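(* Let $F \in \mathbb{Z}[x, y]$ be an irreducible binary form of degree $d \geq 3$. Let $\alpha$ be a root of $F(x, 1)$ and assume that the field extension $\mathbb{Q}(\alpha)/\mathbb{Q}$ is Galois. For a positive integer $m$ consider the Thue inequality $$ 0 < |F(x, y)| \leq m $$ in integers $x, y$. Let $\mu$ be a real number such that $(d/2) + 1 < \mu < d$. There exists a computable positive real number $C_5$, which depends only on $m$, $F$ and $\mu$, such that the number of primitive solutions $(x, y) \in \mathbb{Z}^2$ to this inequality with $H(x, y) \geq C_5$ does not exceed $$ \#\operatorname{Aut}'|F| \cdot \left\lfloor 1 + \frac{11.51 + 1.5\log d + \log \mu}{\log(\mu - d/2)}\right\rfloor. $$ Here the solutions $(x, y)$ and $(-x, -y)$ are regarded as the same.
   Context: A solution $(x,y) \in \mathbb{Z}^2$ is primitive if $x$ and $y$ are coprime. $H(x, y) = \max(|x|, |y|)$, and $\log$ is the natural logarithm. For a $2\times 2$ matrix $M = \begin{pmatrix} s & u \\ t & v\end{pmatrix}$ with complex entries, define the binary form $F_M(x, y) = F(sx + uy, tx + vy)$. Let $\overline{\mathbb{Q}}$ be the algebraic closure of $\mathbb{Q}$ and let $\operatorname{Aut}_{\overline{\mathbb{Q}}}|F|$ be the set of all $M \in \operatorname{M}_2(\overline{\mathbb{Q}})$ such that $F_M = F$ or $F_M = -F$. The enhanced automorphism group of $F$ is $$ \operatorname{Aut}'|F| = \left\{\frac{1}{\sqrt{|sv - tu|}}\begin{pmatrix} s & u \\ t & v\end{pmatrix} : s, t, u, v \in \mathbb{Z}\right\}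 \cap \operatorname{Aut}_{\overline{\mathbb{Q}}}|F|, $$ where only $s,t,u,v$ with $sv - tu \neq 0$ are considered. It is a finite group under matrix multiplication. *)

theory Defs
  imports "HOL-Analysis.Analysis" "HOL-Computational_Algebra.Polynomial_Factorial"
    "HOL-Library.Nat_Bijection"
begin

text \<open>An element \<open>F\<close> of \<open>R[x,y]\<close> is represented as an element of \<open>R[y][x]\<close>: the coefficient
  of \<open>x^i y^j\<close> is \<open>coeff (coeff F i) j\<close>.\<close>

definition binary_form :: "nat \<Rightarrow> 'a::zero poly poly \<Rightarrow> bool" where
  "binary_form d F \<longleftrightarrow> F \<noteq> 0 \<and> (\<forall>i j. coeff (coeff F i) j \<noteq> 0 \<longrightarrow> i + j = d)"

definition form_eval :: "'a::comm_semiring_0 poly poly \<Rightarrow> 'a \<Rightarrow> 'a \<Rightarrow> 'a" where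
  "form_eval F x y = poly (poly F [:x:]) y"

definition map_form :: "('a::zero \<Rightarrow> 'b::zero) \<Rightarrow> 'a poly poly \<Rightarrow> 'b poly poly" where
  "map_form h F = map_poly (map_poly h) F"

text \<open>A form in \<open>\<int>[x,y]\<close> is irreducible if it is irreducible in \<open>\<rat>[x,y]\<close>; a nontrivial integer
  content is allowed.\<close>

definition irreducible_form :: "int poly poly \<Rightarrow> bool" where
  "irreducible_form F \<longleftrightarrow> irreducible (map_form rat_of_int F)"

definition height :: "int \<Rightarrow> int \<Rightarrow> int" where
  "height x y = max \<bar>x\<bar> \<bar>y\<bar>"

definition mat2 :: "complex \<Rightarrow> complex \<Rightarrow> complex \<Rightarrow> complex \<Rightarrow> complex^2^2" where
  "mat2 s u t v = vector [vector [s, u], vector [t, v]]"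

text \<open>\<open>F(s x + u y, t x + v y)\<close> for the matrix with rows \<open>(s, u)\<close> and \<open>(t, v)\<close>, computed as a
  polynomial: the coefficients of \<open>F\<close> are embedded as constants into \<open>\<complex>[y][x]\<close>, where
  \<open>[:[:0, u:], [:s:]:]\<close> is \<open>s x + u y\<close>.\<close>

definition form_subst :: "complex poly poly \<Rightarrow> complex^2^2 \<Rightarrow> complex poly poly" where
  "form_subst F M = form_eval (map_form (\<lambda>c. [:[:c:]:]) F)
     [:[:0, M $ 1 $ 2:], [:M $ 1 $ 1:]:] [:[:0, M $ 2 $ 2:], [:M $ 2 $ 1:]:]"

text \<open>\<open>\<rat>\<close>-bar is the set of algebraic numbers in \<open>\<complex>\<close>.\<close>

definition Aut_Qbar :: "int poly poly \<Rightarrow> (complex^2^2) set" where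
  "Aut_Qbar F = {M. (\<forall>i j. algebraic (M $ i $ j)) \<and>
     (form_subst (map_form of_int F) M = map_form of_int F \<or>
      form_subst (map_form of_int F) M = - map_form of_int F)}"

definition Aut_enh :: "int poly poly \<Rightarrow> (complex^2^2) set" where
  "Aut_enh F =
     {(1 / sqrt (real_of_int \<bar>s * v - t * u\<bar>)) *\<^sub>R mat2 (of_int s) (of_int u) (of_int t) (of_int v)
       | s t u v :: int. s * v - t * u \<noteq> 0} \<inter> Aut_Qbar F"

definition subfield_of_C :: "complex set \<Rightarrow> bool" where
  "subfield_of_C K \<longleftrightarrow> 0 \<in> K \<and> 1 \<in> K \<and> (\<forall>x\<in>K. - x \<in> K \<and> inverse x \<in> K) \<and>
     (\<forall>x\<in>K. \<forall>y\<in>K. x + y \<in> K \<and> x * y \<in> K)"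

definition adjoin :: "complex set \<Rightarrow> complex \<Rightarrow> complex set" where
  "adjoin K \<alpha> = \<Inter>{L. subfield_of_C L \<and> K \<subseteq> L \<and> \<alpha> \<in> L}"

definition polys_over :: "complex set \<Rightarrow> complex poly set" where
  "polys_over K = {p. \<forall>i. coeff p i \<in> K}"

definition irreducible_over :: "complex set \<Rightarrow> complex poly \<Rightarrow> bool" where
  "irreducible_over K p \<longleftrightarrow> p \<in> polys_over K \<and> degree p > 0 \<and>
     (\<forall>q\<in>polys_over K. \<forall>r\<in>polys_over K. p = q * r \<longrightarrow> degree q = 0 \<or> degree r = 0)"

definition splits_over :: "complex set \<Rightarrow> complex poly \<Rightarrow> bool" where
  "splits_over L p \<longleftrightarrow> (\<exists>c\<in>L. \<exists>rs. set rs \<subseteq> L \<and> p = smult c (\<Prod>r\<leftarrow>rs. [:- r, 1:]))"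

definition algebraic_ext :: "complex set \<Rightarrow> complex set \<Rightarrow> bool" where
  "algebraic_ext K L \<longleftrightarrow> (\<forall>z\<in>L. \<exists>p\<in>polys_over K. p \<noteq> 0 \<and> poly p z = 0)"

definition normal_ext :: "complex set \<Rightarrow> complex set \<Rightarrow> bool" where
  "normal_ext K L \<longleftrightarrow>
     (\<forall>p. irreducible_over K p \<and> (\<exists>z\<in>L. poly p z = 0) \<longrightarrow> splits_over L p)"

definition separable_ext :: "complex set \<Rightarrow> complex set \<Rightarrow> bool" where
  "separable_ext K L \<longleftrightarrow>
     (\<forall>p. irreducible_over K p \<and> (\<exists>z\<in>L. poly p z = 0) \<longrightarrow> rsquarefree p)"

definition galois_ext :: "complex set \<Rightarrow> complex set \<Rightarrow> bool" where
  "galois_ext K L \<longleftrightarrow> subfield_of_C K \<and> subfield_of_C L \<and> K \<subseteq> L \<and>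
     algebraic_ext K L \<and> normal_ext K L \<and> separable_ext K L"

text \<open>Partial recursive functions relative to an oracle \<open>\<phi> :: nat \<Rightarrow> nat\<close>.\<close>

datatype recf =
    Zero
  | Succ
  | Proj nat
  | Oracle
  | Comp recf "recf list"
  | PrimRec recf recf
  | Mu recf

inductive rec_eval :: "(nat \<Rightarrow> nat) \<Rightarrow> recf \<Rightarrow> nat list \<Rightarrow> nat \<Rightarrow> bool" for \<phi> where
  zero: "rec_eval \<phi> Zero xs 0"
| succ: "rec_eval \<phi> Succ [x] (Suc x)"
| proj: "i < length xs \<Longrightarrow> rec_eval \<phi> (Proj i) xs (xs ! i)"
| orac: "rec_eval \<phi> Oracle [x] (\<phi> x)"
| comp: "length ys = length gs \<Longrightarrow> (\<forall>i<length gs. rec_eval \<phi> (gs ! i) xs (ys ! i)) \<Longrightarrow>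
    rec_eval \<phi> f ys z \<Longrightarrow> rec_eval \<phi> (Comp f gs) xs z"
| prim_0: "rec_eval \<phi> f xs y \<Longrightarrow> rec_eval \<phi> (PrimRec f g) (0 # xs) y"
| prim_Suc: "rec_eval \<phi> (PrimRec f g) (n # xs) r \<Longrightarrow> rec_eval \<phi> g (n # r # xs) y \<Longrightarrow>
    rec_eval \<phi> (PrimRec f g) (Suc n # xs) y"
| mu: "rec_eval \<phi> f (n # xs) 0 \<Longrightarrow> (\<forall>k<n. \<exists>y. rec_eval \<phi> f (k # xs) (Suc y)) \<Longrightarrow>
    rec_eval \<phi> (Mu f) xs n"

definition dyadic_name :: "(nat \<Rightarrow> int) \<Rightarrow> real \<Rightarrow> bool" where
  "dyadic_name q \<mu> \<longleftrightarrow> (\<forall>k. \<bar>of_int (q k) / 2 ^ k - \<mu>\<bar> \<le> 1 / 2 ^ k)"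

definition encode_form :: "int poly poly \<Rightarrow> nat" where
  "encode_form F = list_encode (map (\<lambda>p. list_encode (map int_encode (coeffs p))) (coeffs F))"

text \<open>The program \<open>P\<close> computes the real number \<open>c\<close> from the input data \<open>m\<close>, \<open>F\<close> and \<open>\<mu>\<close>. As usual
  in computable analysis, the real input \<open>\<mu>\<close> is given by an oracle for dyadic approximations, and
  a dyadic approximation of \<open>c\<close> to any requested precision \<open>2^-n\<close> must be returned, whichever
  approximations of \<open>\<mu>\<close> are supplied.\<close>

definition computes_from :: "recf \<Rightarrow> nat \<Rightarrow> int poly poly \<Rightarrow> real \<Rightarrow> real \<Rightarrow> bool" where
  "computes_from P m F \<mu> c \<longleftrightarrow>
     (\<forall>q. dyadic_name q \<mu> \<longrightarrow>
       (\<forall>n. \<exists>z::int. rec_eval (\<lambda>k. int_encode (q k)) P [m, encode_form F, n] (int_encode z) \<and>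
          \<bar>of_int z / 2 ^ n - c\<bar> \<le> 1 / 2 ^ n))"

definition primitive_solutions :: "nat \<Rightarrow> int poly poly \<Rightarrow> real \<Rightarrow> (int \<times> int) set" where
  "primitive_solutions m F C = {(x, y). 0 < \<bar>form_eval F x y\<bar> \<and> \<bar>form_eval F x y\<bar> \<le> int m \<and>
     coprime x y \<and> real_of_int (height x y) \<ge> C}"

definition up_to_sign :: "(int \<times> int) set \<Rightarrow> (int \<times> int) set set" where
  "up_to_sign S = (\<lambda>(x, y). {(x, y), (- x, - y)}) ` S"

end

theory Submission
  imports Defs "Jordan_Normal_Form.Char_Poly" "HOL-Computational_Algebra.Field_as_Ring"
begin

text \<open>A large primitive solution \<open>(x, y)\<close> gives an approximation \<open>x/y\<close> to some root of \<open>F(x, 1)\<close> with error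
  \<open>O(H\<^bsup>-d\<^esup>)\<close>. Let \<open>x\<^sub>1/y\<^sub>1\<close> and \<open>x\<^sub>2/y\<^sub>2\<close> approximate the roots \<open>\<alpha>\<close> and \<open>\<beta>\<close>. As \<open>\<beta> \<in> \<rat>(\<alpha>)\<close>, Siegel's lemma
  provides integer polynomials \<open>A\<close>, \<open>B\<close> of degree about \<open>d n / 2\<close> such that \<open>A - \<beta> B\<close> vanishes to order
  \<open>n\<close> at \<open>\<alpha>\<close>.

  For \<open>n = 1\<close>, either \<open>A(x\<^sub>1/y\<^sub>1) \<noteq> (x\<^sub>2/y\<^sub>2) B(x\<^sub>1/y\<^sub>1)\<close>, which forces \<open>H\<^sub>2 \<ge> c H\<^sub>1\<^bsup>d/2\<^esup>\<close>, or \<open>A/B\<close> takes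
  \<open>x\<^sub>1/y\<^sub>1\<close> to \<open>x\<^sub>2/y\<^sub>2\<close>. In the latter case \<open>H\<^sub>2\<close> is comparable to \<open>H\<^sub>1\<close>, \<open>A/B\<close> reduces to a Moebius
  transformation, and this is an element of the enhanced automorphism group up to scaling. For large
  \<open>n\<close>, Thue's argument (with the Wronskian of \<open>A\<close> and \<open>B\<close> for the nonvanishing) yields
  \<open>H\<^sub>2 < H\<^sub>1\<^sup>K\<close> with \<open>K = 100 d\<^sup>2\<close>. Hence solutions that are pairwise unrelated by automorphisms have
  heights growing at least with exponent \<open>d/2 - 1/16\<close> and at most by the exponent \<open>K\<close> in total, which
  leaves room for \<open>\<lfloor>1 + log K / log (d/2 - 1/16)\<rfloor>\<close> of them.

  All constants are powers of the size of \<open>m\<close> and \<open>F\<close> with exponents polynomial in \<open>d\<close>. The constant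
  11.51 leaves so much room that a threshold independent of \<open>\<mu>\<close> suffices; an iterated power of 2
  is chosen because it is easy to compute.\<close>

section \<open>Hasse derivatives and Wronskians\<close>

text \<open>Vanishing to order \<open>n\<close> at \<open>\<alpha>\<close> and, through conjugation,
  at all \<open>d\<close> roots imposes \<open>d n\<close> rational conditions, while a pair of
  polynomials of degree at most \<open>N\<close> has \<open>2 N + 2\<close> coefficients; this is
  the origin of \<open>d n / 2\<close>. The value of \<open>A - (x2/y2) B\<close> at
  \<open>x1/y1\<close> has a denominator of size at most \<open>H1^N H2\<close>, so for
  \<open>n = 1\<close> a nonzero value gives \<open>H1^(d - d/2)\<close> at most about
  \<open>H2\<close>. The obstacle is a zero value. For large \<open>n\<close> one passes to a
  derivative, but for \<open>n = 1\<close> this would lose the only order of vanishing, so the zero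
  value needs a meaning of its own: comparable heights leave room for a second pair of degree up to
  \<open>d - 2\<close>, and its existence shows that the first pair has degree at most 1 in lowest
  terms. The box principle rounds real numbers, one for each root and order. This suffices because a
  root approximated so well by rationals must be real, and in a Galois field one real root makes all
  roots real.\<close>

hide_const (open) module.smult

text \<open>The Hasse derivative, the \<open>l\<close>-th derivative divided by \<open>l!\<close>.
  It keeps integer coefficients integral and enlarges them by at most \<open>2 ^ N\<close>; a
  factorial would spoil the exponential bounds that Thue's argument needs.\<close>

definition hasse :: "nat \<Rightarrow> 'a::comm_semiring_1 poly \<Rightarrow> 'a poly" where
  "hasse l p = Abs_poly (\<lambda>i. of_nat ((i + l) choose l) * coeff p (i + l))"

lemma coeff_hasse [simp]: "coeff (hasse l p) i = of_nat ((i + l) choose l) * coeff p (i + l)"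
  unfolding hasse_def
  by (subst coeff_Abs_poly[where n = "degree p"]) (auto simp: coeff_eq_0)

lemma hasse_0 [simp]: "hasse 0 p = p"
  by (rule poly_eqI) simp

lemma hasse_zero [simp]: "hasse l 0 = 0"
  by (rule poly_eqI) simp

lemma hasse_1: "hasse 1 p = pderiv (p :: 'a::{comm_semiring_1,semiring_no_zero_divisors} poly)"
  by (rule poly_eqI) (simp add: coeff_pderiv)

lemma hasse_diff: "hasse l (p - q) = hasse l p - hasse l (q :: 'a::comm_ring_1 poly)"
  by (rule poly_eqI) (simp add: algebra_simps)

lemma hasse_smult: "hasse l (smult c p) = smult c (hasse l p)"
  by (rule poly_eqI) (simp add: algebra_simps)

lemma degree_hasse: "degree (hasse l p) \<le> degree p - l"
  by (rule degree_le) (auto simp: coeff_eq_0)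

lemma hasse_hasse: "hasse i (hasse l p) = smult (of_nat ((i + l) choose l)) (hasse (i + l) p)"
proof (rule poly_eqI)
  fix j
  have "((j + i) choose i) * ((j + i + l) choose l) = ((i + l) choose l) * ((j + (i + l)) choose (i + l))"
    using choose_mult[of l "i + l" "j + i + l"] by (simp add: ac_simps)
  then have "of_nat ((j + i) choose i) * of_nat ((j + i + l) choose l)
      = (of_nat ((i + l) choose l) * of_nat ((j + (i + l)) choose (i + l)) :: 'a)"
    by (metis of_nat_mult)
  then show "coeff (hasse i (hasse l p)) j = coeff (smult (of_nat ((i + l) choose l)) (hasse (i + l) p)) j"
    by (simp add: add.assoc flip: mult.assoc)
qed

lemma map_poly_hasse_of_int: "map_poly of_int (hasse l p) = (hasse l (map_poly of_int p) :: 'a::comm_ring_1 poly)"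
  by (rule poly_eqI) (simp add: coeff_map_poly)

lemma poly_taylor:
  assumes "degree p \<le> N"
  shows "poly p (a + h) = (\<Sum>l\<le>N. poly (hasse l p) a * h ^ l)"
proof -
  have ex: "poly q x = (\<Sum>i\<le>N. coeff q i * x ^ i)" if "degree q \<le> N" for q :: "'a poly" and x
    using that by (subst poly_altdef) (intro sum.mono_neutral_left, auto simp: coeff_eq_0)
  have "poly p (a + h) = (\<Sum>i\<le>N. coeff p i * (\<Sum>l\<le>i. of_nat (i choose l) * h ^ l * a ^ (i - l)))"
    unfolding ex[OF assms] by (subst add.commute) (simp add: binomial_ring)
  also have "\<dots> = (\<Sum>i\<le>N. \<Sum>l\<le>N. if l \<le> i then coeff p i * of_nat (i choose l) * h ^ l * a ^ (i - l) else 0)"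
    unfolding sum_distrib_left by (intro sum.cong refl sum.mono_neutral_cong_left) (auto simp: mult.assoc)
  also have "\<dots> = (\<Sum>l\<le>N. \<Sum>i\<le>N. if l \<le> i then coeff p i * of_nat (i choose l) * h ^ l * a ^ (i - l) else 0)"
    by (rule sum.swap)
  also have "\<dots> = (\<Sum>l\<le>N. poly (hasse l p) a * h ^ l)"
  proof (intro sum.cong refl)
    fix l assume "l \<in> {..N}"
    have z: "coeff p (i + l) = 0" if "\<not> i \<le> N - l" for i
      using assms that by (intro coeff_eq_0) linarith
    have "(\<Sum>i\<le>N. if l \<le> i then coeff p i * of_nat (i choose l) * h ^ l * a ^ (i - l) else 0)
        = (\<Sum>i\<in>{l..N}. coeff p i * of_nat (i choose l) * h ^ l * a ^ (i - l))"
      by (auto intro!: sum.mono_neutral_cong_right)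
    also have "\<dots> = (\<Sum>i\<le>N - l. coeff p (i + l) * of_nat ((i + l) choose l) * h ^ l * a ^ i)"
      using \<open>l \<in> {..N}\<close> by (intro sum.reindex_bij_witness[of _ "\<lambda>i. i + l" "\<lambda>i. i - l"]) auto
    also have "\<dots> = (\<Sum>i\<le>N. coeff (hasse l p) i * a ^ i) * h ^ l"
      unfolding sum_distrib_right using assms
      by (intro sum.mono_neutral_cong_left ballI) (simp_all add: algebra_simps z)
    also have "\<dots> = poly (hasse l p) a * h ^ l"
      using ex[of "hasse l p" a] degree_hasse[of l p] assms by simp
    finally show "(\<Sum>i\<le>N. if l \<le> i then coeff p i * of_nat (i choose l) * h ^ l * a ^ (i - l) else 0)
        = poly (hasse l p) a * h ^ l" .
  qed
  finally show ?thesis .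
qed

text \<open>By \<open>poly_taylor\<close> the polynomial is the sum of its Taylor terms in powers of
  \<open>[:- a, 1:]\<close>. Agreement as functions is agreement as polynomials in characteristic 0,
  and the terms below \<open>n\<close> drop out.\<close>

lemma dvd_of_hasse_vanish:
  fixes p :: "'a::{idom,ring_char_0} poly"
  assumes "\<And>l. l < n \<Longrightarrow> poly (hasse l p) a = 0"
  shows "[:- a, 1:] ^ n dvd p"
proof -
  define N where "N = degree p"
  have "poly p = poly (\<Sum>l\<le>N. smult (poly (hasse l p) a) ([:- a, 1:] ^ l))"
  proof
    fix x
    show "poly p x = poly (\<Sum>l\<le>N. smult (poly (hasse l p) a) ([:- a, 1:] ^ l)) x"
      using poly_taylor[of p N a "x - a"] by (simp add: N_def poly_sum poly_power)
  qed
  then have "p = (\<Sum>l\<le>N. smult (poly (hasse l p) a) ([:- a, 1:] ^ l))"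
    by (simp only: poly_eq_poly_eq_iff)
  moreover have "[:- a, 1:] ^ n dvd smult (poly (hasse l p) a) ([:- a, 1:] ^ l)" for l
    using assms[of l] by (cases "l < n") (auto intro!: dvd_smult le_imp_power_dvd)
  ultimately show ?thesis by (metis (no_types, lifting) dvd_sum)
qed

definition wronskian :: "'a::idom poly \<Rightarrow> 'a poly \<Rightarrow> 'a poly" where
  "wronskian A B = A * pderiv B - pderiv A * B"

text \<open>This invariance turns a condition on \<open>A - smult c B\<close>, with irrational
  \<open>c\<close> in the applications, into one on \<open>wronskian A B\<close>, which does not
  involve \<open>c\<close>.\<close>

lemma wronskian_diff_smult: "wronskian (A - smult c B) B = wronskian A B"
  by (simp add: wronskian_def pderiv_diff pderiv_smult algebra_simps)

lemma linear_power_dvd_pderiv: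
  assumes "[:- a, 1:] ^ Suc n dvd p"
  shows "[:- a, 1:] ^ n dvd pderiv (p :: 'a::idom poly)"
proof -
  obtain q where "p = [:- a, 1:] ^ Suc n * q" using assms by blast
  then have "pderiv p = [:- a, 1:] ^ n * (smult (of_nat (Suc n)) q + [:- a, 1:] * pderiv q)"
    unfolding pderiv_mult pderiv_power_Suc
    by (simp del: mult_pCons_left mult_pCons_right add: pderiv_mult pderiv_power_Suc pderiv_pCons ring_distribs mult_ac smult_add_right flip: power_Suc one_pCons)
  then show ?thesis by simp
qed

lemma linear_power_dvd_wronskian:
  assumes "[:- a, 1:] ^ n dvd A - smult c B"
  shows "[:- a, 1:] ^ (n - 1) dvd wronskian A B"
proof (cases n)
  case (Suc k)
  have "[:- a, 1:] ^ k dvd pderiv (A - smult c B)"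
    using linear_power_dvd_pderiv assms Suc by blast
  moreover have "[:- a, 1:] ^ k dvd A - smult c B"
    using assms Suc by (metis dvd_trans le_imp_power_dvd lessI less_imp_le)
  ultimately have "[:- a, 1:] ^ k dvd wronskian (A - smult c B) B"
    unfolding wronskian_def by simp
  then show ?thesis by (simp add: Suc wronskian_diff_smult)
qed simp

text \<open>The coefficient of degree \<open>degree A + degree B - 1\<close> is
  \<open>degree B - degree A\<close> times the product of the leading coefficients; in
  characteristic 0 it vanishes only for equal degrees.\<close>

lemma wronskian_0_degree_eq:
  fixes A B :: "'a::field_char_0 poly"
  assumes "wronskian A B = 0" "A \<noteq> 0" "B \<noteq> 0"
  shows "degree A = degree B"
proof (rule ccontr)
  assume ne: "degree A \<noteq> degree B"
  define a b where "a = degree A" and "b = degree B"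
  have top: "coeff (A * pderiv B) (a + b - 1) = of_nat b * lead_coeff A * lead_coeff B"
    if "A \<noteq> 0" "B \<noteq> 0" "a = degree A" "b = degree B" for A B :: "'a poly" and a b
  proof (cases "b = 0")
    case True
    then show ?thesis using that by (auto elim!: degree_eq_zeroE simp: pderiv_pCons)
  next
    case False
    then have "coeff (A * pderiv B) (degree A + degree (pderiv B)) = lead_coeff A * lead_coeff (pderiv B)"
      by (simp only: coeff_mult_degree_sum)
    moreover have "degree (pderiv B) = b - 1" using that by (simp add: degree_pderiv)
    ultimately show ?thesis using False that by (simp add: coeff_pderiv)
  qed
  have "coeff (wronskian A B) (a + b - 1) = (of_nat b - of_nat a) * lead_coeff A * lead_coeff B"
    using top[OF assms(2,3) a_def b_def] top[OF assms(3,2) b_def a_def]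
    by (simp add: wronskian_def algebra_simps)
  then show False using assms ne by (simp add: a_def b_def)
qed

text \<open>Subtracting the multiple of \<open>B\<close> that cancels the leading coefficient of
  \<open>A\<close> preserves the Wronskian but destroys the equality of degrees, unless nothing
  remains.\<close>

lemma wronskian_0_imp_proportional:
  fixes A B :: "'a::field_char_0 poly"
  assumes "wronskian A B = 0" "B \<noteq> 0"
  shows "\<exists>c. A = smult c B"
proof (cases "A = 0")
  case True then show ?thesis by (intro exI[of _ 0]) simp
next
  case False
  have deg: "degree A = degree B" by (rule wronskian_0_degree_eq) (use assms False in auto)
  define c where "c = lead_coeff A / lead_coeff B"
  define D where "D = A - smult c B"
  have "D = 0"
  proof (rule ccontr)
    assume "D \<noteq> 0"
    moreover have "wronskian D B = 0" using assms by (simp add: D_def wronskian_diff_smult)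
    ultimately have "degree D = degree B" using wronskian_0_degree_eq assms by blast
    moreover have "coeff D (degree B) = 0"
      using assms deg by (simp add: D_def c_def)
    ultimately show False using \<open>D \<noteq> 0\<close> by (metis leading_coeff_0_iff)
  qed
  then show ?thesis by (auto simp: D_def)
qed

lemma degree_wronskian:
  assumes "degree A \<le> N" "degree B \<le> N"
  shows "degree (wronskian A B) \<le> 2 * N - 1"
proof (cases N)
  case 0
  then show ?thesis using assms by (auto elim!: degree_eq_zeroE simp: wronskian_def pderiv_pCons)
next
  case (Suc k)
  have "degree (pderiv A) \<le> k" "degree (pderiv B) \<le> k"
    using assms Suc by (auto intro!: order.trans[OF degree_pderiv_le])
  then have "degree (A * pderiv B) \<le> N + k" "degree (pderiv A * B) \<le> N + k"
    using assms by (auto intro!: order.trans[OF degree_mult_le])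
  then show ?thesis unfolding wronskian_def using Suc
    by (intro degree_diff_le) auto
qed

text \<open>\<open>A * pderiv B\<close> and \<open>pderiv A * B\<close> have the same coefficient in
  degree \<open>2 * N - 1\<close>, namely \<open>N\<close> times the product of the coefficients of
  degree \<open>N\<close>.\<close>

lemma degree_wronskian':
  fixes A B :: "'a::{idom, semiring_char_0} poly"
  assumes "degree A \<le> N" "degree B \<le> N"
  shows "degree (wronskian A B) \<le> 2 * N - 2"
proof (cases "N = 0")
  case True
  then show ?thesis using degree_wronskian[OF assms] by simp
next
  case False
  obtain k where N: "N = Suc k" using False by (cases N) auto
  have le: "degree (pderiv A) \<le> k" "degree (pderiv B) \<le> k"
    using assms N by (auto intro!: order.trans[OF degree_pderiv_le])
  have top: "coeff (P * Q) (N + k) = coeff P N * coeff Q k" if "degree P \<le> N" "degree Q \<le> k" for P Q :: "'a poly"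
  proof -
    have "coeff P i * coeff Q (N + k - i) = (if i = N then coeff P N * coeff Q k else 0)" for i
      using that by (cases i N rule: linorder_cases) (auto simp: coeff_eq_0)
    then show ?thesis by (simp add: coeff_mult)
  qed
  have "coeff (wronskian A B) (N + k) = 0"
    using top[OF assms(1) le(2)] top[OF assms(2) le(1)] N
    by (simp add: wronskian_def coeff_pderiv mult.commute[of "pderiv A"] algebra_simps)
  moreover have "degree (wronskian A B) \<le> N + k" using degree_wronskian[OF assms] N by simp
  ultimately have "wronskian A B = 0 \<or> degree (wronskian A B) < N + k"
    by (metis le_neq_implies_less leading_coeff_0_iff)
  then show ?thesis using N by auto
qed

section \<open>Algebraic integers\<close>

text \<open>\<open>x\<close> is an eigenvalue of an integer matrix, hence a root of its
  characteristic polynomial, which is monic and integral.\<close>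

lemma algebraic_int_of_eigenvector:
  fixes x :: complex and v :: "nat \<Rightarrow> complex" and M :: "nat \<Rightarrow> nat \<Rightarrow> int"
  assumes "\<And>i. i < n \<Longrightarrow> x * v i = (\<Sum>j<n. of_int (M i j) * v j)" and "i0 < n" "v i0 \<noteq> 0"
  shows "algebraic_int x"
proof -
  define A where "A = mat n n (\<lambda>(i, j). M i j)"
  have A: "A \<in> carrier_mat n n" by (simp add: A_def)
  define A' where "A' = (map_mat of_int A :: complex mat)"
  have A': "A' \<in> carrier_mat n n" by (simp add: A'_def A_def)
  have "A' *\<^sub>v vec n v = x \<cdot>\<^sub>v vec n v"
    by (rule eq_vecI)
       (simp_all add: A'_def A_def scalar_prod_def assms(1) atLeast0LessThan)
  moreover have "vec n v \<noteq> 0\<^sub>v n"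
    using assms(2,3) by (metis index_vec index_zero_vec(1))
  ultimately have "eigenvector A' (vec n v) x"
    using A' by (simp add: eigenvector_def)
  then have "poly (char_poly A') x = 0"
    using eigenvalue_root_char_poly[OF A', of x] by (auto simp: eigenvalue_def)
  moreover have "char_poly A' = map_poly of_int (char_poly A)"
    unfolding A'_def by (rule of_int_hom.char_poly_hom[OF A])
  moreover have "monic (char_poly A)"
    using degree_monic_char_poly[OF A] by simp
  ultimately show ?thesis unfolding algebraic_int_altdef_ipoly by metis
qed

text \<open>The additive group generated by the family \<open>v\<close>. Algebraic integers are
  recognized as the numbers that multiply some nonzero finitely generated group of this kind into
  itself.\<close>

definition int_span :: "'i set \<Rightarrow> ('i \<Rightarrow> complex) \<Rightarrow> complex set" where
  "int_span I v = {(\<Sum>j\<in>I. of_int (c j) * v j) | c :: 'i \<Rightarrow> int. True}"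

lemma int_span_base: "finite I \<Longrightarrow> i \<in> I \<Longrightarrow> v i \<in> int_span I v"
  unfolding int_span_def
  by (rule CollectI, rule exI[of _ "\<lambda>j. if j = i then 1 else 0"])
     (simp add: if_distrib[of of_int] if_distrib[of "\<lambda>u. u * _"] cong: if_cong)

lemma int_span_add: "a \<in> int_span I v \<Longrightarrow> b \<in> int_span I v \<Longrightarrow> a + b \<in> int_span I v"
proof -
  assume "a \<in> int_span I v" "b \<in> int_span I v"
  then obtain c d where "a = (\<Sum>j\<in>I. of_int (c j) * v j)" "b = (\<Sum>j\<in>I. of_int (d j) * v j)"
    unfolding int_span_def by blast
  then have "a + b = (\<Sum>j\<in>I. of_int (c j + d j) * v j)" by (simp add: sum.distrib algebra_simps)
  then show ?thesis unfolding int_span_def by (intro CollectI exI[of _ "\<lambda>j. c j + d j"]) simp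
qed

lemma int_span_smult: "a \<in> int_span I v \<Longrightarrow> of_int k * a \<in> int_span I v"
proof -
  assume "a \<in> int_span I v"
  then obtain c where "a = (\<Sum>j\<in>I. of_int (c j) * v j)"
    unfolding int_span_def by blast
  then have "of_int k * a = (\<Sum>j\<in>I. of_int (k * c j) * v j)" by (simp add: sum_distrib_left algebra_simps)
  then show ?thesis unfolding int_span_def by (intro CollectI exI[of _ "\<lambda>j. k * c j"]) simp
qed

lemma int_span_0: "0 \<in> int_span I v"
  unfolding int_span_def by (rule CollectI, rule exI[of _ "\<lambda>_. 0"]) simp

lemma int_span_sum: "(\<And>k. k \<in> K \<Longrightarrow> g k \<in> int_span I v) \<Longrightarrow> (\<Sum>k\<in>K. g k) \<in> int_span I v"
  by (induction K rule: infinite_finite_induct) (auto intro: int_span_0 int_span_add)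

lemma int_span_mult:
  assumes "\<And>i. i \<in> I \<Longrightarrow> x * v i \<in> int_span I v" and "a \<in> int_span I v"
  shows "x * a \<in> int_span I v"
proof -
  obtain c where "a = (\<Sum>j\<in>I. of_int (c j) * v j)" using assms(2) unfolding int_span_def by blast
  then have "x * a = (\<Sum>j\<in>I. of_int (c j) * (x * v j))" by (simp add: sum_distrib_left algebra_simps)
  then show ?thesis using assms(1) by (auto intro!: int_span_sum int_span_smult)
qed

lemma algebraic_int_of_int_span:
  fixes x :: complex
  assumes fin: "finite I" and st: "\<And>i. i \<in> I \<Longrightarrow> x * v i \<in> int_span I v" and "i0 \<in> I" "v i0 \<noteq> 0"
  shows "algebraic_int x"
proof -
  obtain h where h: "bij_betw h {..<card I} I"
    using ex_bij_betw_nat_finite[OF fin] by (auto simp: atLeast0LessThan)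
  have "\<forall>i\<in>I. \<exists>c :: _ \<Rightarrow> int. x * v i = (\<Sum>j\<in>I. of_int (c j) * v j)"
    using st unfolding int_span_def by blast
  then obtain c :: "_ \<Rightarrow> _ \<Rightarrow> int" where c: "\<And>i. i \<in> I \<Longrightarrow> x * v i = (\<Sum>j\<in>I. of_int (c i j) * v j)"
    by metis
  obtain k where k: "k < card I" "h k = i0" using h \<open>i0 \<in> I\<close> by (metis bij_betw_imp_surj_on imageE lessThan_iff)
  show ?thesis
  proof (rule algebraic_int_of_eigenvector)
    fix i assume "i < card I"
    then have "h i \<in> I" using h unfolding bij_betw_def by auto
    then show "x * (v \<circ> h) i = (\<Sum>j<card I. of_int (c (h i) (h j)) * (v \<circ> h) j)"
      using c sum.reindex_bij_betw[OF h, of "\<lambda>j. of_int (c (h i) j) * v j"] by simp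
  qed (use k assms in auto)
qed

text \<open>The products \<open>x ^ i * y ^ j\<close> with exponents below the degrees of monic
  equations for \<open>x\<close> and \<open>y\<close> span the ring generated by both, so one module
  serves the sum and the product alike.\<close>

lemma int_span_monomials:
  fixes x y :: complex
  assumes "algebraic_int x" "algebraic_int y"
  obtains I :: "(nat \<times> nat) set" and v i0 where "finite I" "i0 \<in> I" "v i0 \<noteq> 0"
    "\<And>i. i \<in> I \<Longrightarrow> x * v i \<in> int_span I v" "\<And>i. i \<in> I \<Longrightarrow> y * v i \<in> int_span I v"
proof -
  have red: "\<exists>n>0. \<exists>c::nat \<Rightarrow> int. z ^ n = (\<Sum>k<n. of_int (c k) * z ^ k)"
    if "algebraic_int z" for z :: complex
  proof -
    from that obtain p where p: "poly (of_int_poly p) z = 0" "monic p"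
      unfolding algebraic_int_altdef_ipoly by blast
    have "degree p > 0"
      using p by (intro Nat.gr0I) (auto elim!: degree_eq_zeroE)
    moreover have "z ^ degree p = (\<Sum>k<degree p. of_int (- coeff p k) * z ^ k)"
    proof -
      have "0 = (\<Sum>k\<le>degree p. of_int (coeff p k) * z ^ k)"
        using p(1) by (simp add: poly_altdef)
      also have "\<dots> = z ^ degree p + (\<Sum>k<degree p. of_int (coeff p k) * z ^ k)"
        using p(2) by (simp flip: lessThan_Suc_atMost)
      finally show ?thesis by (simp add: sum_negf eq_neg_iff_add_eq_0)
    qed
    ultimately show ?thesis by (intro exI[of _ "degree p"] conjI exI[of _ "\<lambda>k. - coeff p k"])
  qed
  obtain a ca where a: "a > 0" "x ^ a = (\<Sum>k<a. of_int (ca k :: int) * x ^ k)" using red[OF assms(1)] by blast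
  obtain b cb where b: "b > 0" "y ^ b = (\<Sum>k<b. of_int (cb k :: int) * y ^ k)" using red[OF assms(2)] by blast
  define I where "I = {..<a} \<times> {..<b}"
  define v where "v = (\<lambda>(i, j). x ^ i * y ^ j)"
  have fin: "finite I" by (simp add: I_def)
  have base: "x ^ i * y ^ j \<in> int_span I v" if "i < a" "j < b" for i j
    using int_span_base[OF fin, of "(i, j)" v] that by (simp add: I_def v_def)
  show thesis
  proof (rule that[of I "(0, 0)" v])
    show "finite I" "(0, 0) \<in> I" "v (0, 0) \<noteq> 0" using fin a b by (auto simp: I_def v_def)
    fix i assume "i \<in> I"
    then obtain k l where i: "i = (k, l)" "k < a" "l < b" by (auto simp: I_def)
    show "x * v i \<in> int_span I v"
    proof (cases "Suc k < a")
      case True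
      then show ?thesis using base[of "Suc k" l] i by (simp add: v_def mult_ac)
    next
      case False
      then have "Suc k = a" using i by simp
      then have "x * v i = x ^ a * y ^ l" using i by (auto simp: v_def)
      also have "\<dots> = (\<Sum>k<a. of_int (ca k) * (x ^ k * y ^ l))"
        by (simp add: a(2) sum_distrib_right mult.assoc)
      also have "\<dots> \<in> int_span I v" using base i by (intro int_span_sum int_span_smult) auto
      finally show ?thesis .
    qed
    show "y * v i \<in> int_span I v"
    proof (cases "Suc l < b")
      case True
      then show ?thesis using base[of k "Suc l"] i by (simp add: v_def mult_ac)
    next
      case False
      then have "Suc l = b" using i by simp
      then have "y * v i = x ^ k * y ^ b" using i by (auto simp: v_def)
      also have "\<dots> = (\<Sum>j<b. of_int (cb j) * (x ^ k * y ^ j))"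
        by (simp add: b(2) sum_distrib_left mult_ac)
      also have "\<dots> \<in> int_span I v" using base i by (intro int_span_sum int_span_smult) auto
      finally show ?thesis .
    qed
  qed
qed

lemma algebraic_int_add:
  fixes x y :: complex
  assumes "algebraic_int x" "algebraic_int y"
  shows "algebraic_int (x + y)"
proof -
  obtain I :: "(nat \<times> nat) set" and v i0 where *: "finite I" "i0 \<in> I" "v i0 \<noteq> 0"
    "\<And>i. i \<in> I \<Longrightarrow> x * v i \<in> int_span I v" "\<And>i. i \<in> I \<Longrightarrow> y * v i \<in> int_span I v"
    using int_span_monomials[OF assms] by metis
  have "(x + y) * v i \<in> int_span I v" if "i \<in> I" for i
    using * that by (simp add: distrib_right int_span_add)
  then show ?thesis using algebraic_int_of_int_span * by metis
qed

lemma algebraic_int_mult: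
  fixes x y :: complex
  assumes "algebraic_int x" "algebraic_int y"
  shows "algebraic_int (x * y)"
proof -
  obtain I :: "(nat \<times> nat) set" and v i0 where *: "finite I" "i0 \<in> I" "v i0 \<noteq> 0"
    "\<And>i. i \<in> I \<Longrightarrow> x * v i \<in> int_span I v" "\<And>i. i \<in> I \<Longrightarrow> y * v i \<in> int_span I v"
    using int_span_monomials[OF assms] by metis
  have "x * y * v i \<in> int_span I v" if "i \<in> I" for i
    using int_span_mult[of I x v "y * v i"] * that by (simp add: mult.assoc)
  then show ?thesis using algebraic_int_of_int_span * by metis
qed

lemma algebraic_int_sum:
  fixes g :: "'i \<Rightarrow> complex"
  shows "(\<And>i. i \<in> I \<Longrightarrow> algebraic_int (g i)) \<Longrightarrow> algebraic_int (\<Sum>i\<in>I. g i)"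
  by (induction I rule: infinite_finite_induct) (auto intro: algebraic_int_add)

lemma algebraic_int_prod:
  fixes g :: "'i \<Rightarrow> complex"
  shows "(\<And>i. i \<in> I \<Longrightarrow> algebraic_int (g i)) \<Longrightarrow> algebraic_int (\<Prod>i\<in>I. g i)"
  by (induction I rule: infinite_finite_induct) (auto intro: algebraic_int_mult int_imp_algebraic_int)

lemma algebraic_int_power: "algebraic_int (x :: complex) \<Longrightarrow> algebraic_int (x ^ n)"
  by (induction n) (auto intro: algebraic_int_mult int_imp_algebraic_int)

lemma algebraic_int_lead_coeff_mult_root:
  fixes z :: complex
  assumes "poly (of_int_poly p) z = 0" "p \<noteq> 0"
  shows "algebraic_int (of_int (lead_coeff p) * z)"
proof (rule algebraic_int_of_int_span[where I = "{..<degree p}"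
      and v = "\<lambda>i. (of_int (lead_coeff p) * z) ^ i" and ?i0.0 = 0])
  define a :: complex where "a = of_int (lead_coeff p)"
  define d where "d = degree p"
  have d: "d > 0" using assms by (intro Nat.gr0I) (auto simp: d_def elim!: degree_eq_zeroE)
  then show "0 \<in> {..<degree p}" by (simp add: d_def)
  fix i assume "i \<in> {..<degree p}"
  then have i: "i < d" by (simp add: d_def)
  have "a * z * (a * z) ^ i \<in> int_span {..<d} (\<lambda>i. (a * z) ^ i)"
  proof (cases "Suc i < d")
    case True
    then show ?thesis using int_span_base[of "{..<d}" "Suc i" "\<lambda>i. (a * z) ^ i"] by simp
  next
    case False
    then have si: "Suc i = d" using i by simp
    have "0 = (\<Sum>k\<le>d. of_int (coeff p k) * z ^ k)"
      using assms(1) by (simp add: poly_altdef d_def)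
    also have "\<dots> = a * z ^ d + (\<Sum>k<d. of_int (coeff p k) * z ^ k)"
      by (simp add: a_def d_def flip: lessThan_Suc_atMost)
    finally have "a * z ^ d = - (\<Sum>k<d. of_int (coeff p k) * z ^ k)"
      by (simp add: eq_neg_iff_add_eq_0)
    \<comment> \<open>As \<open>i = d - 1\<close>, the factor \<open>a ^ i\<close> turns each
      \<open>z ^ k\<close> with \<open>k < d\<close> into an integer multiple of
      \<open>(a * z) ^ k\<close>, and the equation becomes monic in \<open>a * z\<close>.\<close>
    then have "a ^ i * (a * z ^ d) = (\<Sum>k<d. - (a ^ i * (of_int (coeff p k) * z ^ k)))"
      by (simp add: sum_distrib_left sum_negf)
    also have "\<dots> = (\<Sum>k<d. of_int (- coeff p k * lead_coeff p ^ (i - k)) * (a * z) ^ k)"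
    proof (intro sum.cong refl)
      fix k assume "k \<in> {..<d}"
      then have "a ^ i = a ^ (i - k) * a ^ k" using si by (simp flip: power_add)
      then show "- (a ^ i * (of_int (coeff p k) * z ^ k)) = of_int (- coeff p k * lead_coeff p ^ (i - k)) * (a * z) ^ k"
        by (simp add: a_def power_mult_distrib)
    qed
    also have "\<dots> \<in> int_span {..<d} (\<lambda>i. (a * z) ^ i)"
      by (intro int_span_sum int_span_smult) (rule int_span_base, auto)
    finally show ?thesis using si by (auto simp: power_mult_distrib mult_ac)
  qed
  then show "of_int (lead_coeff p) * z * (of_int (lead_coeff p) * z) ^ i
      \<in> int_span {..<degree p} (\<lambda>i. (of_int (lead_coeff p) * z) ^ i)"
    by (simp add: a_def d_def)
qed auto

lemma map_poly_of_rat_mult: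
  "map_poly of_rat (p * q) = map_poly of_rat p * (map_poly of_rat q :: 'a::field_char_0 poly)"
  by (rule poly_eqI) (simp add: coeff_map_poly coeff_mult of_rat_sum of_rat_mult)

lemma map_poly_of_rat_diff:
  "map_poly of_rat (p - q) = map_poly of_rat p - (map_poly of_rat q :: 'a::field_char_0 poly)"
  by (rule poly_eqI) (simp add: coeff_map_poly of_rat_diff)

text \<open>The product of the values of \<open>g\<close> at the roots of \<open>f\<close> is, up to powers of the leading
  coefficients, the resultant; exchanging \<open>f\<close> and \<open>g\<close> and reducing modulo \<open>g\<close> runs the Euclidean
  algorithm.\<close>

lemma prod_poly_proots_rational:
  fixes f g :: "rat poly"
  assumes "f \<noteq> 0"
  shows "(\<Prod>x\<in>#proots (map_poly of_rat f :: complex poly). poly (map_poly of_rat g) x) \<in> \<rat>"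
  using assms
proof (induction "degree g" arbitrary: f g rule: less_induct)
  case less
  define cf where "cf = (map_poly of_rat f :: complex poly)"
  define cg where "cg = (map_poly of_rat g :: complex poly)"
  define A where "A = proots cf"
  define B where "B = proots cg"
  have fac: "poly p x = lead_coeff p * (\<Prod>w\<in>#proots p. x - w)" for p :: "complex poly" and x
  proof -
    have "p = smult (lead_coeff p) (\<Prod>w\<in>#proots p. [:- w, 1:])"
      by (rule complex_poly_decompose_multiset[symmetric])
    then have "poly p x = poly (smult (lead_coeff p) (\<Prod>w\<in>#proots p. [:- w, 1:])) x" by metis
    then show ?thesis by (simp add: poly_prod_mset)
  qed
  show ?case
  proof (cases "degree g = 0")
    case True
    then obtain c where "g = [:c:]" by (auto elim: degree_eq_zeroE)
    then have "poly (map_poly of_rat g) = (\<lambda>x :: complex. of_rat c)" by (simp add: fun_eq_iff of_rat_hom.map_poly_pCons_hom)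
    then show ?thesis by (simp add: Rats_power)
  next
    case False
    then have g0: "g \<noteq> 0" by auto
    have IH: "(\<Prod>x\<in>#B. poly (map_poly of_rat (f mod g)) x) \<in> \<rat>"
      unfolding B_def cg_def
      by (rule less.hyps[OF _ g0]) (use False degree_mod_less'[of g f] g0 in \<open>cases "f mod g = 0"; auto\<close>)
    have "poly (map_poly of_rat (f mod g)) x = poly cf x" if "x \<in># B" for x
    proof -
      have "poly cg x = 0" using that g0 by (simp add: B_def cg_def)
      moreover have "cf = map_poly of_rat (f div g) * cg + map_poly of_rat (f mod g)"
        unfolding cf_def cg_def by (simp flip: map_poly_of_rat_mult of_rat_hom.map_poly_hom_add)
      ultimately show ?thesis by simp
    qed
    then have fB: "(\<Prod>x\<in>#B. poly cf x) \<in> \<rat>"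
      using IH by (metis (no_types, lifting) image_mset_cong)
    have "(\<Prod>x\<in>#B. poly cf x) = lead_coeff cf ^ size B * (\<Prod>x\<in>#B. \<Prod>w\<in>#A. x - w)"
      by (simp add: fac[of cf] A_def prod_mset.distrib)
    also have "(\<Prod>x\<in>#B. \<Prod>w\<in>#A. x - w) = (\<Prod>x\<in>#B. \<Prod>w\<in>#A. (- 1) * (w - x))"
      by simp
    also have "\<dots> = (- 1) ^ (size A * size B) * (\<Prod>x\<in>#B. \<Prod>w\<in>#A. w - x)"
      by (simp only: prod_mset.distrib prod_mset_constant power_mult)
    also have "(\<Prod>x\<in>#B. \<Prod>w\<in>#A. w - x) = (\<Prod>w\<in>#A. \<Prod>x\<in>#B. w - x)"
      by (rule prod_mset.swap)
    finally have 1: "(\<Prod>x\<in>#B. poly cf x) = lead_coeff cf ^ size B * ((- 1) ^ (size A * size B) * (\<Prod>w\<in>#A. \<Prod>x\<in>#B. w - x))" .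
    have lc: "lead_coeff cf = of_rat (lead_coeff f)" "lead_coeff cg = of_rat (lead_coeff g)"
      by (simp_all add: cf_def cg_def)
    have "(\<Prod>x\<in>#A. poly cg x) = lead_coeff cg ^ size A * (\<Prod>w\<in>#A. \<Prod>x\<in>#B. w - x)"
      by (simp add: fac[of cg] B_def prod_mset.distrib)
    also have "\<dots> = lead_coeff cg ^ size A * ((- 1) ^ (size A * size B) * (\<Prod>x\<in>#B. poly cf x) / lead_coeff cf ^ size B)"
      unfolding 1 using less.prems by (simp add: lc field_simps flip: power_add mult_2)
    also have "\<dots> \<in> \<rat>"
      using fB by (auto simp: lc intro!: Rats_mult Rats_divide Rats_power)
    finally show ?thesis by (simp add: A_def cf_def cg_def)
  qed
qed

section \<open>Norms in a Galois number field\<close>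

lemma map_poly_of_rat_of_int:
  "map_poly of_rat (map_poly rat_of_int p) = (map_poly of_int p :: 'a::field_char_0 poly)"
  by (rule poly_eqI) (simp add: coeff_map_poly)

text \<open>If \<open>f\<close> did not divide \<open>q\<close>, a Bezout identity between the two
  would read \<open>0 = 1\<close> at the common complex root.\<close>

lemma irreducible_rat_dvd:
  fixes f q :: "rat poly" and z :: complex
  assumes "irreducible f" and "poly (map_poly of_rat f) z = 0" and "poly (map_poly of_rat q) z = 0"
  shows "f dvd q"
proof (rule ccontr)
  assume "\<not> f dvd q"
  then have "coprime f q"
    using assms(1) by (meson algebraic_semidom_class.irreducibleD' dvd_trans not_coprimeE)
  then obtain u v where "u * f + v * q = 1"
    using bezout_coefficients_fst_snd[of f q] by (metis coprime_imp_gcd_eq_1)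
  then have "map_poly of_rat u * map_poly of_rat f + map_poly of_rat v * map_poly of_rat q = (1 :: complex poly)"
    by (simp flip: map_poly_of_rat_mult of_rat_hom.map_poly_hom_add)
  then have "poly (map_poly of_rat u * map_poly of_rat f + map_poly of_rat v * map_poly of_rat q) z = 1"
    by simp
  then show False using assms by simp
qed

lemma irreducible_rat_vanish:
  fixes f q :: "rat poly" and z w :: complex
  assumes "irreducible f" "poly (map_poly of_rat f) z = 0" "poly (map_poly of_rat q) z = 0"
    "poly (map_poly of_rat f) w = 0"
  shows "poly (map_poly of_rat q) w = 0"
proof -
  obtain r where "q = f * r" using irreducible_rat_dvd[OF assms(1-3)] by blast
  then show ?thesis using assms(4) by (simp add: map_poly_of_rat_mult)
qed

lemma poly_of_rat_pcompose:
  "poly (map_poly of_rat (p \<circ>\<^sub>p q)) z = poly (map_poly of_rat p) (poly (map_poly of_rat q) z :: 'a::field_char_0)"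
  by (simp add: of_rat_hom.map_poly_pcompose poly_pcompose)

text \<open>The Galois property enters in the form that any root is a rational polynomial in any
  other. Automorphisms thereby become substitutions of roots into rational polynomials.\<close>

locale galois_poly =
  fixes f :: "int poly" and Z :: "complex set" and d :: nat
  assumes irr: "irreducible (map_poly rat_of_int f)"
    and Z: "Z = {z. poly (of_int_poly f) z = 0}"
    and d: "d = degree f"
    and card_Z: "card Z = d"
    and d_ge: "d \<ge> 3"
    and gal: "\<And>\<alpha> \<beta>. \<alpha> \<in> Z \<Longrightarrow> \<beta> \<in> Z \<Longrightarrow> \<exists>R :: rat poly. poly (map_poly of_rat R) \<alpha> = \<beta>"
begin

text \<open>\<open>conj \<alpha> \<beta> z\<close> is the image of \<open>\<beta>\<close> under the automorphism that takes \<open>\<alpha>\<close> to \<open>z\<close>; accordingly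
  \<open>lin \<alpha> \<beta> A B z\<close> runs through the conjugates of \<open>A(\<alpha>) - \<beta> B(\<alpha>)\<close>.\<close>

definition conj :: "complex \<Rightarrow> complex \<Rightarrow> complex \<Rightarrow> complex" where
  "conj \<alpha> \<beta> = poly (map_poly of_rat (SOME R. poly (map_poly of_rat R) \<alpha> = \<beta>))"

abbreviation lc :: int where "lc \<equiv> lead_coeff f"

lemma f_nz [simp]: "f \<noteq> 0" using d d_ge by auto

lemma lc_nz: "lc \<noteq> 0" by simp

lemma finite_Z: "finite Z" using card_Z d_ge by (metis card.infinite not_numeral_le_zero)

lemma root_iff: "z \<in> Z \<longleftrightarrow> poly (of_int_poly f) z = 0" by (simp add: Z)

lemma rat_dvd:
  assumes "z \<in> Z" "poly (map_poly of_rat q) z = 0"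
  shows "map_poly of_int f dvd q"
  using irreducible_rat_dvd[OF irr, of z q] assms by (simp add: map_poly_of_rat_of_int Z)

lemma rat_vanish:
  assumes "z \<in> Z" "poly (map_poly of_rat q) z = 0" "w \<in> Z"
  shows "poly (map_poly of_rat q) w = 0"
  using irreducible_rat_vanish[OF irr, of z q w] assms by (simp add: map_poly_of_rat_of_int Z)

lemma rat_degree:
  assumes "z \<in> Z" "poly (map_poly of_rat q) z = 0" "degree q < d"
  shows "q = 0"
  using dvd_imp_degree_le[OF rat_dvd[OF assms(1,2)]] assms(3) d by auto

lemma int_degree:
  assumes "z \<in> Z" "poly (of_int_poly q) z = 0" "degree q < d"
  shows "q = 0"
  using rat_degree[OF assms(1), of "map_poly of_int q"] assms by (simp add: map_poly_of_rat_of_int)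

lemma irrational: "z \<in> Z \<Longrightarrow> z \<noteq> of_rat r"
  using rat_degree[of z "[:-r, 1:]"] d_ge by (auto simp: of_rat_hom.map_poly_pCons_hom of_rat_minus)

lemma proots_f: "proots (of_int_poly f :: complex poly) = mset_set Z"
proof -
  define M where "M = proots (of_int_poly f :: complex poly)"
  have "set_mset M = Z" by (simp add: M_def Z)
  then have "mset_set Z \<subseteq># M" by (metis mset_set_set_mset_msubset)
  moreover have "size M = size (mset_set Z)"
    using card_Z d by (simp add: M_def size_proots_complex)
  ultimately show ?thesis unfolding M_def by (metis mset_subset_size nat_neq_iff subset_mset.less_le)
qed

lemma f_factorization: "(of_int_poly f :: complex poly) = smult (of_int lc) (\<Prod>z\<in>Z. [:- z, 1:])"
  using complex_poly_decompose_multiset[of "of_int_poly f"] finite_Z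
  by (simp add: proots_f prod_unfold_prod_mset)

lemma conj_self: "\<alpha> \<in> Z \<Longrightarrow> \<beta> \<in> Z \<Longrightarrow> conj \<alpha> \<beta> \<alpha> = \<beta>"
  unfolding conj_def by (rule someI_ex) (rule gal)

lemma conj_in: assumes "\<alpha> \<in> Z" "\<beta> \<in> Z" "z \<in> Z" shows "conj \<alpha> \<beta> z \<in> Z"
proof -
  define R where "R = (SOME R. poly (map_poly of_rat R) \<alpha> = \<beta>)"
  have "poly (map_poly of_rat (map_poly of_int f \<circ>\<^sub>p R)) \<alpha> = 0"
    using conj_self[OF assms(1,2)] assms by (simp add: poly_of_rat_pcompose map_poly_of_rat_of_int Z conj_def R_def)
  from rat_vanish[OF assms(1) this assms(3)] show ?thesis
    by (simp add: poly_of_rat_pcompose map_poly_of_rat_of_int Z conj_def R_def)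
qed

definition lin :: "complex \<Rightarrow> complex \<Rightarrow> int poly \<Rightarrow> int poly \<Rightarrow> complex \<Rightarrow> complex" where
  "lin \<alpha> \<beta> A B z = poly (of_int_poly A) z - conj \<alpha> \<beta> z * poly (of_int_poly B) z"

lemma lin_rat: "\<exists>q :: rat poly. \<forall>z. lin \<alpha> \<beta> A B z = poly (map_poly of_rat q) z"
proof (intro exI allI)
  fix z
  show "lin \<alpha> \<beta> A B z = poly (map_poly of_rat (map_poly of_int A -
      (SOME R. poly (map_poly of_rat R) \<alpha> = \<beta>) * map_poly of_int B)) z"
    by (simp add: lin_def conj_def map_poly_of_rat_diff map_poly_of_rat_mult map_poly_of_rat_of_int)
qed

lemma lin_vanish: "z \<in> Z \<Longrightarrow> lin \<alpha> \<beta> A B z = 0 \<Longrightarrow> w \<in> Z \<Longrightarrow> lin \<alpha> \<beta> A B w = 0"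
  using lin_rat[of \<alpha> \<beta> A B] rat_vanish by metis

lemma lin_self: "\<alpha> \<in> Z \<Longrightarrow> \<beta> \<in> Z \<Longrightarrow> lin \<alpha> \<beta> A B \<alpha> = poly (of_int_poly A) \<alpha> - \<beta> * poly (of_int_poly B) \<alpha>"
  by (simp add: lin_def conj_self)

lemma algebraic_int_scaled_poly:
  assumes "z \<in> Z" "degree A \<le> N"
  shows "algebraic_int (of_int lc ^ N * poly (of_int_poly A) z)"
proof -
  have "of_int lc ^ N * poly (of_int_poly A) z = (\<Sum>i\<le>degree A. of_int (coeff A i * lc ^ (N - i)) * (of_int lc * z) ^ i)"
    unfolding poly_altdef sum_distrib_left
  proof (intro sum.cong)
    fix i assume "i \<in> {..degree A}"
    then have "lc ^ N = lc ^ (N - i) * lc ^ i" using assms(2) by (simp flip: power_add)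
    then show "of_int lc ^ N * (coeff (of_int_poly A) i * z ^ i) = of_int (coeff A i * lc ^ (N - i)) * (of_int lc * z) ^ i"
      by (simp add: power_mult_distrib mult_ac flip: of_int_power)
  qed simp
  also have "algebraic_int \<dots>"
    using algebraic_int_lead_coeff_mult_root[of f z] assms
    by (intro algebraic_int_sum algebraic_int_mult[OF algebraic_int_of_int algebraic_int_power]) (simp_all add: Z)
  finally show ?thesis .
qed

text \<open>\<open>N\<close> factors \<open>lc\<close> clear the denominators of the values of
  \<open>A\<close> and \<open>B\<close>, one more clears that of the conjugate of
  \<open>\<beta>\<close>.\<close>

lemma algebraic_int_lin:
  assumes "\<alpha> \<in> Z" "\<beta> \<in> Z" "z \<in> Z" "degree A \<le> N" "degree B \<le> N"
  shows "algebraic_int (of_int lc ^ (N + 1) * lin \<alpha> \<beta> A B z)"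
proof -
  have 1: "algebraic_int (of_int lc * conj \<alpha> \<beta> z)"
    using algebraic_int_lead_coeff_mult_root[of f "conj \<alpha> \<beta> z"] conj_in[OF assms(1-3)] by (simp add: Z)
  have "of_int lc ^ (N + 1) * lin \<alpha> \<beta> A B z = of_int lc * (of_int lc ^ N * poly (of_int_poly A) z)
     + (- 1) * ((of_int lc * conj \<alpha> \<beta> z) * (of_int lc ^ N * poly (of_int_poly B) z))"
    by (simp add: lin_def algebra_simps)
  also have "algebraic_int \<dots>"
    by (intro algebraic_int_add algebraic_int_mult[OF _ algebraic_int_mult] algebraic_int_mult[OF algebraic_int_of_int]
          algebraic_int_scaled_poly 1 assms)
       (simp_all add: int_imp_algebraic_int)
  finally show ?thesis .
qed

text \<open>The product is the norm of an algebraic integer. It is rational by the resultant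
  computation \<open>prod_poly_proots_rational\<close>, and a rational algebraic integer is an
  integer.\<close>

lemma norm_lin_int:
  assumes "\<alpha> \<in> Z" "\<beta> \<in> Z" "degree A \<le> N" "degree B \<le> N"
  shows "(\<Prod>z\<in>Z. of_int lc ^ (N + 1) * lin \<alpha> \<beta> A B z) \<in> \<int>"
proof (rule rational_algebraic_int_is_int)
  show "algebraic_int (\<Prod>z\<in>Z. of_int lc ^ (N + 1) * lin \<alpha> \<beta> A B z)"
    using assms by (intro algebraic_int_prod algebraic_int_lin)
  obtain q :: "rat poly" where q: "\<And>z. lin \<alpha> \<beta> A B z = poly (map_poly of_rat q) z"
    using lin_rat by metis
  have "(\<Prod>x\<in>#proots (map_poly of_rat (map_poly of_int f) :: complex poly). poly (map_poly of_rat q) x) \<in> \<rat>"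
    by (rule prod_poly_proots_rational) (use f_nz in auto)
  then have "(\<Prod>z\<in>Z. poly (map_poly of_rat q) z) \<in> \<rat>"
    by (simp add: map_poly_of_rat_of_int proots_f prod_unfold_prod_mset)
  then show "(\<Prod>z\<in>Z. of_int lc ^ (N + 1) * lin \<alpha> \<beta> A B z) \<in> \<rat>"
    by (simp add: q prod.distrib Rats_mult)
qed

text \<open>Liouville's inequality: the norm is a nonzero integer, because vanishing at one root
  would spread to all, and the \<open>d - 1\<close> factors at the other roots are at most
  \<open>V\<close>.\<close>

lemma lin_lower_bound:
  assumes "\<alpha> \<in> Z" "\<beta> \<in> Z" "degree A \<le> N" "degree B \<le> N"
    and V: "\<And>z. z \<in> Z \<Longrightarrow> cmod (of_int lc ^ (N + 1) * lin \<alpha> \<beta> A B z) \<le> V"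
    and nz: "lin \<alpha> \<beta> A B \<alpha> \<noteq> 0"
  shows "1 \<le> cmod (of_int lc ^ (N + 1) * lin \<alpha> \<beta> A B \<alpha>) * V ^ (d - 1)"
proof -
  let ?g = "\<lambda>z. of_int lc ^ (N + 1) * lin \<alpha> \<beta> A B z"
  have "?g z \<noteq> 0" if "z \<in> Z" for z using lin_vanish[OF that, of \<alpha> \<beta> A B \<alpha>] nz assms(1) by auto
  then have "(\<Prod>z\<in>Z. ?g z) \<noteq> 0" using finite_Z by (simp add: prod_zero_iff)
  moreover obtain k :: int where k: "(\<Prod>z\<in>Z. ?g z) = of_int k"
    using norm_lin_int[OF assms(1-4)] by (auto elim: Ints_cases)
  ultimately have "1 \<le> cmod (\<Prod>z\<in>Z. ?g z)" by auto
  also have "\<dots> = cmod (?g \<alpha>) * (\<Prod>z\<in>Z - {\<alpha>}. cmod (?g z))"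
    using assms(1) finite_Z by (simp add: prod.remove[OF finite_Z assms(1)] norm_mult flip: prod_norm)
  also have "\<dots> \<le> cmod (?g \<alpha>) * (\<Prod>z\<in>Z - {\<alpha>}. V)"
    using V by (intro mult_left_mono prod_mono) auto
  also have "\<dots> = cmod (?g \<alpha>) * V ^ (d - 1)" using assms(1) card_Z finite_Z by (simp add: card_Diff_singleton)
  finally show ?thesis .
qed

lemma lin_small_imp_0:
  assumes "\<alpha> \<in> Z" "\<beta> \<in> Z" "degree A \<le> N" "degree B \<le> N"
    and small: "\<And>z. z \<in> Z \<Longrightarrow> cmod (of_int lc ^ (N + 1) * lin \<alpha> \<beta> A B z) < 1" and "w \<in> Z"
  shows "lin \<alpha> \<beta> A B w = 0"
proof (rule ccontr)
  assume "lin \<alpha> \<beta> A B w \<noteq> 0"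
  then have "lin \<alpha> \<beta> A B \<alpha> \<noteq> 0" using lin_vanish assms by metis
  from lin_lower_bound[OF assms(1-4) _ this, of 1] small assms(1)
  show False by (metis less_le_not_le mult.right_neutral order_less_imp_le power_one)
qed

end

section \<open>Estimates\<close>

lemma taylor_remainder:
  fixes p :: "complex poly"
  assumes "degree p \<le> N" and T: "\<And>i. cmod (poly (hasse i p) a) \<le> T" and h: "cmod h \<le> 1"
  shows "cmod (poly p (a + h) - (\<Sum>i<n. poly (hasse i p) a * h ^ i)) \<le> real (N + 1) * T * cmod h ^ n"
proof -
  have hz: "hasse i p = 0" if "N < i" for i
    using that assms(1) by (intro poly_eqI) (simp add: coeff_eq_0)
  have T0: "0 \<le> T" using T[of 0] norm_ge_zero order_trans by blast
  have "poly p (a + h) = (\<Sum>i\<le>N + n. poly (hasse i p) a * h ^ i)"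
    using assms(1) by (intro poly_taylor) simp
  also have "{..N + n} = {..<n} \<union> {n..N + n}" by auto
  also have "(\<Sum>i\<in>{..<n} \<union> {n..N + n}. poly (hasse i p) a * h ^ i)
      = (\<Sum>i<n. poly (hasse i p) a * h ^ i) + (\<Sum>i\<in>{n..N + n}. poly (hasse i p) a * h ^ i)"
    by (rule sum.union_disjoint) auto
  finally have "cmod (poly p (a + h) - (\<Sum>i<n. poly (hasse i p) a * h ^ i))
      = cmod (\<Sum>i\<in>{n..N + n}. poly (hasse i p) a * h ^ i)" by simp
  also have "\<dots> \<le> (\<Sum>i\<in>{n..N + n}. T * cmod h ^ n)"
  proof (rule sum_norm_le)
    fix i assume "i \<in> {n..N + n}"
    then have "cmod h ^ i \<le> cmod h ^ n" using h by (intro power_decreasing) auto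
    then show "cmod (poly (hasse i p) a * h ^ i) \<le> T * cmod h ^ n"
      using T[of i] T0 by (simp add: norm_mult norm_power mult_mono)
  qed
  also have "\<dots> = real (N + 1) * T * cmod h ^ n" by (simp add: algebra_simps)
  finally show ?thesis .
qed

lemma Suc_le_two_power: "real (N + 1) \<le> 2 ^ N"
  by (induction N) auto

definition bdd_poly :: "nat \<Rightarrow> real \<Rightarrow> int poly \<Rightarrow> bool" where
  "bdd_poly N X A \<longleftrightarrow> degree A \<le> N \<and> (\<forall>i. real_of_int \<bar>coeff A i\<bar> \<le> X)"

lemma bdd_polyD: "bdd_poly N X A \<Longrightarrow> degree A \<le> N" "bdd_poly N X A \<Longrightarrow> real_of_int \<bar>coeff A i\<bar> \<le> X"
  by (auto simp: bdd_poly_def)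

lemma bdd_poly_nonneg: "bdd_poly N X A \<Longrightarrow> 0 \<le> X"
  using bdd_polyD(2)[of N X A 0] by linarith

text \<open>Numerical factors are absorbed into powers of \<open>C \<ge> 4\<close> here and later,
  so that constants become exponents of one number. The radius \<open>2 * C\<close> covers points at
  distance at most 1 from a root.\<close>

lemma bdd_poly_eval:
  assumes "bdd_poly N X A" "cmod x \<le> 2 * C" "C \<ge> 4"
  shows "cmod (poly (of_int_poly A) x) \<le> X * C ^ (2 * N)"
proof -
  have X: "0 \<le> X" using bdd_poly_nonneg assms by blast
  have "poly (of_int_poly A) x = (\<Sum>i\<le>N. of_int (coeff A i) * x ^ i)"
    using bdd_polyD(1)[OF assms(1)] by (subst poly_altdef) (intro sum.mono_neutral_cong_left, auto simp: coeff_eq_0)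
  also have "cmod \<dots> \<le> (\<Sum>i\<le>N. X * (2 * C) ^ N)"
  proof (rule sum_norm_le)
    fix i assume "i \<in> {..N}"
    have "cmod x ^ i \<le> (2 * C) ^ i" using assms(2) by (intro power_mono) auto
    also have "\<dots> \<le> (2 * C) ^ N" using assms(3) \<open>i \<in> {..N}\<close> by (intro power_increasing) auto
    finally show "cmod (of_int (coeff A i) * x ^ i) \<le> X * (2 * C) ^ N"
      using bdd_polyD(2)[OF assms(1), of i] X by (simp add: norm_mult norm_power mult_mono)
  qed
  also have "\<dots> = real (N + 1) * (X * (2 * C) ^ N)" by simp
  also have "\<dots> \<le> 2 ^ N * (X * (2 * C) ^ N)"
    using Suc_le_two_power[of N] X assms(3) by (intro mult_right_mono) auto
  also have "\<dots> = X * (2 * (2 * C)) ^ N" by (simp only: power_mult_distrib mult_ac)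
  also have "\<dots> = X * (4 * C) ^ N" by simp
  also have "\<dots> \<le> X * (C * C) ^ N" using X assms(3) by (intro mult_left_mono power_mono mult_right_mono) auto
  also have "\<dots> = X * C ^ (2 * N)" by (simp add: power_mult power2_eq_square)
  finally show ?thesis .
qed

lemma bdd_poly_hasse:
  assumes "bdd_poly N X A"
  shows "bdd_poly N (2 ^ N * X) (hasse l A)"
  unfolding bdd_poly_def
proof (intro conjI allI)
  show "degree (hasse l A) \<le> N" using degree_hasse[of l A] bdd_polyD(1)[OF assms] by linarith
  fix i
  show "real_of_int \<bar>coeff (hasse l A) i\<bar> \<le> 2 ^ N * X"
  proof (cases "i + l \<le> N")
    case True
    have "real ((i + l) choose l) \<le> 2 ^ (i + l)"
      using binomial_le_pow2[of "i + l" l] by (metis of_nat_le_iff of_nat_numeral of_nat_power)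
    also have "\<dots> \<le> 2 ^ N" using True by (intro power_increasing) auto
    finally show ?thesis using bdd_polyD(2)[OF assms, of "i + l"]
      by (simp add: abs_mult mult_mono)
  next
    case False
    then show ?thesis using bdd_polyD(1)[OF assms] bdd_poly_nonneg[OF assms] by (simp add: coeff_eq_0)
  qed
qed

lemma bdd_poly_hasse_eval:
  assumes "bdd_poly N X A" "cmod x \<le> 2 * C" "C \<ge> 4"
  shows "cmod (poly (of_int_poly (hasse l A)) x) \<le> X * C ^ (3 * N)"
proof -
  have "cmod (poly (of_int_poly (hasse l A)) x) \<le> 2 ^ N * X * C ^ (2 * N)"
    by (rule bdd_poly_eval[OF bdd_poly_hasse[OF assms(1)] assms(2,3)])
  also have "\<dots> \<le> C ^ N * X * C ^ (2 * N)"
    using assms(3) bdd_poly_nonneg[OF assms(1)] by (intro mult_right_mono power_mono) auto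
  also have "\<dots> = X * C ^ (3 * N)" by (simp flip: power_add)
  finally show ?thesis .
qed

locale galois_bounds = galois_poly +
  fixes C :: real
  assumes C4: "C \<ge> 4" and d_le: "real d \<le> C" and coeff_le: "\<And>i. real_of_int \<bar>coeff f i\<bar> \<le> C"
    and root_le: "\<And>z. z \<in> Z \<Longrightarrow> cmod z \<le> C"
begin

lemma lin_hasse_bound:
  assumes "bdd_poly N X A" "bdd_poly N X B" "\<alpha> \<in> Z" "\<beta> \<in> Z" "z \<in> Z"
  shows "cmod (lin \<alpha> \<beta> (hasse l A) (hasse l B) z) \<le> X * C ^ (3 * N + 2)"
proof -
  have X: "0 \<le> X" using bdd_poly_nonneg assms by blast
  have z: "cmod z \<le> 2 * C" using root_le[OF assms(5)] C4 by simp
  have "cmod (lin \<alpha> \<beta> (hasse l A) (hasse l B) z) \<le> cmod (poly (of_int_poly (hasse l A)) z)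
     + cmod (conj \<alpha> \<beta> z) * cmod (poly (of_int_poly (hasse l B)) z)"
    unfolding lin_def by (metis norm_mult norm_triangle_ineq4)
  also have "\<dots> \<le> X * C ^ (3 * N) + C * (X * C ^ (3 * N))"
    using C4 root_le[OF conj_in[OF assms(3-5)]] z assms(1,2)
    by (intro add_mono mult_mono bdd_poly_hasse_eval) auto
  also have "\<dots> = X * C ^ (3 * N) * (1 + C)" by (simp add: algebra_simps)
  also have "\<dots> \<le> X * C ^ (3 * N) * (C * C)"
    using X C4 by (intro mult_left_mono order.trans[of "1 + C" "4 * C" "C * C"] mult_right_mono) auto
  finally show ?thesis by (simp add: power_add power2_eq_square mult_ac)
qed

lemma scaled_lin_hasse_bound:
  assumes "bdd_poly N X A" "bdd_poly N X B" "\<alpha> \<in> Z" "\<beta> \<in> Z" "z \<in> Z"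
  shows "cmod (of_int lc ^ (N + 1) * lin \<alpha> \<beta> (hasse l A) (hasse l B) z) \<le> X * C ^ (4 * N + 3)"
proof -
  have "cmod (of_int lc ^ (N + 1)) \<le> C ^ (N + 1)"
    using coeff_le[of "degree f"] by (simp only: norm_power norm_of_int) (intro power_mono, auto)
  then have "cmod (of_int lc ^ (N + 1) * lin \<alpha> \<beta> (hasse l A) (hasse l B) z) \<le> C ^ (N + 1) * (X * C ^ (3 * N + 2))"
    unfolding norm_mult using lin_hasse_bound[OF assms] C4 by (intro mult_mono) auto
  also have "\<dots> = X * C ^ (4 * N + 3)"
  proof -
    have "4 * N + 3 = (N + 1) + (3 * N + 2)" by simp
    then show ?thesis by (simp only: power_add) (simp add: mult_ac)
  qed
  finally show ?thesis .
qed

lemma lin_hasse_lower_bound: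
  assumes "bdd_poly N X A" "bdd_poly N X B" "\<alpha> \<in> Z" "\<beta> \<in> Z" "1 \<le> X"
    and nz: "lin \<alpha> \<beta> (hasse l A) (hasse l B) \<alpha> \<noteq> 0"
  shows "1 \<le> cmod (lin \<alpha> \<beta> (hasse l A) (hasse l B) \<alpha>) * (X * C ^ (4 * N + 3)) ^ d"
proof -
  let ?V = "X * C ^ (4 * N + 3)" and ?L = "cmod (lin \<alpha> \<beta> (hasse l A) (hasse l B) \<alpha>)"
  have deg: "degree (hasse l A) \<le> N" "degree (hasse l B) \<le> N"
    using bdd_polyD(1)[OF bdd_poly_hasse] assms by blast+
  have "1 \<le> cmod (of_int lc ^ (N + 1) * lin \<alpha> \<beta> (hasse l A) (hasse l B) \<alpha>) * ?V ^ (d - 1)"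
    by (rule lin_lower_bound[OF assms(3,4) deg scaled_lin_hasse_bound nz]) (use assms in auto)
  \<comment> \<open>Undoing the scaling by \<open>lc\<close> costs one more factor
    \<open>?V\<close>, which raises the exponent from \<open>d - 1\<close> to
    \<open>d\<close>.\<close>
  also have "cmod (of_int lc ^ (N + 1) * lin \<alpha> \<beta> (hasse l A) (hasse l B) \<alpha>) \<le> ?V * ?L"
  proof -
    have "cmod (of_int lc ^ (N + 1)) \<le> C ^ (N + 1)"
      using coeff_le[of "degree f"] by (simp only: norm_power norm_of_int) (intro power_mono, auto)
    also have "\<dots> \<le> C ^ (4 * N + 3)" using C4 by (intro power_increasing) auto
    also have "\<dots> \<le> ?V" using assms(5) C4 by simp
    finally show ?thesis unfolding norm_mult by (rule mult_right_mono) simp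
  qed
  also have "?V * ?L * ?V ^ (d - 1) = ?L * ?V ^ d"
    using d_ge by (cases d) simp_all
  finally show ?thesis using C4 assms(5) by (auto simp: mult_right_mono)
qed

text \<open>The \<open>l\<close>-th derivative of a polynomial that vanishes to order
  \<open>n\<close> at \<open>\<alpha>\<close> vanishes to order \<open>n - l\<close>;
  \<open>hasse_hasse\<close> makes this a matter of indices.\<close>

lemma lin_hasse_taylor:
  assumes "bdd_poly N X A" "bdd_poly N X B" "\<alpha> \<in> Z" "\<beta> \<in> Z" "cmod (\<xi> - \<alpha>) \<le> 1" "l \<le> n"
    and van: "\<And>l. l < n \<Longrightarrow> lin \<alpha> \<beta> (hasse l A) (hasse l B) \<alpha> = 0"
  shows "cmod (poly (of_int_poly (hasse l A)) \<xi> - \<beta> * poly (of_int_poly (hasse l B)) \<xi>)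
    \<le> X * C ^ (4 * N + 2) * cmod (\<xi> - \<alpha>) ^ (n - l)"
proof -
  define p where "p = (of_int_poly A - smult \<beta> (of_int_poly B) :: complex poly)"
  have X: "0 \<le> X" using bdd_poly_nonneg assms by blast
  have hp: "poly (hasse k p) x = poly (of_int_poly (hasse k A)) x - \<beta> * poly (of_int_poly (hasse k B)) x" for k x
    by (simp add: p_def hasse_diff hasse_smult map_poly_hasse_of_int)
  have hl: "poly (hasse k p) \<alpha> = lin \<alpha> \<beta> (hasse k A) (hasse k B) \<alpha>" for k
    using assms(3,4) by (simp add: hp lin_self)
  have deg: "degree p \<le> N" unfolding p_def
    using bdd_polyD(1)[OF assms(1)] bdd_polyD(1)[OF assms(2)]
    by (intro degree_diff_le) (auto intro: order.trans[OF degree_smult_le])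
  have T: "cmod (poly (hasse i (hasse l p)) \<alpha>) \<le> 2 ^ N * (X * C ^ (3 * N + 2))" for i
  proof (cases "i + l \<le> N")
    case True
    have "real ((i + l) choose l) \<le> 2 ^ (i + l)"
      using binomial_le_pow2[of "i + l" l] by (metis of_nat_le_iff of_nat_numeral of_nat_power)
    also have "\<dots> \<le> 2 ^ N" using True by (intro power_increasing) auto
    finally show ?thesis using lin_hasse_bound[OF assms(1-4,3), of "i + l"]
      by (simp add: hasse_hasse hl norm_mult mult_mono)
  next
    case False
    then have "hasse (i + l) p = 0" using deg by (intro poly_eqI) (simp add: coeff_eq_0)
    then show ?thesis using X C4 by (simp add: hasse_hasse)
  qed
  have "(\<Sum>i<n - l. poly (hasse i (hasse l p)) \<alpha> * (\<xi> - \<alpha>) ^ i) = 0"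
    using van by (intro sum.neutral) (auto simp: hasse_hasse hl)
  moreover have "degree (hasse l p) \<le> N" using degree_hasse[of l p] deg by linarith
  ultimately have "cmod (poly (hasse l p) (\<alpha> + (\<xi> - \<alpha>))) \<le> real (N + 1) * (2 ^ N * (X * C ^ (3 * N + 2))) * cmod (\<xi> - \<alpha>) ^ (n - l)"
    using taylor_remainder[of "hasse l p" N \<alpha> _ "\<xi> - \<alpha>" "n - l", OF _ T assms(5)] by simp
  also have "\<dots> \<le> X * C ^ (4 * N + 2) * cmod (\<xi> - \<alpha>) ^ (n - l)"
  proof (rule mult_right_mono)
    have "real (N + 1) * (2 ^ N * (X * C ^ (3 * N + 2))) \<le> 2 ^ N * (2 ^ N * (X * C ^ (3 * N + 2)))"
      using Suc_le_two_power[of N] X C4 by (intro mult_right_mono) auto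
    also have "\<dots> = 4 ^ N * (X * C ^ (3 * N + 2))" by (simp flip: mult.assoc power_mult_distrib)
    also have "\<dots> \<le> C ^ N * (X * C ^ (3 * N + 2))" using C4 X by (intro mult_right_mono power_mono) auto
    also have "\<dots> = X * C ^ (4 * N + 2)"
    proof -
      have "4 * N + 2 = N + (3 * N + 2)" by simp
      then show ?thesis by (simp only: power_add) (simp add: mult_ac)
    qed
    finally show "real (N + 1) * (2 ^ N * (X * C ^ (3 * N + 2))) \<le> X * C ^ (4 * N + 2)" .
  qed simp
  finally show ?thesis by (simp add: hp)
qed

lemma lin_linear_term:
  assumes "bdd_poly N X A" "bdd_poly N X B" "\<alpha> \<in> Z" "\<beta> \<in> Z" "cmod (\<xi> - \<alpha>) \<le> 1"
    and van: "lin \<alpha> \<beta> A B \<alpha> = 0"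
  shows "cmod (poly (of_int_poly A) \<xi> - \<beta> * poly (of_int_poly B) \<xi>
      - lin \<alpha> \<beta> (hasse 1 A) (hasse 1 B) \<alpha> * (\<xi> - \<alpha>)) \<le> X * C ^ (4 * N + 2) * cmod (\<xi> - \<alpha>) ^ 2"
proof -
  define p where "p = (of_int_poly A - smult \<beta> (of_int_poly B) :: complex poly)"
  have X: "0 \<le> X" using bdd_poly_nonneg assms by blast
  have hp: "poly (hasse k p) x = poly (of_int_poly (hasse k A)) x - \<beta> * poly (of_int_poly (hasse k B)) x" for k x
    by (simp add: p_def hasse_diff hasse_smult map_poly_hasse_of_int)
  have hl: "poly (hasse k p) \<alpha> = lin \<alpha> \<beta> (hasse k A) (hasse k B) \<alpha>" for k
    using assms(3,4) by (simp add: hp lin_self)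
  have deg: "degree p \<le> N" unfolding p_def
    using bdd_polyD(1)[OF assms(1)] bdd_polyD(1)[OF assms(2)]
    by (intro degree_diff_le) (auto intro: order.trans[OF degree_smult_le])
  have "cmod (poly p (\<alpha> + (\<xi> - \<alpha>)) - (\<Sum>i<2. poly (hasse i p) \<alpha> * (\<xi> - \<alpha>) ^ i))
      \<le> real (N + 1) * (X * C ^ (3 * N + 2)) * cmod (\<xi> - \<alpha>) ^ 2"
    by (rule taylor_remainder[OF deg _ assms(5)]) (simp only: hl lin_hasse_bound assms)
  also have "\<dots> \<le> C ^ N * (X * C ^ (3 * N + 2)) * cmod (\<xi> - \<alpha>) ^ 2"
    using order.trans[OF Suc_le_two_power[of N] power_mono[of 2 C N]] X C4
    by (intro mult_right_mono) auto
  also have "C ^ N * (X * C ^ (3 * N + 2)) = X * C ^ (4 * N + 2)"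
  proof -
    have "4 * N + 2 = N + (3 * N + 2)" by simp
    then show ?thesis by (simp only: power_add) (simp add: mult_ac)
  qed
  finally show ?thesis using van hp[of 0] hl[of 0] by (simp add: numeral_2_eq_2 hl)
qed

end

section \<open>Siegel's lemma\<close>

definition poly_of :: "nat \<Rightarrow> (nat \<Rightarrow> 'a::comm_ring_1) \<Rightarrow> 'a poly" where
  "poly_of N c = (\<Sum>i\<le>N. monom (c i) i)"

lemma coeff_poly_of [simp]: "coeff (poly_of N c) i = (if i \<le> N then c i else 0)"
  by (simp add: poly_of_def coeff_sum if_distrib cong: if_cong)

lemma Reals_poly_of_int: "x \<in> \<real> \<Longrightarrow> poly (of_int_poly p) x \<in> \<real>"
  by (simp add: poly_altdef)

context galois_bounds
begin

lemma lin_diff: "lin \<alpha> \<beta> (A - A') (B - B') z = lin \<alpha> \<beta> A B z - lin \<alpha> \<beta> A' B' z"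
  by (simp add: lin_def hom_distribs algebra_simps)

text \<open>Siegel's lemma by the box principle. The unknowns are the coefficients of \<open>A\<close> and \<open>B\<close> at the
  positions in \<open>I\<close>; the numbers \<open>lin\<close> have \<open>d\<close> real conjugates each, and those of a difference
  of two vectors in the same box are too small for a nonzero algebraic integer.\<close>

lemma siegel:
  assumes "\<alpha> \<in> Z" "\<beta> \<in> Z" and real: "Z \<subseteq> \<real>" and I: "I \<subseteq> UNIV \<times> {..N}" and X: "1 \<le> X"
    and count: "(real X * C ^ (4 * N + 4)) ^ (n * d) < real (X + 1) ^ card (I :: (bool \<times> nat) set)"
  obtains A B where "A \<noteq> 0 \<or> B \<noteq> 0" "bdd_poly N (real X) A" "bdd_poly N (real X) B"
    "\<And>i. (True, i) \<notin> I \<Longrightarrow> coeff A i = 0" "\<And>i. (False, i) \<notin> I \<Longrightarrow> coeff B i = 0"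
    "\<And>l z. l < n \<Longrightarrow> z \<in> Z \<Longrightarrow> lin \<alpha> \<beta> (hasse l A) (hasse l B) z = 0"
proof -
  have finI: "finite I" using I by (rule finite_subset) simp
  define P :: "(bool \<times> nat \<Rightarrow> int) \<Rightarrow> bool \<Rightarrow> int poly" where
    "P c s = poly_of N (\<lambda>i. if (s, i) \<in> I then c (s, i) else 0)" for c s
  define box where "box = I \<rightarrow>\<^sub>E {0..int X}"
  define val where "val c = (\<lambda>(l, z). of_int lc ^ (N + 1) * lin \<alpha> \<beta> (hasse l (P c True)) (hasse l (P c False)) z)" for c
  define J where "J = {..<n} \<times> Z"
  define F where "F c = restrict (\<lambda>j. \<lfloor>Re (val c j)\<rfloor>) J" for c
  define E where "E = real X * C ^ (4 * N + 3)"
  have E1: "1 \<le> E" unfolding E_def using X C4 by (intro mult_ge1_I one_le_power) auto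
  have bP: "bdd_poly N (real X) (P c s)" if "c \<in> box" for c s
  proof -
    have "\<bar>c (s, i)\<bar> \<le> int X" if "(s, i) \<in> I" for i
      using \<open>c \<in> box\<close> that unfolding box_def by (auto simp: PiE_iff)
    then have "\<bar>coeff (P c s) i\<bar> \<le> int X" for i by (simp add: P_def)
    then have "real_of_int \<bar>coeff (P c s) i\<bar> \<le> real X" for i
      by (metis of_int_le_iff of_int_of_nat_eq)
    then show ?thesis unfolding bdd_poly_def by (auto simp: P_def intro!: degree_le)
  qed
  have bound: "cmod (val c j) \<le> E" if "c \<in> box" "j \<in> J" for c j
  proof -
    obtain l z where "j = (l, z)" "z \<in> Z" using \<open>j \<in> J\<close> by (auto simp: J_def)
    then show ?thesis
      using scaled_lin_hasse_bound[OF bP[OF \<open>c \<in> box\<close>] bP[OF \<open>c \<in> box\<close>] assms(1,2)]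
      unfolding val_def E_def by (simp only: prod.case)
  qed
  \<comment> \<open>Rounding the \<open>n * d\<close> real values to integers leaves
    \<open>card S ^ (n * d)\<close> possible images. By \<open>count\<close> the box has more points
    than that, so two of them collide.\<close>
  define S where "S = {\<lfloor>- E\<rfloor>..\<lfloor>E\<rfloor>}"
  have "F c \<in> J \<rightarrow>\<^sub>E S" if "c \<in> box" for c
  proof -
    have "\<lfloor>Re (val c j)\<rfloor> \<in> S" if "j \<in> J" for j
    proof -
      have "\<bar>Re (val c j)\<bar> \<le> E" using bound[OF \<open>c \<in> box\<close> that] abs_Re_le_cmod order_trans by blast
      then show ?thesis unfolding S_def by (auto intro!: floor_mono)
    qed
    then show ?thesis by (auto simp: F_def)
  qed
  then have FS: "F ` box \<subseteq> J \<rightarrow>\<^sub>E S" by blast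
  have finJ: "finite J" using finite_Z by (simp add: J_def)
  have "card (J \<rightarrow>\<^sub>E S) = card S ^ (n * d)"
    using finJ by (simp add: card_PiE J_def card_cartesian_product card_Z)
  moreover have "real (card S) \<le> real X * C ^ (4 * N + 4)"
  proof -
    have "real (card S) = of_int (\<lfloor>E\<rfloor> - \<lfloor>- E\<rfloor> + 1)"
      unfolding S_def using E1 by simp linarith
    also have "\<dots> \<le> 2 * E + 2" by linarith
    also have "\<dots> \<le> C * E" using E1 C4 mult_right_mono[of 4 C E] by linarith
    also have "\<dots> = real X * C ^ (4 * N + 4)" by (simp add: E_def mult_ac eval_nat_numeral)
    finally show ?thesis .
  qed
  ultimately have "real (card (J \<rightarrow>\<^sub>E S)) \<le> (real X * C ^ (4 * N + 4)) ^ (n * d)"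
    by (simp add: power_mono)
  also note count
  also have "real (X + 1) ^ card I = real (card box)"
    using finI by (simp add: box_def card_PiE add.commute)
  finally have "card (J \<rightarrow>\<^sub>E S) < card box" by simp
  moreover have "finite (J \<rightarrow>\<^sub>E S)" using finJ by (intro finite_PiE) (auto simp: S_def)
  ultimately have "\<not> inj_on F box"
    using FS by (meson card_inj_on_le not_le)
  then obtain c c' where c: "c \<in> box" "c' \<in> box" "c \<noteq> c'" "F c = F c'" unfolding inj_on_def by blast
  define A where "A = P c True - P c' True"
  define B where "B = P c False - P c' False"
  have bd: "bdd_poly N (real X) (P c s - P c' s)" for s
  proof -
    have "\<bar>c (s, i) - c' (s, i)\<bar> \<le> int X" if "(s, i) \<in> I" for i
    proof -
      have "c (s, i) \<in> {0..int X}" "c' (s, i) \<in> {0..int X}"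
        using c that unfolding box_def by (auto simp: PiE_iff)
      then show ?thesis by auto
    qed
    then have "\<bar>coeff (P c s - P c' s) i\<bar> \<le> int X" for i by (simp add: P_def)
    then have "real_of_int \<bar>coeff (P c s - P c' s) i\<bar> \<le> real X" for i
      by (metis of_int_le_iff of_int_of_nat_eq)
    then show ?thesis unfolding bdd_poly_def by (auto simp: P_def intro!: degree_le)
  qed
  show thesis
  proof (rule that[of A B])
    obtain j where "j \<in> I" "c j \<noteq> c' j"
      using c unfolding box_def by (meson PiE_ext)
    moreover obtain s i where "j = (s, i)" by fastforce
    ultimately have "coeff (P c s - P c' s) i \<noteq> 0" using I by (auto simp: P_def)
    then show "A \<noteq> 0 \<or> B \<noteq> 0" unfolding A_def B_def by (cases s) auto
    show "bdd_poly N (real X) A" "bdd_poly N (real X) B" unfolding A_def B_def by (rule bd)+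
    show "coeff A i = 0" if "(True, i) \<notin> I" for i using that by (simp add: A_def P_def)
    show "coeff B i = 0" if "(False, i) \<notin> I" for i using that by (simp add: B_def P_def)
  next
    fix l z assume l: "l < n" and z: "z \<in> Z"
    show "lin \<alpha> \<beta> (hasse l A) (hasse l B) z = 0"
    proof (rule lin_small_imp_0[OF assms(1,2) _ _ _ z])
      show "degree (hasse l A) \<le> N" "degree (hasse l B) \<le> N"
        unfolding A_def B_def by (rule bdd_polyD(1)[OF bdd_poly_hasse[OF bd]])+
      fix w assume w: "w \<in> Z"
      have eq: "of_int lc ^ (N + 1) * lin \<alpha> \<beta> (hasse l A) (hasse l B) w = val c (l, w) - val c' (l, w)"
        by (simp add: val_def A_def B_def hasse_diff lin_diff algebra_simps)
      \<comment> \<open>For real values, equal rounding of the real parts bounds the modulus of the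
        difference itself, and by less than 1.\<close>
      have rl: "val e (l, w) \<in> \<real>" for e
        using real w conj_in[OF assms(1,2) w]
        by (auto simp: val_def lin_def intro!: Reals_mult Reals_power Reals_diff Reals_poly_of_int)
      have "(l, w) \<in> J" using l w by (simp add: J_def)
      then have "\<lfloor>Re (val c (l, w))\<rfloor> = \<lfloor>Re (val c' (l, w))\<rfloor>"
        using c(4) unfolding F_def by (metis restrict_apply')
      then have "\<bar>Re (val c (l, w) - val c' (l, w))\<bar> < 1" by simp linarith
      moreover have "cmod (val c (l, w) - val c' (l, w)) = \<bar>Re (val c (l, w) - val c' (l, w))\<bar>"
        using rl by (metis Reals_diff in_Reals_norm)
      ultimately show "cmod (of_int lc ^ (N + 1) * lin \<alpha> \<beta> (hasse l A) (hasse l B) w) < 1"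
        unfolding eq by simp
    qed
  qed
qed

end

section \<open>Values of integer polynomials at rational points\<close>

definition homog :: "nat \<Rightarrow> int poly \<Rightarrow> int \<Rightarrow> int \<Rightarrow> int" where
  "homog N A x y = (\<Sum>i\<le>N. coeff A i * x ^ i * y ^ (N - i))"

lemma of_int_homog:
  fixes x y :: int
  assumes "degree A \<le> N" "y \<noteq> 0"
  shows "of_int (homog N A x y) = of_int y ^ N * poly (of_int_poly A) (of_int x / of_int y :: 'a::field_char_0)"
proof -
  have "poly (of_int_poly A) (of_int x / of_int y :: 'a) = (\<Sum>i\<le>N. of_int (coeff A i) * (of_int x / of_int y) ^ i)"
    using assms(1) by (subst poly_altdef) (intro sum.mono_neutral_cong_left, auto simp: coeff_eq_0)
  then have "of_int y ^ N * poly (of_int_poly A) (of_int x / of_int y :: 'a)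
      = (\<Sum>i\<le>N. of_int y ^ N * (of_int (coeff A i) * (of_int x / of_int y) ^ i))"
    by (simp add: sum_distrib_left)
  also have "\<dots> = (\<Sum>i\<le>N. of_int (coeff A i * x ^ i * y ^ (N - i)))"
  proof (intro sum.cong refl)
    fix i assume "i \<in> {..N}"
    then have "(of_int y :: 'a) ^ N = of_int y ^ (N - i) * of_int y ^ i" by (simp flip: power_add)
    then show "of_int y ^ N * (of_int (coeff A i) * (of_int x / of_int y) ^ i) = (of_int (coeff A i * x ^ i * y ^ (N - i)) :: 'a)"
      using assms(2) by (simp add: power_divide)
  qed
  finally show ?thesis by (simp add: homog_def)
qed

text \<open>In the homogenized equation every term but the leading one is divisible by
  \<open>y\<close>.\<close>

lemma rational_root_denominator:
  assumes "U \<noteq> 0" "poly (of_int_poly U) (of_int x / of_int y :: complex) = 0" "coprime x y" "y \<noteq> 0"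
  shows "\<bar>y\<bar> \<le> \<bar>lead_coeff U\<bar>"
proof -
  define n where "n = degree U"
  have "(of_int (homog n U x y) :: complex) = 0"
    using of_int_homog[of U n y x, where 'a = complex] assms by (simp add: n_def)
  then have "homog n U x y = 0" by simp
  then have "coeff U n * x ^ n + (\<Sum>i<n. coeff U i * x ^ i * y ^ (n - i)) = 0"
    by (simp add: homog_def flip: lessThan_Suc_atMost)
  moreover have "y dvd (\<Sum>i<n. coeff U i * x ^ i * y ^ (n - i))"
    by (intro dvd_sum) (auto intro!: dvd_mult)
  ultimately have "y dvd coeff U n * x ^ n"
    by (metis dvd_0_right dvd_add_left_iff)
  moreover have "coprime y (x ^ n)" using assms(3) by (simp add: ac_simps)
  ultimately have "y dvd coeff U n" by (simp add: coprime_dvd_mult_left_iff)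
  moreover have "coeff U n \<noteq> 0" using assms(1) by (simp add: n_def)
  ultimately show ?thesis unfolding n_def by (simp add: dvd_imp_le_int)
qed

lemma height_ge: "\<bar>y\<bar> \<le> height x y" "\<bar>x\<bar> \<le> height x y" by (auto simp: height_def)

text \<open>Reality serves the box principle; \<open>C\<close> is a natural number so that the box
  can have side \<open>C ^ k\<close> exactly.\<close>

locale galois_approx = galois_bounds +
  assumes C_nat: "C \<in> \<nat>" and real: "Z \<subseteq> \<real>"
begin

text \<open>The comparison of the height with \<open>\<bar>y\<bar>\<close> keeps
  \<open>x / y\<close> bounded and makes height and denominator interchangeable up to
  \<open>C\<close>. The error term is the one that a bounded value of the form yields.\<close>

definition approx :: "complex \<Rightarrow> int \<Rightarrow> int \<Rightarrow> bool" where
  "approx \<alpha> x y \<longleftrightarrow> \<alpha> \<in> Z \<and> coprime x y \<and> y \<noteq> 0 \<and> real_of_int (height x y) \<le> C * real_of_int \<bar>y\<bar>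
     \<and> cmod (of_int x / of_int y - \<alpha>) \<le> C / real_of_int (height x y) ^ d"

text \<open>With \<open>M\<close> unknowns in excess of the \<open>n * d\<close> conditions, the
  side \<open>X\<close> of the box has to satisfy that \<open>X ^ M\<close> is at least
  \<open>C ^ ((4 * N + 4) * (n * d))\<close>. With \<open>X = C ^ k\<close> this becomes a bound on
  \<open>k * M\<close>.\<close>

lemma siegel':
  assumes "\<alpha> \<in> Z" "\<beta> \<in> Z" and I: "I \<subseteq> UNIV \<times> {..N}" and "n * d + M \<le> card I" "(4 * N + 4) * (n * d) \<le> k * M" "0 < M"
  obtains A B where "A \<noteq> 0 \<or> B \<noteq> 0" "bdd_poly N (C ^ k) A" "bdd_poly N (C ^ k) B"
    "\<And>i. (True, i) \<notin> I \<Longrightarrow> coeff A i = 0" "\<And>i. (False, i) \<notin> I \<Longrightarrow> coeff B i = 0"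
    "\<And>l z. l < n \<Longrightarrow> z \<in> Z \<Longrightarrow> lin \<alpha> \<beta> (hasse l A) (hasse l B) z = 0"
proof -
  obtain c0 where c0: "C = real c0" using C_nat by (auto elim: Nats_cases)
  define X where "X = c0 ^ k"
  have rX: "real X = C ^ k" by (simp add: X_def c0)
  have c01: "1 \<le> c0" using C4 c0 by simp
  have X1: "1 \<le> X" using c01 by (simp add: X_def)
  have "(real X * C ^ (4 * N + 4)) ^ (n * d) = real X ^ (n * d) * C ^ ((4 * N + 4) * (n * d))"
    by (simp only: power_mult_distrib power_mult[of C])
  also have "\<dots> \<le> real X ^ (n * d) * C ^ (k * M)"
    using assms(5) C4 by (intro mult_left_mono power_increasing) auto
  also have "\<dots> = real X ^ (n * d + M)" by (simp add: rX power_add power_mult)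
  also have "\<dots> \<le> real X ^ card I" using X1 assms(4) by (intro power_increasing) auto
  also have "\<dots> < real (X + 1) ^ card I"
    using assms(4,6) by (intro power_strict_mono) auto
  finally have *: "(real X * C ^ (4 * N + 4)) ^ (n * d) < real (X + 1) ^ card I" .
  show thesis
  proof (rule siegel[OF assms(1,2) real I X1 *], goal_cases)
    case (1 A B)
    then show thesis using that[of A B] by (simp add: rX)
  qed
qed

end

section \<open>The gap principle\<close>

context galois_approx
begin

lemma approx_facts:
  assumes "approx \<alpha> x y"
  shows "\<alpha> \<in> Z" "coprime x y" "y \<noteq> 0" "1 \<le> real_of_int (height x y)"
    "real_of_int (height x y) \<le> C * real_of_int \<bar>y\<bar>"
    "cmod (of_int x / of_int y - \<alpha>) \<le> C / real_of_int (height x y) ^ d"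
proof -
  show "1 \<le> real_of_int (height x y)"
    using assms height_ge(1)[of y x] unfolding approx_def by linarith
qed (use assms in \<open>auto simp: approx_def\<close>)

lemma ln_C: "1 \<le> ln C"
proof -
  have "exp 1 \<le> C" using exp_le C4 by linarith
  then show ?thesis using C4 by (subst ln_ge_iff) auto
qed

lemma approx_close:
  assumes "approx \<alpha> x y" "ln C \<le> ln (real_of_int (height x y))"
  shows "cmod (of_int x / of_int y - \<alpha>) \<le> 1" "cmod (of_int x / of_int y :: complex) \<le> 2 * C"
proof -
  note f = approx_facts[OF assms(1)]
  have "C \<le> real_of_int (height x y)" using assms(2) C4 f(4) by simp
  also have "\<dots> \<le> real_of_int (height x y) ^ d" using f(4) d_ge by (intro self_le_power) auto
  finally have "C / real_of_int (height x y) ^ d \<le> 1" using f(4) by simp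
  with f(6) show 1: "cmod (of_int x / of_int y - \<alpha>) \<le> 1" by linarith
  have "cmod (of_int x / of_int y :: complex) \<le> cmod (of_int x / of_int y - \<alpha>) + cmod \<alpha>"
    by (metis add_diff_cancel_left' add.commute diff_add_cancel norm_triangle_ineq)
  then show "cmod (of_int x / of_int y :: complex) \<le> 2 * C" using 1 root_le[OF f(1)] C4 by linarith
qed

text \<open>Multiplication by \<open>y1 ^ N * y2\<close> turns the difference into a nonzero
  integer.\<close>

lemma nonvanishing_lower_bound:
  assumes "degree A \<le> N" "degree B \<le> N" "y1 \<noteq> 0" "y2 \<noteq> 0"
    and nz: "poly (of_int_poly A) (of_int x1 / of_int y1 :: complex)
      \<noteq> of_int x2 / of_int y2 * poly (of_int_poly B) (of_int x1 / of_int y1)"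
  shows "1 \<le> real_of_int (height x1 y1) ^ N * real_of_int (height x2 y2)
    * cmod (poly (of_int_poly A) (of_int x1 / of_int y1)
      - of_int x2 / of_int y2 * poly (of_int_poly B) (of_int x1 / of_int y1))"
proof -
  let ?v = "poly (of_int_poly A) (of_int x1 / of_int y1 :: complex)
      - of_int x2 / of_int y2 * poly (of_int_poly B) (of_int x1 / of_int y1)"
  define k where "k = y2 * homog N A x1 y1 - x2 * homog N B x1 y1"
  have k: "of_int k = of_int y1 ^ N * of_int y2 * ?v"
    unfolding k_def of_int_diff of_int_mult of_int_homog[OF assms(1,3)] of_int_homog[OF assms(2,3)]
    using assms(4) by (simp add: algebra_simps)
  then have "k \<noteq> 0" using nz assms by auto
  then have "1 \<le> cmod (of_int k)" by simp
  also have "\<dots> = \<bar>real_of_int y1\<bar> ^ N * \<bar>real_of_int y2\<bar> * cmod ?v"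
    unfolding k by (simp add: norm_mult norm_power)
  also have "\<dots> \<le> real_of_int (height x1 y1) ^ N * real_of_int (height x2 y2) * cmod ?v"
    using height_ge(1)[of y1 x1] height_ge(1)[of y2 x2]
    by (intro mult_right_mono mult_mono power_mono) (auto simp: height_def)
  finally show ?thesis .
qed

text \<open>With \<open>\<xi> = x1/y1\<close>, \<open>\<eta> = x2/y2\<close> and the derivatives in
  place of \<open>A\<close> and \<open>B\<close>, the difference is
  \<open>(A - \<beta> B)(\<xi>) - (\<eta> - \<beta>) B(\<xi>)\<close>. The order of vanishing makes
  the first part small, the quality of \<open>\<eta>\<close> the second;
  \<open>nonvanishing_lower_bound\<close> limits how small both can be.\<close>

lemma approx_inequality:
  assumes "approx \<alpha> x1 y1" "approx \<beta> x2 y2" "ln C \<le> ln (real_of_int (height x1 y1))"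
    and bdd: "bdd_poly N X A" "bdd_poly N X B" and "l \<le> n"
    and van: "\<And>l. l < n \<Longrightarrow> lin \<alpha> \<beta> (hasse l A) (hasse l B) \<alpha> = 0"
    and nz: "poly (of_int_poly (hasse l A)) (of_int x1 / of_int y1 :: complex)
      \<noteq> of_int x2 / of_int y2 * poly (of_int_poly (hasse l B)) (of_int x1 / of_int y1)"
  defines "H1 \<equiv> real_of_int (height x1 y1)" and "H2 \<equiv> real_of_int (height x2 y2)"
  shows "1 \<le> H1 ^ N * H2 * (X * C ^ (4 * N + 2)) * ((C / H1 ^ d) ^ (n - l) + C / H2 ^ d)"
proof -
  define \<xi> :: complex where "\<xi> = of_int x1 / of_int y1"
  define \<eta> :: complex where "\<eta> = of_int x2 / of_int y2"
  note f1 = approx_facts[OF assms(1), folded H1_def] and f2 = approx_facts[OF assms(2), folded H2_def]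
  have X: "0 \<le> X" using bdd_poly_nonneg bdd by blast
  have "cmod (poly (of_int_poly (hasse l A)) \<xi> - \<eta> * poly (of_int_poly (hasse l B)) \<xi>)
      \<le> cmod (poly (of_int_poly (hasse l A)) \<xi> - \<beta> * poly (of_int_poly (hasse l B)) \<xi>)
        + cmod (\<eta> - \<beta>) * cmod (poly (of_int_poly (hasse l B)) \<xi>)"
    by (subst norm_mult[symmetric], rule order.trans[OF _ norm_triangle_ineq4]) (simp add: algebra_simps)
  also have "\<dots> \<le> X * C ^ (4 * N + 2) * (C / H1 ^ d) ^ (n - l) + C / H2 ^ d * (X * C ^ (3 * N))"
  proof (intro add_mono mult_mono)
    have "cmod (poly (of_int_poly (hasse l A)) \<xi> - \<beta> * poly (of_int_poly (hasse l B)) \<xi>)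
        \<le> X * C ^ (4 * N + 2) * cmod (\<xi> - \<alpha>) ^ (n - l)"
      unfolding \<xi>_def by (rule lin_hasse_taylor[OF bdd f1(1) f2(1) approx_close(1)[OF assms(1,3)] \<open>l \<le> n\<close> van])
    also have "\<dots> \<le> X * C ^ (4 * N + 2) * (C / H1 ^ d) ^ (n - l)"
      using f1(6) X C4 unfolding \<xi>_def by (intro mult_left_mono power_mono) auto
    finally show "cmod (poly (of_int_poly (hasse l A)) \<xi> - \<beta> * poly (of_int_poly (hasse l B)) \<xi>)
        \<le> X * C ^ (4 * N + 2) * (C / H1 ^ d) ^ (n - l)" .
    show "cmod (\<eta> - \<beta>) \<le> C / H2 ^ d" unfolding \<eta>_def by (rule f2)
    show "cmod (poly (of_int_poly (hasse l B)) \<xi>) \<le> X * C ^ (3 * N)"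
      unfolding \<xi>_def by (rule bdd_poly_hasse_eval[OF bdd(2) approx_close(2)[OF assms(1,3)] C4])
  qed (use C4 X f2 in auto)
  also have "\<dots> \<le> X * C ^ (4 * N + 2) * (C / H1 ^ d) ^ (n - l) + C / H2 ^ d * (X * C ^ (4 * N + 2))"
    using C4 X f2(4) by (intro add_left_mono mult_left_mono power_increasing) auto
  finally have le: "cmod (poly (of_int_poly (hasse l A)) \<xi> - \<eta> * poly (of_int_poly (hasse l B)) \<xi>)
      \<le> X * C ^ (4 * N + 2) * ((C / H1 ^ d) ^ (n - l) + C / H2 ^ d)" by (simp add: algebra_simps)
  have "1 \<le> H1 ^ N * H2 * cmod (poly (of_int_poly (hasse l A)) \<xi> - \<eta> * poly (of_int_poly (hasse l B)) \<xi>)"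
    unfolding \<xi>_def \<eta>_def H1_def H2_def
    by (rule nonvanishing_lower_bound[OF _ _ f1(3) f2(3) nz]) (rule bdd_polyD(1)[OF bdd_poly_hasse] bdd)+
  also have "\<dots> \<le> H1 ^ N * H2 * (X * C ^ (4 * N + 2) * ((C / H1 ^ d) ^ (n - l) + C / H2 ^ d))"
    using f1(4) f2(4) by (intro mult_left_mono le) auto
  finally show ?thesis by (simp add: mult.assoc)
qed

text \<open>The case \<open>n = 1\<close>, \<open>l = 0\<close>. Since \<open>h1 \<le> h2\<close>,
  both error terms are at most \<open>C / H1 ^ d\<close>, and \<open>gt\<close> says that this is
  too small for a nonzero value with denominator at most \<open>H1 ^ N * H2\<close>.\<close>

lemma gap_vanish:
  assumes "approx \<alpha> x1 y1" "approx \<beta> x2 y2"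
    and bdd: "bdd_poly N (C ^ k) A" "bdd_poly N (C ^ k) B" and van: "lin \<alpha> \<beta> A B \<alpha> = 0"
  defines "h1 \<equiv> ln (real_of_int (height x1 y1))" and "h2 \<equiv> ln (real_of_int (height x2 y2))"
  assumes "ln C \<le> h1" "h1 \<le> h2"
    and gt: "real (k + 4 * N + 4) * ln C + real N * h1 + h2 < real d * h1"
  shows "poly (of_int_poly A) (of_int x1 / of_int y1 :: complex)
      = of_int x2 / of_int y2 * poly (of_int_poly B) (of_int x1 / of_int y1)"
proof (rule ccontr)
  define H1 where "H1 = real_of_int (height x1 y1)"
  define H2 where "H2 = real_of_int (height x2 y2)"
  note f1 = approx_facts[OF assms(1), folded H1_def] and f2 = approx_facts[OF assms(2), folded H2_def]
  assume "\<not> ?thesis"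
  then have "1 \<le> H1 ^ N * H2 * (C ^ k * C ^ (4 * N + 2)) * ((C / H1 ^ d) ^ (1 - 0) + C / H2 ^ d)"
    using approx_inequality[OF assms(1,2) _ bdd, of 0 1] assms(8) van by (simp add: h1_def H1_def H2_def)
  also have "\<dots> \<le> H1 ^ N * H2 * (C ^ k * C ^ (4 * N + 2)) * (C / H1 ^ d + C / H1 ^ d)"
  proof -
    have "H1 \<le> H2" using assms(9) f1(4) f2(4) by (simp add: h1_def h2_def H1_def H2_def)
    then show ?thesis using f1(4) f2(4) C4
      by (intro mult_left_mono add_mono divide_left_mono power_mono) auto
  qed
  also have "\<dots> \<le> H1 ^ N * H2 * (C ^ k * C ^ (4 * N + 2)) * (C * C / H1 ^ d)"
    using f1(4) f2(4) C4 by (intro mult_left_mono) (auto simp: divide_right_mono simp flip: add_divide_distrib)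
  also have "\<dots> = H1 ^ N * H2 * C ^ (k + 4 * N + 4) / H1 ^ d"
    by (simp add: power_add eval_nat_numeral mult_ac)
  finally have "H1 ^ d \<le> H1 ^ N * H2 * C ^ (k + 4 * N + 4)" using f1(4) by (simp add: field_simps)
  then have "ln (H1 ^ d) \<le> ln (H1 ^ N * H2 * C ^ (k + 4 * N + 4))"
    using f1(4) f2(4) C4 by (subst ln_le_cancel_iff) auto
  also have "\<dots> = real N * h1 + h2 + real (k + 4 * N + 4) * ln C"
    using f1(4) f2(4) C4 by (simp add: ln_mult ln_realpow h1_def h2_def H1_def H2_def)
  finally show False using gt f1(4) by (simp add: ln_realpow h1_def H1_def)
qed

end

lemma cube_facts:
  assumes "(d::nat) \<ge> 3"
  shows "3 * d \<le> d ^ 2" "3 * d ^ 2 \<le> d ^ 3" "27 \<le> d ^ 3"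
proof -
  show "3 * d \<le> d ^ 2" using assms by (simp add: power2_eq_square)
  show "3 * d ^ 2 \<le> d ^ 3" using assms by (simp add: power2_eq_square power3_eq_cube)
  show "27 \<le> d ^ 3" using power_mono[OF assms, of 3] by simp
qed

section \<open>The case of a vanishing value: from small pairs to Moebius transformations\<close>

context galois_approx
begin

lemma pair_nonzero:
  assumes "\<alpha> \<in> Z" "\<beta> \<in> Z" "A \<noteq> 0 \<or> B \<noteq> 0" "degree A < d" "degree B < d" "lin \<alpha> \<beta> A B \<alpha> = 0"
  shows "A \<noteq> 0" "B \<noteq> 0" "poly (of_int_poly A) \<alpha> \<noteq> 0" "poly (of_int_poly B) \<alpha> \<noteq> 0"
proof -
  have eq: "poly (of_int_poly A) \<alpha> = \<beta> * poly (of_int_poly B) \<alpha>"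
    using assms by (simp add: lin_self)
  have "\<beta> \<noteq> 0" using irrational[OF assms(2), of 0] by simp
  then have "poly (of_int_poly A) \<alpha> = 0 \<longleftrightarrow> poly (of_int_poly B) \<alpha> = 0" using eq by auto
  then show "poly (of_int_poly A) \<alpha> \<noteq> 0" "poly (of_int_poly B) \<alpha> \<noteq> 0"
    using int_degree[OF assms(1)] assms(3-5) by auto
  then show "A \<noteq> 0" "B \<noteq> 0" by auto
qed

lemma wronskian_of_int: "wronskian (of_int_poly A) (of_int_poly B) = (of_int_poly (wronskian A B) :: 'b::{idom,ring_char_0} poly)"
  by (simp add: wronskian_def hom_distribs of_int_hom.map_poly_pderiv)

lemma wronskian_nonzero:
  fixes w c :: complex
  assumes van: "poly (of_int_poly A) w = c * poly (of_int_poly B) w" "poly (of_int_poly B) w \<noteq> 0"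
    and c: "\<And>r. c \<noteq> of_rat r"
  shows "wronskian A B \<noteq> 0"
proof
  assume "wronskian A B = 0"
  then have "wronskian (map_poly rat_of_int A) (map_poly rat_of_int B) = 0"
    by (simp add: wronskian_of_int)
  moreover have "map_poly rat_of_int B \<noteq> 0" using van by auto
  ultimately obtain r where "map_poly rat_of_int A = smult r (map_poly rat_of_int B)"
    using wronskian_0_imp_proportional by blast
  then have "map_poly of_rat (map_poly rat_of_int A) = (map_poly of_rat (smult r (map_poly rat_of_int B)) :: complex poly)"
    by simp
  then have "of_int_poly A = smult (of_rat r) (of_int_poly B :: complex poly)"
    by (simp add: map_poly_of_rat_of_int hom_distribs of_rat_hom.map_poly_hom_smult)
  then have "poly (of_int_poly A) w = of_rat r * poly (of_int_poly B) w" by simp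
  then show False using van c by auto
qed

text \<open>A double zero of \<open>A - \<beta> B\<close> at \<open>\<alpha>\<close> would be a zero
  of the Wronskian. Its degree is below \<open>d\<close>, so it would vanish identically and
  \<open>\<beta>\<close> would be rational.\<close>

lemma derivative_nonzero:
  assumes "\<alpha> \<in> Z" "\<beta> \<in> Z" "A \<noteq> 0 \<or> B \<noteq> 0" "degree A \<le> N" "degree B \<le> N" "2 * N \<le> d" "lin \<alpha> \<beta> A B \<alpha> = 0"
  shows "lin \<alpha> \<beta> (hasse 1 A) (hasse 1 B) \<alpha> \<noteq> 0"
proof
  assume "lin \<alpha> \<beta> (hasse 1 A) (hasse 1 B) \<alpha> = 0"
  then have "poly (of_int_poly (pderiv A)) \<alpha> = \<beta> * poly (of_int_poly (pderiv B)) \<alpha>"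
    using assms(1,2) hasse_1[of A] hasse_1[of B] by (simp add: lin_self)
  moreover have eq: "poly (of_int_poly A) \<alpha> = \<beta> * poly (of_int_poly B) \<alpha>"
    using assms by (simp add: lin_self)
  ultimately have "poly (of_int_poly (wronskian A B)) \<alpha> = 0"
    by (simp add: wronskian_def hom_distribs)
  moreover have deg: "degree A < d" "degree B < d" using assms(4-6) d_ge by auto
  have "degree (wronskian A B) < d" using degree_wronskian'[OF assms(4,5)] assms(6) d_ge by linarith
  ultimately have "wronskian A B = 0" using int_degree[OF assms(1)] by blast
  moreover have "wronskian A B \<noteq> 0"
    using pair_nonzero[OF assms(1-3) deg assms(7)] eq irrational[OF assms(2)]
    by (intro wronskian_nonzero[of A \<alpha> \<beta> B]) auto
  ultimately show False by simp
qed

text \<open>Liouville's lower bound for the distance to a root, obtained from the general estimates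
  with the pair \<open>(f, 0)\<close> and the dummy approximation \<open>0 / 1\<close>.\<close>

lemma root_approx_lower_bound:
  assumes "approx \<alpha> x y" "ln C \<le> ln (real_of_int (height x y))"
  shows "1 \<le> real_of_int (height x y) ^ d * (C ^ (4 * d + 3) * cmod (of_int x / of_int y - \<alpha>))"
proof -
  note f = approx_facts[OF assms(1)]
  define \<xi> :: complex where "\<xi> = of_int x / of_int y"
  have bf: "bdd_poly d C f" "bdd_poly d C 0" using coeff_le C4 by (auto simp: bdd_poly_def d)
  have "\<xi> = of_rat (of_int x / of_int y)" by (simp add: \<xi>_def of_rat_divide)
  then have "\<xi> \<notin> Z" using irrational by blast
  then have "1 \<le> real_of_int (height x y) ^ d * real_of_int (height 0 1) * cmod (poly (of_int_poly f) \<xi> - of_int 0 / of_int 1 * poly (of_int_poly 0) \<xi>)"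
    unfolding \<xi>_def using f(3) by (intro nonvanishing_lower_bound) (auto simp: d root_iff)
  also have "\<dots> = real_of_int (height x y) ^ d * cmod (poly (of_int_poly (hasse 0 f)) \<xi> - \<alpha> * poly (of_int_poly (hasse 0 0)) \<xi>)"
    by (simp add: height_def)
  also have "cmod (poly (of_int_poly (hasse 0 f)) \<xi> - \<alpha> * poly (of_int_poly (hasse 0 0)) \<xi>)
      \<le> C * C ^ (4 * d + 2) * cmod (\<xi> - \<alpha>) ^ (1 - 0)"
    using f(1) approx_close[OF assms]
    by (intro lin_hasse_taylor[OF bf]) (auto simp: \<xi>_def lin_def root_iff)
  finally show ?thesis using f(4) by (simp add: \<xi>_def eval_nat_numeral mult.assoc mult_left_mono)
qed

text \<open>\<open>A - \<beta> B\<close> has a simple zero at \<open>\<alpha>\<close>, so its value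
  at \<open>x1 / y1\<close> is at least about the distance to \<open>\<alpha>\<close>, hence at
  least about \<open>1 / H1 ^ d\<close>. By \<open>eq\<close> the same value is at most about
  \<open>1 / H2 ^ d\<close>.\<close>

lemma height_comparison:
  assumes "approx \<alpha> x1 y1" "approx \<beta> x2 y2" "A \<noteq> 0 \<or> B \<noteq> 0" "2 * N \<le> d"
    and bdd: "bdd_poly N (C ^ (4 * d ^ 2)) A" "bdd_poly N (C ^ (4 * d ^ 2)) B" and van: "lin \<alpha> \<beta> A B \<alpha> = 0"
    and eq: "poly (of_int_poly A) (of_int x1 / of_int y1 :: complex)
      = of_int x2 / of_int y2 * poly (of_int_poly B) (of_int x1 / of_int y1)"
  defines "h1 \<equiv> ln (real_of_int (height x1 y1))" and "h2 \<equiv> ln (real_of_int (height x2 y2))"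
  assumes h1: "1000 * real d ^ 3 * ln C \<le> h1"
  shows "real d * h2 \<le> real d * h1 + 20 * real d ^ 3 * ln C"
proof -
  define \<xi> :: complex where "\<xi> = of_int x1 / of_int y1"
  define \<eta> :: complex where "\<eta> = of_int x2 / of_int y2"
  define H1 where "H1 = real_of_int (height x1 y1)"
  define H2 where "H2 = real_of_int (height x2 y2)"
  define X where "X = C ^ (4 * d ^ 2)"
  define V where "V = X * C ^ (4 * N + 3)"
  define g where "g = cmod (lin \<alpha> \<beta> (hasse 1 A) (hasse 1 B) \<alpha>)"
  define e where "e = cmod (\<xi> - \<alpha>)"
  note f1 = approx_facts[OF assms(1), folded H1_def \<xi>_def e_def]
    and f2 = approx_facts[OF assms(2), folded H2_def \<eta>_def]
  have X1: "1 \<le> X" unfolding X_def using C4 by (intro one_le_power) auto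
  have V1: "1 \<le> V" unfolding V_def using C4 X1 by (intro mult_ge1_I one_le_power) auto
  have d27: "27 \<le> real d ^ 3" using cube_facts(3)[OF d_ge] by (metis of_nat_le_iff of_nat_numeral of_nat_power)
  have "ln C \<le> 1000 * real d ^ 3 * ln C" using ln_C d27 by (intro mult_le_cancel_right1[THEN iffD2]) auto
  then have lC: "ln C \<le> ln (real_of_int (height x1 y1))" using h1 by (simp add: h1_def)
  have degN: "degree A \<le> N" "degree B \<le> N" using bdd by (auto dest: bdd_polyD)
  have nz: "lin \<alpha> \<beta> (hasse 1 A) (hasse 1 B) \<alpha> \<noteq> 0"
    by (rule derivative_nonzero[OF f1(1) f2(1) assms(3) degN assms(4) van])
  have g: "1 \<le> g * V ^ d" unfolding g_def V_def
    by (rule lin_hasse_lower_bound[OF bdd[folded X_def] f1(1) f2(1) X1 nz])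
  then have g0: "0 < g" using V1 by (metis g_def mult_zero_left nz not_one_le_zero zero_less_norm_iff)
  have a: "1 \<le> H1 ^ d * (C ^ (4 * d + 3) * e)"
    unfolding H1_def e_def \<xi>_def by (rule root_approx_lower_bound[OF assms(1) lC])
  have e0: "0 < e" using a by (metis e_def mult_zero_right not_one_le_zero norm_eq_zero zero_less_norm_iff)
  have close: "e \<le> 1" "cmod \<xi> \<le> 2 * C"
    unfolding e_def \<xi>_def by (rule approx_close[OF assms(1) lC])+
  \<comment> \<open>The exponents of \<open>C\<close> that are collected in \<open>VH\<close> and in
    the final chain, respectively.\<close>
  have nat1: "1 + (4 * d ^ 2 + (4 * N + 3)) * (d + 1) \<le> 20 * d ^ 3"
    "1 + (4 * d ^ 2 + 2 * N + 1) + (4 * d ^ 2 + (4 * N + 3)) * d + (4 * d + 3) \<le> 20 * d ^ 3"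
  proof -
    have m: "N * (d * 4) \<le> 2 * d ^ 2" using assms(4) by (simp add: power2_eq_square)
    have x: "d * (4 * d ^ 2) = 4 * d ^ 3" by (simp add: power2_eq_square power3_eq_cube)
    show "1 + (4 * d ^ 2 + (4 * N + 3)) * (d + 1) \<le> 20 * d ^ 3"
      using m cube_facts[OF d_ge] assms(4) by (simp add: algebra_simps x)
    show "1 + (4 * d ^ 2 + 2 * N + 1) + (4 * d ^ 2 + (4 * N + 3)) * d + (4 * d + 3) \<le> 20 * d ^ 3"
      using m cube_facts[OF d_ge] assms(4) by (simp add: algebra_simps x)
  qed
  have "2 * V ^ (d + 1) \<le> C ^ (1 + (4 * d ^ 2 + (4 * N + 3)) * (d + 1))"
    unfolding V_def X_def using C4 by (simp only: power_add power_mult) (simp add: power_mult_distrib)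
  also have "\<dots> \<le> C ^ (20 * d ^ 3)" using nat1(1) C4 by (intro power_increasing) auto
  also have "\<dots> \<le> H1 ^ d"
  proof -
    have "ln (C ^ (20 * d ^ 3)) = 20 * real d ^ 3 * ln C" using C4 by (simp add: ln_realpow)
    also have "\<dots> \<le> 1000 * real d ^ 3 * ln C" using ln_C d27 by (intro mult_right_mono) auto
    also have "\<dots> \<le> h1" by (rule h1)
    also have "\<dots> \<le> real d * h1" using d_ge f1(4) unfolding h1_def H1_def[symmetric] by (intro mult_le_cancel_right1[THEN iffD2]) auto
    also have "\<dots> = ln (H1 ^ d)" using f1(4) by (simp add: ln_realpow h1_def H1_def)
    finally show ?thesis using C4 f1(4) by (subst (asm) ln_le_cancel_iff) auto
  qed
  finally have VH: "2 * V ^ (d + 1) \<le> H1 ^ d" .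
  \<comment> \<open>The quadratic remainder may take half of the linear term, which still leaves a
    lower bound.\<close>
  have quad: "X * C ^ (4 * N + 2) * e \<le> g / 2"
  proof -
    have "X * C ^ (4 * N + 2) * e \<le> X * C ^ (4 * N + 2) * (C / H1 ^ d)"
      using f1(6) X1 C4 by (intro mult_left_mono) auto
    also have "\<dots> = V / H1 ^ d" by (simp add: V_def eval_nat_numeral mult_ac)
    also have "\<dots> \<le> V / (2 * V ^ (d + 1))" using VH V1 f1(4) by (intro divide_left_mono mult_pos_pos zero_less_power) auto
    also have "\<dots> = 1 / (2 * V ^ d)" using V1 by (simp add: field_simps)
    also have "\<dots> \<le> g / 2" using g V1 by (simp add: field_simps)
    finally show ?thesis .
  qed
  have val: "cmod (poly (of_int_poly A) \<xi> - \<beta> * poly (of_int_poly B) \<xi>) \<le> C / H2 ^ d * (X * C ^ (2 * N))"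
  proof -
    have "poly (of_int_poly A) \<xi> - \<beta> * poly (of_int_poly B) \<xi> = (\<eta> - \<beta>) * poly (of_int_poly B) \<xi>"
      using eq by (simp add: \<xi>_def \<eta>_def algebra_simps)
    then have "cmod (poly (of_int_poly A) \<xi> - \<beta> * poly (of_int_poly B) \<xi>) = cmod (\<eta> - \<beta>) * cmod (poly (of_int_poly B) \<xi>)"
      by (simp add: norm_mult)
    also have "\<dots> \<le> C / H2 ^ d * (X * C ^ (2 * N))"
      using f2(4,6) C4 bdd_poly_eval[OF bdd(2) close(2) C4] unfolding X_def[symmetric]
      by (intro mult_mono) auto
    finally show ?thesis .
  qed
  have "cmod (poly (of_int_poly A) \<xi> - \<beta> * poly (of_int_poly B) \<xi> - lin \<alpha> \<beta> (hasse 1 A) (hasse 1 B) \<alpha> * (\<xi> - \<alpha>))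
      \<le> X * C ^ (4 * N + 2) * e ^ 2"
    unfolding e_def by (rule lin_linear_term[OF bdd[folded X_def] f1(1) f2(1) _ van]) (use close in \<open>simp add: e_def\<close>)
  then have "g * e \<le> X * C ^ (4 * N + 2) * e ^ 2 + C / H2 ^ d * (X * C ^ (2 * N))"
    using val norm_triangle_sub[of "lin \<alpha> \<beta> (hasse 1 A) (hasse 1 B) \<alpha> * (\<xi> - \<alpha>)" "poly (of_int_poly A) \<xi> - \<beta> * poly (of_int_poly B) \<xi>"]
    by (simp add: g_def e_def norm_mult norm_minus_commute)
  also have "X * C ^ (4 * N + 2) * e ^ 2 \<le> g / 2 * e"
    using mult_right_mono[OF quad, of e] e0 by (simp add: power2_eq_square mult_ac)
  finally have "g * e / 2 \<le> C / H2 ^ d * (X * C ^ (2 * N))" by linarith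
  then have "H2 ^ d * (g * e) \<le> 2 * (X * C ^ (2 * N + 1))" using f2(4) by (simp add: field_simps)
  then have 1: "H2 ^ d * (g * e) * (V ^ d * H1 ^ d * C ^ (4 * d + 3)) \<le> 2 * (X * C ^ (2 * N + 1)) * (V ^ d * H1 ^ d * C ^ (4 * d + 3))"
    using V1 f1(4) C4 by (intro mult_right_mono) auto
  have "H2 ^ d \<le> H2 ^ d * ((g * V ^ d) * (H1 ^ d * (C ^ (4 * d + 3) * e)))"
    using f2(4) mult_mono[OF g a] g0 V1 by (intro mult_le_cancel_left1[THEN iffD2]) auto
  also have "\<dots> = H2 ^ d * (g * e) * (V ^ d * H1 ^ d * C ^ (4 * d + 3))" by (simp add: mult_ac)
  also note 1
  also have "2 * (X * C ^ (2 * N + 1)) * (V ^ d * H1 ^ d * C ^ (4 * d + 3))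
      \<le> C * (X * C ^ (2 * N + 1)) * (V ^ d * H1 ^ d * C ^ (4 * d + 3))"
    using C4 X1 V1 f1(4) by (intro mult_right_mono) auto
  also have "\<dots> = C ^ (1 + (4 * d ^ 2 + 2 * N + 1) + (4 * d ^ 2 + (4 * N + 3)) * d + (4 * d + 3)) * H1 ^ d"
  proof -
    have "V ^ d = C ^ ((4 * d ^ 2 + (4 * N + 3)) * d)"
      unfolding V_def X_def by (simp only: power_mult power_add)
    then show ?thesis unfolding X_def by (simp only: power_add power_one_right mult_ac)
  qed
  also have "\<dots> \<le> C ^ (20 * d ^ 3) * H1 ^ d"
    using nat1(2) C4 f1(4) by (intro mult_right_mono power_increasing) auto
  finally have "ln (H2 ^ d) \<le> ln (C ^ (20 * d ^ 3) * H1 ^ d)"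
    using f1(4) f2(4) C4 by (subst ln_le_cancel_iff) auto
  also have "\<dots> = 20 * real d ^ 3 * ln C + real d * h1"
    using f1(4) C4 by (simp add: ln_mult ln_realpow h1_def H1_def)
  finally show ?thesis using f2(4) by (simp add: ln_realpow h2_def H2_def)
qed

end

lemma common_denominator:
  assumes "finite (S :: rat set)"
  shows "\<exists>L::int. L \<noteq> 0 \<and> (\<forall>r\<in>S. \<exists>k::int. of_int L * r = of_int k)"
  using assms
proof (induction S)
  case empty
  then show ?case by (intro exI[of _ 1]) auto
next
  case (insert r S)
  then obtain L :: int where L: "L \<noteq> 0" "\<And>r. r \<in> S \<Longrightarrow> \<exists>k::int. of_int L * r = of_int k" by blast
  obtain p q where pq: "quotient_of r = (p, q)" by fastforce
  have q: "q > 0" by (rule quotient_of_denom_pos[OF pq])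
  have r: "r = of_int p / of_int q" by (rule quotient_of_div[OF pq])
  show ?case
  proof (rule exI[of _ "q * L"], intro conjI ballI)
    show "q * L \<noteq> 0" using L q by simp
    fix w assume w: "w \<in> insert r S"
    show "\<exists>k::int. of_int (q * L) * w = of_int k"
    proof (cases "w = r")
      case True
      then show ?thesis using q r by (intro exI[of _ "p * L"]) (simp add: field_simps)
    next
      case False
      then obtain k :: int where "of_int L * w = of_int k" using L w by blast
      then show ?thesis by (intro exI[of _ "q * k"]) (simp add: mult.assoc)
    qed
  qed
qed

lemma coeff_mult_bound:
  assumes "bdd_poly N X A" "bdd_poly N X B"
  shows "real_of_int \<bar>coeff (A * B) i\<bar> \<le> real (N + 1) * X ^ 2"
proof -
  have X: "0 \<le> X" using bdd_poly_nonneg assms by blast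
  have "coeff (A * B) i = (\<Sum>j\<le>i. coeff A j * coeff B (i - j))" by (rule coeff_mult)
  also have "\<dots> = (\<Sum>j\<in>{..i} \<inter> {..N}. coeff A j * coeff B (i - j))"
    using bdd_polyD(1)[OF assms(1)] by (intro sum.mono_neutral_right) (auto simp: coeff_eq_0)
  finally have "real_of_int \<bar>coeff (A * B) i\<bar> = \<bar>\<Sum>j\<in>{..i} \<inter> {..N}. real_of_int (coeff A j) * real_of_int (coeff B (i - j))\<bar>"
    by simp
  also have "\<dots> \<le> (\<Sum>j\<in>{..i} \<inter> {..N}. \<bar>real_of_int (coeff A j) * real_of_int (coeff B (i - j))\<bar>)"
    by (rule sum_abs)
  also have "\<dots> \<le> (\<Sum>j\<in>{..i} \<inter> {..N}. X * X)"
    using bdd_polyD(2)[OF assms(1)] bdd_polyD(2)[OF assms(2)] X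
    by (intro sum_mono) (auto simp: abs_mult intro!: mult_mono)
  also have "\<dots> \<le> (\<Sum>j\<in>{..N}. X * X)"
    using X by (intro sum_mono2) auto
  finally show ?thesis by (simp add: power2_eq_square)
qed

context galois_approx
begin

lemma bdd_poly_mono: "bdd_poly N X A \<Longrightarrow> N \<le> N' \<Longrightarrow> bdd_poly N' X A"
  by (auto simp: bdd_poly_def)

text \<open>If some pair of higher degree than a Moebius transformation related \<open>\<alpha>\<close> and \<open>\<beta>\<close>, then a second,
  independent pair of degree at most \<open>d - 2\<close> with small coefficients would exist, and both would
  vanish at the two approximations.\<close>

lemma reduced_degree:
  assumes "approx \<alpha> x1 y1" "approx \<beta> x2 y2" "A \<noteq> 0 \<or> B \<noteq> 0" "2 * N \<le> d"
    and bdd: "bdd_poly N (C ^ (4 * d ^ 2)) A" "bdd_poly N (C ^ (4 * d ^ 2)) B" and van: "lin \<alpha> \<beta> A B \<alpha> = 0"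
    and eq: "poly (of_int_poly A) (of_int x1 / of_int y1 :: complex)
      = of_int x2 / of_int y2 * poly (of_int_poly B) (of_int x1 / of_int y1)"
    and fac: "map_poly rat_of_int A = A0 * g" "map_poly rat_of_int B = B0 * g" "coprime A0 B0"
  defines "h1 \<equiv> ln (real_of_int (height x1 y1))" and "h2 \<equiv> ln (real_of_int (height x2 y2))"
  assumes h1: "1000 * real d ^ 3 * ln C \<le> h1" and h12: "h1 \<le> h2" "2 * h2 \<le> 3 * h1"
  shows "degree A0 \<le> 1" "degree B0 \<le> 1"
proof -
  define r where "r = max (degree A0) (degree B0)"
  note f1 = approx_facts[OF assms(1)] and f2 = approx_facts[OF assms(2)]
  have degs: "degree A \<le> N" "degree B \<le> N" using bdd by (auto dest: bdd_polyD)
  have Nd: "N < d" using assms(4) d_ge by linarith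
  note nzs = pair_nonzero[OF f1(1) f2(1) assms(3) le_less_trans[OF degs(1) Nd] le_less_trans[OF degs(2) Nd] van]
  have nz0: "A0 \<noteq> 0" "B0 \<noteq> 0" "g \<noteq> 0" using nzs(1,2) fac by auto
  have "r \<le> 1"
  proof (rule ccontr)
    assume "\<not> r \<le> 1"
    then have r2: "2 \<le> r" by simp
    have "degree A = degree A0 + degree g" "degree B = degree B0 + degree g"
      using arg_cong[OF fac(1), of degree] arg_cong[OF fac(2), of degree] nz0 by (simp_all add: degree_mult_eq)
    then have rN: "r \<le> N" using degs unfolding r_def by auto
    then have d4: "4 \<le> d" "r \<le> d - 2" using r2 assms(4) by auto
    \<comment> \<open>Every nonzero multiple \<open>(A0 * G, B0 * G)\<close> of degree at most
      \<open>d - 2\<close> has \<open>degree G \<le> d - 2 - r\<close>, so the leading term of its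
      first component sits at a position in \<open>K\<close>. Forbidding these positions excludes
      all such multiples, and \<open>r \<ge> 2\<close> still leaves \<open>d + 1\<close> unknowns
      for the \<open>d\<close> conditions.\<close>
    define K where "K = {True} \<times> {degree A0..degree A0 + (d - 2 - r)}"
    define I where "I = UNIV \<times> {..d - 2} - K"
    have "card (UNIV \<times> {..d - 2} :: (bool \<times> nat) set) - card K \<le> card I"
      unfolding I_def by (rule diff_card_le_card_Diff) (simp add: K_def)
    moreover have "card (UNIV \<times> {..d - 2} :: (bool \<times> nat) set) = 2 * (d - 1)"
      using d4 by (simp add: card_cartesian_product)
    moreover have "card K = d - 1 - r" using d4 by (simp add: K_def card_cartesian_product)
    ultimately have cI: "1 * d + 1 \<le> card I" using r2 d4 by linarith
    have cond: "(4 * (d - 2) + 4) * (1 * d) \<le> 4 * d ^ 2 * 1"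
      using d4 by (simp add: power2_eq_square)
    have "I \<subseteq> UNIV \<times> {..d - 2}" by (auto simp: I_def)
    then show False
    proof (rule siegel'[OF f1(1) f2(1) _ cI cond], goal_cases)
      case (2 A2 B2)
      note bd2 = 2(2,3)
      have van2: "lin \<alpha> \<beta> A2 B2 \<alpha> = 0" using 2(6)[of 0 \<alpha>] f1(1) by simp
      \<comment> \<open>The determinant of the two pairs is nonzero, since the second pair is no
        multiple of \<open>(A0, B0)\<close>, and it vanishes at \<open>x1 / y1\<close>. Hence
        \<open>y1\<close> is bounded by its leading coefficient, which is far too small.\<close>
      define U where "U = A * B2 - A2 * B"
      have c0: "1 \<le> ln C" by (rule ln_C)
      have d27: "27 \<le> real d ^ 3" using cube_facts(3)[OF d_ge] by (metis of_nat_le_iff of_nat_numeral of_nat_power)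
      have rc: "3 * real d \<le> real d ^ 2" "3 * real d ^ 2 \<le> real d ^ 3"
        using d_ge by (simp_all add: power2_eq_square power3_eq_cube)
      have kc: "real (4 * d ^ 2 + 4 * (d - 2) + 4) * ln C \<le> 20 * real d ^ 3 * ln C"
        using c0 d27 rc d4 by (intro mult_right_mono) (simp_all add: of_nat_diff)
      have h1c: "20 * real d ^ 3 * ln C \<le> h1 / 50" using h1 by simp
      have h1pos: "0 < h1"
        using h1 c0 d27 mult_mono[of 27 "real d ^ 3" 1 "ln C"] by simp
      have eq2: "poly (of_int_poly A2) (of_int x1 / of_int y1 :: complex)
          = of_int x2 / of_int y2 * poly (of_int_poly B2) (of_int x1 / of_int y1)"
      proof (rule gap_vanish[OF assms(1,2) bd2 van2, folded h1_def h2_def])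
        show "ln C \<le> h1" using h1 mult_right_mono[of 1 "1000 * real d ^ 3" "ln C"] c0 d27 by linarith
        show "h1 \<le> h2" by fact
        have "real (d - 2) * h1 = real d * h1 - 2 * h1" using d4 by (simp add: of_nat_diff algebra_simps)
        then show "real (4 * d ^ 2 + 4 * (d - 2) + 4) * ln C + real (d - 2) * h1 + h2 < real d * h1"
          using kc h1c h12 h1pos by linarith
      qed
      have "U \<noteq> 0"
      proof
        assume "U = 0"
        define a2 where "a2 = map_poly rat_of_int A2"
        define b2 where "b2 = map_poly rat_of_int B2"
        have "map_poly rat_of_int (A * B2) = map_poly rat_of_int (A2 * B)" using \<open>U = 0\<close> by (simp add: U_def)
        then have "g * (A0 * b2) = g * (a2 * B0)"
          by (simp add: hom_distribs fac a2_def b2_def mult_ac)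
        then have e: "A0 * b2 = a2 * B0" using nz0 by (metis mult_cancel_left)
        then have "A0 dvd a2 * B0" by (metis dvd_triv_left)
        then have "A0 dvd a2" using fac(3) by (simp add: coprime_dvd_mult_left_iff)
        then obtain G where G: "a2 = A0 * G" by blast
        have "A0 * b2 = A0 * (G * B0)" using e G by (simp add: mult_ac)
        then have G2: "b2 = G * B0" using nz0 by (metis mult_cancel_left)
        have "G \<noteq> 0"
        proof
          assume "G = 0"
          then have "a2 = 0" "b2 = 0" using G G2 by auto
          then show False using 2(1) by (simp add: a2_def b2_def)
        qed
        then have "degree a2 = degree A0 + degree G" "degree b2 = degree G + degree B0"
          using G G2 nz0 by (simp_all add: degree_mult_eq)
        moreover have "degree a2 \<le> d - 2" "degree b2 \<le> d - 2"
          using bdd_polyD(1)[OF bd2(1)] bdd_polyD(1)[OF bd2(2)] by (simp_all add: a2_def b2_def)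
        ultimately have "degree G \<le> d - 2 - r" unfolding r_def by auto
        then have "(True, degree A0 + degree G) \<notin> I" by (simp add: I_def K_def)
        then have "coeff A2 (degree A0 + degree G) = 0" by (rule 2(4))
        then have "coeff a2 (degree A0 + degree G) = 0" by (simp add: a2_def)
        then have "lead_coeff A0 * lead_coeff G = 0" using G by (simp add: coeff_mult_degree_sum)
        then show False using nz0 \<open>G \<noteq> 0\<close> by simp
      qed
      moreover have "poly (of_int_poly U) (of_int x1 / of_int y1 :: complex) = 0"
        using eq eq2 by (simp add: U_def hom_distribs)
      ultimately have y1: "\<bar>y1\<bar> \<le> \<bar>lead_coeff U\<bar>"
        by (rule rational_root_denominator[OF _ _ f1(2,3)])
      define X where "X = C ^ (4 * d ^ 2)"
      have X1: "1 \<le> X" unfolding X_def using C4 by (intro one_le_power) auto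
      have bdA: "bdd_poly (d - 2) X A" "bdd_poly (d - 2) X B"
        using bdd_poly_mono[OF bdd(1)] bdd_poly_mono[OF bdd(2)] d4 assms(4) by (auto simp: X_def)
      have "real_of_int \<bar>lead_coeff U\<bar> \<le> real_of_int \<bar>coeff (A * B2) (degree U)\<bar> + real_of_int \<bar>coeff (A2 * B) (degree U)\<bar>"
        by (simp add: U_def)
      also have "\<dots> \<le> 2 * (real (d - 2 + 1) * X ^ 2)"
        using coeff_mult_bound[OF bdA(1) bd2(2)[folded X_def], of "degree U"]
          coeff_mult_bound[OF bd2(1)[folded X_def] bdA(2), of "degree U"] by linarith
      also have "\<dots> \<le> C * (C * X ^ 2)"
        using d_le C4 d4 X1 by (intro mult_mono) (auto simp: of_nat_diff)
      finally have "real_of_int \<bar>y1\<bar> \<le> C * (C * X ^ 2)" using y1 by linarith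
      then have "real_of_int (height x1 y1) \<le> C * (C * (C * X ^ 2))"
        using f1(5) C4 by (meson mult_left_mono order.trans zero_le_numeral)
      then have "h1 \<le> ln (C * (C * (C * X ^ 2)))"
        unfolding h1_def using f1(4) C4 X1 by (subst ln_le_cancel_iff) auto
      also have "\<dots> = real (8 * d ^ 2 + 3) * ln C"
        using C4 by (simp add: X_def ln_mult ln_realpow algebra_simps)
      also have "\<dots> \<le> 20 * real d ^ 3 * ln C"
        using c0 d27 rc by (intro mult_right_mono) simp_all
      also have "\<dots> \<le> h1 / 50" by (rule h1c)
      finally show False using h1pos by simp
    qed simp
  qed
  then show "degree A0 \<le> 1" "degree B0 \<le> 1" by (auto simp: r_def)
qed

text \<open>The Moebius transformation is the quotient of the Siegel pair in lowest terms, with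
  denominators cleared. The margin \<open>h1 / 16\<close> below the exponent \<open>d / 2\<close>
  absorbs all constants, which amount to at most \<open>h1 / 50\<close>.\<close>

lemma gap_principle:
  assumes "approx \<alpha> x1 y1" "approx \<beta> x2 y2"
  defines "h1 \<equiv> ln (real_of_int (height x1 y1))" and "h2 \<equiv> ln (real_of_int (height x2 y2))"
  assumes h1: "1000 * real d ^ 3 * ln C \<le> h1" and h12: "h1 \<le> h2" "h2 < (real d / 2 - 1 / 16) * h1"
  obtains s u t v :: int where "s * v - t * u \<noteq> 0"
    "of_int s * \<alpha> + of_int u = \<beta> * (of_int t * \<alpha> + of_int v)"
    "y2 * (s * x1 + u * y1) = x2 * (t * x1 + v * y1)"
proof -
  note f1 = approx_facts[OF assms(1)] and f2 = approx_facts[OF assms(2)]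
  define N where "N = d div 2"
  have N2: "2 * N \<le> d" by (simp add: N_def)
  have Nd: "N < d" using N2 d_ge by linarith
  have c0: "1 \<le> ln C" by (rule ln_C)
  have d27: "27 \<le> real d ^ 3" using cube_facts(3)[OF d_ge] by (metis of_nat_le_iff of_nat_numeral of_nat_power)
  have rc: "3 * real d \<le> real d ^ 2" "3 * real d ^ 2 \<le> real d ^ 3"
    using d_ge by (simp_all add: power2_eq_square power3_eq_cube)
  have h1pos: "0 < h1" using h1 c0 d27 mult_mono[of 27 "real d ^ 3" 1 "ln C"] by simp
  have h1c: "20 * real d ^ 3 * ln C \<le> h1 / 50" using h1 by simp
  have lC: "ln C \<le> h1" using h1 mult_right_mono[of 1 "1000 * real d ^ 3" "ln C"] c0 d27 by linarith
  \<comment> \<open>\<open>N = d div 2\<close> leaves at least one unknown more than the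
    \<open>d\<close> conditions for either parity of \<open>d\<close>.\<close>
  have cI: "1 * d + 1 \<le> card (UNIV \<times> {..N} :: (bool \<times> nat) set)"
    by (simp add: card_cartesian_product N_def)
  have cond: "(4 * N + 4) * (1 * d) \<le> 4 * d ^ 2 * 1" using Nd by (simp add: power2_eq_square)
  obtain A B where AB: "A \<noteq> 0 \<or> B \<noteq> 0" "bdd_poly N (C ^ (4 * d ^ 2)) A" "bdd_poly N (C ^ (4 * d ^ 2)) B"
    "\<And>l z. l < 1 \<Longrightarrow> z \<in> Z \<Longrightarrow> lin \<alpha> \<beta> (hasse l A) (hasse l B) z = 0"
  proof (rule siegel'[OF f1(1) f2(1) order.refl cI cond], goal_cases)
    case (2 A B)
    then show ?thesis using that[of A B] by blast
  qed simp
  note bdd = AB(2,3)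
  have van: "lin \<alpha> \<beta> A B \<alpha> = 0" using AB(4)[of 0 \<alpha>] f1(1) by simp
  have eq: "poly (of_int_poly A) (of_int x1 / of_int y1 :: complex)
      = of_int x2 / of_int y2 * poly (of_int_poly B) (of_int x1 / of_int y1)"
  proof (rule gap_vanish[OF assms(1,2) bdd van, folded h1_def h2_def])
    show "ln C \<le> h1" by fact
    show "h1 \<le> h2" by fact
    have "real (4 * d ^ 2 + 4 * N + 4) * ln C \<le> 20 * real d ^ 3 * ln C"
      using c0 d27 rc Nd by (intro mult_right_mono) simp_all
    moreover have "real N * h1 \<le> real d / 2 * h1" using N2 h1pos by (intro mult_right_mono) simp_all
    moreover have "(real d / 2 - 1 / 16) * h1 = real d / 2 * h1 - h1 / 16" by (simp add: algebra_simps)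
    ultimately show "real (4 * d ^ 2 + 4 * N + 4) * ln C + real N * h1 + h2 < real d * h1"
      using h12(2) h1c h1pos by linarith
  qed
  have "real d * h2 \<le> real d * h1 + 20 * real d ^ 3 * ln C"
    unfolding h1_def h2_def by (rule height_comparison[OF assms(1,2) AB(1) N2 bdd van eq h1[unfolded h1_def]])
  then have "real d * (h2 - h1) \<le> h1 / 50" using h1c by (simp add: algebra_simps)
  moreover have "h2 - h1 \<le> real d * (h2 - h1)" using h12(1) d_ge by (intro mult_le_cancel_right1[THEN iffD2]) auto
  ultimately have h32: "2 * h2 \<le> 3 * h1" using h1pos by linarith
  have degs: "degree A \<le> N" "degree B \<le> N" using bdd by (auto dest: bdd_polyD)
  note nzs = pair_nonzero[OF f1(1) f2(1) AB(1) le_less_trans[OF degs(1) Nd] le_less_trans[OF degs(2) Nd] van]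
  obtain A0 B0 g where fac: "map_poly rat_of_int A = A0 * g" "map_poly rat_of_int B = B0 * g" "coprime A0 B0"
    using gcd_coprime_exists[of "map_poly rat_of_int A" "map_poly rat_of_int B"] nzs(1) by auto
  have deg1: "degree A0 \<le> 1" "degree B0 \<le> 1"
    using reduced_degree[OF assms(1,2) AB(1) N2 bdd van eq fac] h1 h12(1) h32 by (simp_all add: h1_def h2_def)
  obtain L :: int where L: "L \<noteq> 0" "\<forall>r\<in>{coeff A0 0, coeff A0 1, coeff B0 0, coeff B0 1}. \<exists>k::int. of_int L * r = of_int k"
    using common_denominator[of "{coeff A0 0, coeff A0 1, coeff B0 0, coeff B0 1}"] by blast
  then obtain u s v t :: int where k: "of_int L * coeff A0 0 = of_int u" "of_int L * coeff A0 1 = of_int s"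
    "of_int L * coeff B0 0 = of_int v" "of_int L * coeff B0 1 = of_int t" by (metis insert_iff)
  have ev: "of_int L * poly (map_poly of_rat p) z = of_rat (of_int L * coeff p 1) * z + of_rat (of_int L * coeff p 0)"
    if "degree p \<le> 1" for p :: "rat poly" and z :: complex
  proof -
    have "poly (map_poly of_rat p) z = (\<Sum>i\<le>1. of_rat (coeff p i) * z ^ i)"
      using that by (subst poly_altdef) (intro sum.mono_neutral_cong_left, auto simp: coeff_eq_0)
    then show ?thesis by (simp add: of_rat_mult algebra_simps)
  qed
  have evA: "of_int L * poly (map_poly of_rat A0) z = of_int s * z + of_int u" for z :: complex
    using ev[OF deg1(1), of z] k by simp
  have evB: "of_int L * poly (map_poly of_rat B0) z = of_int t * z + of_int v" for z :: complex
    using ev[OF deg1(2), of z] k by simp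
  have facc: "poly (of_int_poly A) z = poly (map_poly of_rat A0) z * poly (map_poly of_rat g) z"
    "poly (of_int_poly B) z = poly (map_poly of_rat B0) z * poly (map_poly of_rat g) z" for z :: complex
    using arg_cong[OF fac(1), of "\<lambda>p. poly (map_poly of_rat p) z"] arg_cong[OF fac(2), of "\<lambda>p. poly (map_poly of_rat p) z"]
    by (simp_all add: map_poly_of_rat_of_int map_poly_of_rat_mult)
  have "poly (of_int_poly A) \<alpha> = \<beta> * poly (of_int_poly B) \<alpha>" using van f1(1) f2(1) by (simp add: lin_self)
  moreover have "poly (map_poly of_rat g) \<alpha> \<noteq> 0" using nzs(3) facc(1)[of \<alpha>] by auto
  ultimately have "poly (map_poly of_rat A0) \<alpha> = \<beta> * poly (map_poly of_rat B0) \<alpha>" by (simp add: facc)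
  then have M: "of_int s * \<alpha> + of_int u = \<beta> * (of_int t * \<alpha> + of_int v)"
    by (simp flip: evA evB)
  have nzA: "of_int s * \<alpha> + of_int u \<noteq> 0"
    using nzs(3) L(1) by (simp add: facc flip: evA)
  \<comment> \<open>A singular matrix would take \<open>\<alpha>\<close> to a rational number, but
    \<open>\<beta>\<close> is irrational.\<close>
  have det: "s * v - t * u \<noteq> 0"
  proof
    assume "s * v - t * u = 0"
    then have sv: "of_int s * of_int v = (of_int t * of_int u :: complex)" by (metis eq_iff_diff_eq_0 of_int_mult)
    have "of_int t * (of_int s * \<alpha> + of_int u) = of_int s * (of_int t * \<alpha> + of_int v)"
      using sv by (simp add: algebra_simps)
    then have "(of_int t * \<beta> - of_int s) * (of_int t * \<alpha> + of_int v) = 0" unfolding M by (simp add: algebra_simps)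
    moreover have "of_int t * \<alpha> + of_int v \<noteq> 0" using nzA M by auto
    ultimately have ts: "of_int t * \<beta> = of_int s" by simp
    show False
    proof (cases "t = 0")
      case False
      then have "\<beta> = of_rat (of_int s / of_int t)" using ts by (simp add: of_rat_divide field_simps)
      then show False using irrational[OF f2(1)] by blast
    next
      case True
      then have "s = 0" using ts by simp
      then have "of_int u = \<beta> * of_int v" "v \<noteq> 0" using M nzA True by auto
      then have "\<beta> = of_rat (of_int u / of_int v)" by (simp add: of_rat_divide field_simps)
      then show False using irrational[OF f2(1)] by blast
    qed
  qed
  define \<xi> :: complex where "\<xi> = of_int x1 / of_int y1"
  \<comment> \<open>Otherwise \<open>y1\<close> would be bounded by the leading coefficient of
    \<open>A\<close>. So the common factor \<open>g\<close> does not vanish at \<open>\<xi>\<close>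
    and can be cancelled from \<open>eq\<close>.\<close>
  have "poly (of_int_poly A) \<xi> \<noteq> 0"
  proof
    assume "poly (of_int_poly A) \<xi> = 0"
    then have "\<bar>y1\<bar> \<le> \<bar>lead_coeff A\<bar>"
      unfolding \<xi>_def by (rule rational_root_denominator[OF nzs(1) _ f1(2,3)])
    then have "real_of_int \<bar>y1\<bar> \<le> C ^ (4 * d ^ 2)" using bdd_polyD(2)[OF bdd(1), of "degree A"] by linarith
    then have "real_of_int (height x1 y1) \<le> C * C ^ (4 * d ^ 2)"
      using f1(5) C4 by (meson mult_left_mono order.trans zero_le_numeral)
    then have "h1 \<le> ln (C * C ^ (4 * d ^ 2))"
      unfolding h1_def using f1(4) C4 by (subst ln_le_cancel_iff) auto
    also have "\<dots> = real (4 * d ^ 2 + 1) * ln C"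
      using C4 by (simp add: ln_mult ln_realpow algebra_simps)
    also have "\<dots> \<le> 20 * real d ^ 3 * ln C"
      using c0 d27 rc by (intro mult_right_mono) simp_all
    also have "\<dots> \<le> h1 / 50" by (rule h1c)
    finally show False using h1pos by simp
  qed
  then have "poly (map_poly of_rat g) \<xi> \<noteq> 0" by (auto simp: facc)
  then have "poly (map_poly of_rat A0) \<xi> = of_int x2 / of_int y2 * poly (map_poly of_rat B0) \<xi>"
  proof -
    have "(poly (map_poly of_rat A0) \<xi> - of_int x2 / of_int y2 * poly (map_poly of_rat B0) \<xi>) * poly (map_poly of_rat g) \<xi> = 0"
      using eq by (simp add: facc \<xi>_def algebra_simps)
    then show ?thesis using \<open>poly (map_poly of_rat g) \<xi> \<noteq> 0\<close> by simp
  qed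
  then have lin: "of_int s * \<xi> + of_int u = of_int x2 / of_int y2 * (of_int t * \<xi> + of_int v)"
    by (simp flip: evA evB)
  have scale: "of_int (a * x1 + b * y1) = of_int y1 * (of_int a * \<xi> + of_int b)" for a b :: int
    using f1(3) by (simp add: \<xi>_def algebra_simps)
  have "of_int (y2 * (s * x1 + u * y1)) = (of_int (x2 * (t * x1 + v * y1)) :: complex)"
    unfolding of_int_mult[of y2] of_int_mult[of x2] scale lin using f2(3) by simp
  then have "y2 * (s * x1 + u * y1) = x2 * (t * x1 + v * y1)" using of_int_eq_iff by blast
  with det M show thesis using that by blast
qed

end

section \<open>Thue's principle\<close>

lemma sum_multiplicities_le_degree:
  fixes p :: "complex poly"
  assumes "p \<noteq> 0" "finite S" "\<And>z. z \<in> S \<Longrightarrow> [:- z, 1:] ^ e z dvd p"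
  shows "(\<Sum>z\<in>S. e z) \<le> degree p"
proof -
  have "(\<Sum>z\<in>S. e z) \<le> (\<Sum>z\<in>S. count (proots p) z)"
    using assms by (intro sum_mono) (simp add: order_divides)
  also have "\<dots> = (\<Sum>z\<in>S \<inter> set_mset (proots p). count (proots p) z)"
    using assms(2) by (intro sum.mono_neutral_right) (auto simp: not_in_iff)
  also have "\<dots> \<le> (\<Sum>z\<in>set_mset (proots p). count (proots p) z)"
    by (intro sum_mono2) auto
  also have "\<dots> = size (proots p)" by (simp add: size_multiset_overloaded_eq)
  also have "\<dots> = degree p" by (rule size_proots_complex)
  finally show ?thesis .
qed

text \<open>The linear part of the estimates in \<open>thue_principle\<close>, with
  \<open>P = d * n\<close>, \<open>D = d ^ 2\<close> and products such as \<open>dl = d * l\<close>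
  as independent variables.\<close>

lemma thue_arith:
  fixes P \<kappa> d D n M N dl dM :: real
  shows "3 * D + 6 * d + 3 + 3 * \<kappa> < P \<Longrightarrow> 100 * D \<le> \<kappa> \<Longrightarrow> 3 \<le> d \<Longrightarrow> 0 \<le> D \<Longrightarrow> 8 * D \<le> P"
    and "dl \<le> dM + D \<Longrightarrow> 8 * dM \<le> P + 8 * d \<Longrightarrow> 2 * N \<le> P + M \<Longrightarrow> 8 * M \<le> n + 8 \<Longrightarrow> 3 * n \<le> P
      \<Longrightarrow> 3 * D + 6 * d + 3 + 3 * \<kappa> < P \<Longrightarrow> 3 \<le> d \<Longrightarrow> n / 16 + N + \<kappa> - (P - dl) < 0"
    and "3 * \<kappa> \<le> d\<kappa> \<Longrightarrow> 2 * N \<le> P + M \<Longrightarrow> 8 * M \<le> n + 8 \<Longrightarrow> 3 * n \<le> P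
      \<Longrightarrow> P \<le> 3 * D + 6 * d + 3 + 3 * \<kappa> + d \<Longrightarrow> 3 \<le> d \<Longrightarrow> 3 * d \<le> D \<Longrightarrow> 100 * D \<le> \<kappa>
      \<Longrightarrow> n / 16 + N + \<kappa> - d\<kappa> < 0"
  by - (linarith+)

context galois_approx
begin

lemma int_high_multiplicity:
  assumes "A \<noteq> 0" "\<alpha> \<in> Z" "\<And>l. l < n \<Longrightarrow> poly (of_int_poly (hasse l A)) \<alpha> = 0"
  shows "d * n \<le> degree A"
proof -
  have "[:- z, 1:] ^ n dvd (of_int_poly A :: complex poly)" if "z \<in> Z" for z
  proof (rule dvd_of_hasse_vanish)
    fix l assume "l < n"
    then have "poly (of_int_poly (hasse l A)) z = 0"
      using rat_vanish[OF assms(2) _ that, of "map_poly of_int (hasse l A)"] assms(3)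
      unfolding map_poly_of_rat_of_int by blast
    then show "poly (hasse l (of_int_poly A)) z = 0"
      by (simp add: map_poly_hasse_of_int)
  qed
  then have "(\<Sum>z\<in>Z. n) \<le> degree (of_int_poly A :: complex poly)"
    using assms(1) finite_Z by (intro sum_multiplicities_le_degree) auto
  then show ?thesis by (simp add: card_Z)
qed

text \<open>If \<open>A = r B\<close>, then \<open>(r - \<beta>) B\<close> vanishes to order
  \<open>n\<close> at \<open>\<alpha>\<close>, and so does \<open>B\<close>. Having integer
  coefficients, \<open>B\<close> vanishes to that order at all \<open>d\<close> roots, against its
  degree.\<close>

lemma wronskian_nonzero':
  assumes "\<alpha> \<in> Z" "\<beta> \<in> Z" "A \<noteq> 0 \<or> B \<noteq> 0" "degree A < d * n" "degree B < d * n"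
    and van: "\<And>l. l < n \<Longrightarrow> lin \<alpha> \<beta> (hasse l A) (hasse l B) \<alpha> = 0"
  shows "wronskian A B \<noteq> 0"
proof
  assume W: "wronskian A B = 0"
  have eq: "poly (of_int_poly (hasse l A)) \<alpha> = \<beta> * poly (of_int_poly (hasse l B)) \<alpha>" if "l < n" for l
    using van[OF that] assms(1,2) by (simp add: lin_self)
  show False
  proof (cases "B = 0")
    case True
    then have "d * n \<le> degree A"
      using eq assms(3) by (intro int_high_multiplicity[OF _ assms(1)]) auto
    then show False using assms(4) by simp
  next
    case False
    have "wronskian (map_poly rat_of_int A) (map_poly rat_of_int B) = 0"
      by (simp add: wronskian_of_int W)
    moreover have "map_poly rat_of_int B \<noteq> 0" using False by simp
    ultimately obtain r where "map_poly rat_of_int A = smult r (map_poly rat_of_int B)"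
      using wronskian_0_imp_proportional by blast
    then have "map_poly of_rat (map_poly rat_of_int A) = (map_poly of_rat (smult r (map_poly rat_of_int B)) :: complex poly)"
      by simp
    then have AB: "of_int_poly A = smult (of_rat r) (of_int_poly B :: complex poly)"
      by (simp add: map_poly_of_rat_of_int of_rat_hom.map_poly_hom_smult)
    have "poly (of_int_poly (hasse l B)) \<alpha> = 0" if "l < n" for l
    proof -
      have "poly (of_int_poly (hasse l A)) \<alpha> = of_rat r * poly (of_int_poly (hasse l B)) \<alpha>"
        by (simp add: map_poly_hasse_of_int AB hasse_smult)
      then have "(of_rat r - \<beta>) * poly (of_int_poly (hasse l B)) \<alpha> = 0"
        using eq[OF that] by (metis eq_iff_diff_eq_0 left_diff_distrib)
      then show ?thesis using irrational[OF assms(2), of r] by (metis eq_iff_diff_eq_0 mult_eq_0_iff)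
    qed
    then have "d * n \<le> degree B" by (intro int_high_multiplicity[OF False assms(1)])
    then show False using assms(5) by simp
  qed
qed

text \<open>If all derivatives up to order \<open>L = 2 * N - d * n + d\<close> satisfied the
  relation at \<open>\<xi>\<close>, the Wronskian would have a zero of order \<open>L\<close> there
  and zeros of order \<open>n - 1\<close> at the \<open>d\<close> roots. The total
  \<open>2 * N\<close> exceeds its degree.\<close>

lemma nonvanishing_derivative:
  assumes "\<alpha> \<in> Z" "\<beta> \<in> Z" "A \<noteq> 0 \<or> B \<noteq> 0" "degree A \<le> N" "degree B \<le> N" "N < d * n" "d * n \<le> 2 * N"
    and van: "\<And>l z. l < n \<Longrightarrow> z \<in> Z \<Longrightarrow> lin \<alpha> \<beta> (hasse l A) (hasse l B) z = 0"
    and \<xi>: "\<xi> \<notin> Z"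
  obtains l where "l \<le> 2 * N - d * n + d" "poly (of_int_poly (hasse l A)) \<xi> \<noteq> \<eta> * poly (of_int_poly (hasse l B)) \<xi>"
proof (rule ccontr)
  note found = that
  define L where "L = 2 * N - d * n + d"
  assume "\<not> thesis"
  then have all: "poly (of_int_poly (hasse l A)) \<xi> = \<eta> * poly (of_int_poly (hasse l B)) \<xi>" if "l < Suc L" for l
    using found[of l] that \<open>\<not> thesis\<close> by (auto simp: L_def less_Suc_eq_le)
  define W where "W = (of_int_poly (wronskian A B) :: complex poly)"
  have W: "W = wronskian (of_int_poly A) (of_int_poly B)" by (simp add: W_def wronskian_of_int)
  have "wronskian A B \<noteq> 0"
    by (rule wronskian_nonzero'[OF assms(1-3), of n]) (use assms in auto)
  then have "W \<noteq> 0" by (simp add: W_def)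
  define e where "e z = (if z = \<xi> then L else n - 1)" for z
  have mult: "[:- z, 1:] ^ (n' - 1) dvd W"
    if "\<And>l. l < n' \<Longrightarrow> poly (of_int_poly (hasse l A)) z = c * poly (of_int_poly (hasse l B)) z" for z c n'
    unfolding W
    by (rule linear_power_dvd_wronskian[of _ _ _ c], rule dvd_of_hasse_vanish)
       (simp add: hasse_diff hasse_smult that flip: map_poly_hasse_of_int)
  have "(\<Sum>z\<in>insert \<xi> Z. e z) \<le> degree W"
  proof (rule sum_multiplicities_le_degree[OF \<open>W \<noteq> 0\<close>])
    show "finite (insert \<xi> Z)" using finite_Z by simp
    fix z assume "z \<in> insert \<xi> Z"
    then show "[:- z, 1:] ^ e z dvd W"
      using mult[of "Suc L" \<xi> \<eta>] mult[of n z "conj \<alpha> \<beta> z"] all van[of _ z]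
      by (auto simp: e_def lin_def)
  qed
  also have "(\<Sum>z\<in>insert \<xi> Z. e z) = L + d * (n - 1)"
  proof -
    have "(\<Sum>z\<in>Z. e z) = (\<Sum>z\<in>Z. n - 1)" using \<xi> by (intro sum.cong) (auto simp: e_def)
    then show ?thesis using \<xi> finite_Z by (simp add: e_def card_Z)
  qed
  also have "L + d * (n - 1) = 2 * N"
    using assms(6,7) unfolding L_def by (cases n) (auto simp: algebra_simps)
  also have "degree W \<le> 2 * N - 1"
    using degree_wronskian[OF assms(4,5)] by (simp add: W_def)
  finally show False using assms(6,7) by simp
qed

lemma thue_principle:
  assumes "approx \<alpha> x1 y1" "approx \<beta> x2 y2"
  defines "h1 \<equiv> ln (real_of_int (height x1 y1))" and "h2 \<equiv> ln (real_of_int (height x2 y2))"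
  assumes h1: "1000 * real d ^ 3 * ln C \<le> h1"
  shows "h2 < 100 * real d ^ 2 * h1"
proof (rule ccontr)
  assume neg: "\<not> h2 < 100 * real d ^ 2 * h1"
  note f1 = approx_facts[OF assms(1)] and f2 = approx_facts[OF assms(2)]
  define H1 where "H1 = real_of_int (height x1 y1)"
  define H2 where "H2 = real_of_int (height x2 y2)"
  have c0: "1 \<le> ln C" by (rule ln_C)
  have d27: "27 \<le> real d ^ 3" using cube_facts(3)[OF d_ge] by (metis of_nat_le_iff of_nat_numeral of_nat_power)
  have d3: "3 \<le> real d" using d_ge by simp
  have h1pos: "0 < h1" using h1 c0 d27 mult_mono[of 27 "real d ^ 3" 1 "ln C"] by simp
  have lC: "ln C \<le> h1" using h1 mult_right_mono[of 1 "1000 * real d ^ 3" "ln C"] c0 d27 by linarith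
  define \<kappa> where "\<kappa> = h2 / h1"
  have h2: "h2 = \<kappa> * h1" using h1pos by (simp add: \<kappa>_def)
  have \<kappa>: "100 * real d ^ 2 \<le> \<kappa>" using neg h1pos by (simp add: \<kappa>_def field_simps)
  have \<kappa>0: "0 \<le> \<kappa>" using \<kappa> zero_le_power2[of "real d"] by linarith
  \<comment> \<open>\<open>n\<close> is the least order of vanishing with \<open>d n / 3 > (d + 1)\<^sup>2 + \<kappa>\<close>; then both terms of
    \<open>approx_inequality\<close> are small, the first because of \<open>n\<close>, the second because \<open>\<kappa>\<close> is large.\<close>
  define q where "q = 3 * ((real d + 1) ^ 2 + \<kappa>) / real d"
  have q: "q * real d = 3 * ((real d + 1) ^ 2 + \<kappa>)" using d3 by (simp add: q_def)
  have q0: "0 \<le> q" unfolding q_def using \<kappa>0 by simp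
  define n where "n = nat \<lfloor>q\<rfloor> + 1"
  have n: "q < real n" "real n \<le> q + 1" unfolding n_def using q0 by linarith+
  define P where "P = real d * real n"
  have P1: "3 * ((real d + 1) ^ 2 + \<kappa>) < P" using n(1) d3 unfolding P_def q[symmetric] by (simp add: mult.commute)
  have sq: "(real d + 1) ^ 2 = real d ^ 2 + 2 * real d + 1" by (simp add: power2_eq_square algebra_simps)
  have P1': "3 * real d ^ 2 + 6 * real d + 3 + 3 * \<kappa> < P" using P1 unfolding sq by (simp add: algebra_simps)
  have P2: "P \<le> 3 * ((real d + 1) ^ 2 + \<kappa>) + real d"
    using mult_left_mono[OF n(2), of "real d"] d3 q unfolding P_def by (simp add: algebra_simps)
  have nP: "3 * real n \<le> P" using d3 unfolding P_def by (intro mult_right_mono) auto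
  have P2': "P \<le> 3 * real d ^ 2 + 6 * real d + 3 + 3 * \<kappa> + real d" using P2 unfolding sq by (simp add: algebra_simps)
  have d2: "3 * real d \<le> real d ^ 2" using d3 by (simp add: power2_eq_square)
  have n8: "8 * real d \<le> real n"
  proof -
    have "8 * real d ^ 2 \<le> P" by (rule thue_arith(1)[OF P1' \<kappa> d3 zero_le_power2])
    then have "real d * (8 * real d) \<le> real d * real n" by (simp add: P_def power2_eq_square)
    then show ?thesis using d3 by simp
  qed
  \<comment> \<open>The excess of unknowns over conditions, about \<open>n / 8\<close>: enough to
    keep the exponent \<open>k\<close> of the coefficient bound linear in \<open>n\<close>, and so
    little that the additional degree \<open>M / 2\<close> stays far below
    \<open>d * n\<close>.\<close>
  define M where "M = n div 8 + 1"
  have M: "n \<le> 8 * M" "8 * M \<le> n + 8" by (auto simp: M_def)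
  define N where "N = (d * n + M) div 2"
  have N: "d * n + M \<le> 2 * N + 1" "2 * N \<le> d * n + M" by (auto simp: N_def)
  have dn: "3 * n \<le> d * n" using d_ge by simp
  have n24: "24 \<le> n" using n8 d3 by linarith
  have N1: "N + 1 \<le> d * n" using N(2) M(2) dn n24 by linarith
  have N0: "d * n \<le> 2 * N" using N(1) n24 M(1) by linarith
  define k where "k = 32 * d ^ 2 * n"
  have cI: "n * d + M \<le> card (UNIV \<times> {..N} :: (bool \<times> nat) set)"
    using N(1) by (simp add: card_cartesian_product mult.commute)
  have cond: "(4 * N + 4) * (n * d) \<le> k * M"
  proof -
    have "(4 * N + 4) * (n * d) \<le> (4 * (d * n)) * (n * d)" using N1 by (intro mult_right_mono) auto
    also have "\<dots> = 4 * d ^ 2 * n * n" by (simp add: power2_eq_square)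
    also have "\<dots> \<le> 4 * d ^ 2 * n * (8 * M)" using M(1) by (intro mult_left_mono) auto
    finally show ?thesis by (simp add: k_def)
  qed
  obtain A B where AB: "A \<noteq> 0 \<or> B \<noteq> 0" "bdd_poly N (C ^ k) A" "bdd_poly N (C ^ k) B"
    "\<And>l z. l < n \<Longrightarrow> z \<in> Z \<Longrightarrow> lin \<alpha> \<beta> (hasse l A) (hasse l B) z = 0"
  proof (rule siegel'[OF f1(1) f2(1) order.refl cI cond], goal_cases)
    case (2 A B)
    then show ?thesis using that[of A B] by blast
  qed (simp add: M_def)
  define \<xi> :: complex where "\<xi> = of_int x1 / of_int y1"
  have "\<xi> = of_rat (of_int x1 / of_int y1)" by (simp add: \<xi>_def of_rat_divide)
  then have "\<xi> \<notin> Z" using irrational by blast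
  then obtain l where l: "l \<le> 2 * N - d * n + d"
    "poly (of_int_poly (hasse l A)) \<xi> \<noteq> of_int x2 / of_int y2 * poly (of_int_poly (hasse l B)) \<xi>"
    using nonvanishing_derivative[OF f1(1) f2(1) AB(1), of N n \<xi> "of_int x2 / of_int y2"]
      AB(4) bdd_polyD(1)[OF AB(2)] bdd_polyD(1)[OF AB(3)] N1 N0 by (metis Suc_eq_plus1 Suc_le_eq)
  have lM: "l \<le> M + d" using l(1) N(2) by linarith
  have "real (M + d) \<le> real n" using M(2) n8 n24 d3 by linarith
  then have ln': "l \<le> n" using lM by linarith
  have "1 \<le> H1 ^ N * H2 * (C ^ k * C ^ (4 * N + 2)) * ((C / H1 ^ d) ^ (n - l) + C / H2 ^ d)"
    unfolding H1_def H2_def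
    by (rule approx_inequality[OF assms(1,2) _ AB(2,3) ln' AB(4)]) (use lC f1(1) l(2) in \<open>auto simp: h1_def \<xi>_def\<close>)
  then have "1 / 2 \<le> H1 ^ N * H2 * (C ^ k * C ^ (4 * N + 2)) * (C / H1 ^ d) ^ (n - l)
     \<or> 1 / 2 \<le> H1 ^ N * H2 * (C ^ k * C ^ (4 * N + 2)) * (C / H2 ^ d)"
    unfolding distrib_left by linarith
  moreover have H: "0 < H1" "0 < H2" using f1(4) f2(4) by (auto simp: H1_def H2_def)
  have lnH: "ln H1 = h1" "ln H2 = h2" by (simp_all add: H1_def H2_def h1_def h2_def)
  have ln2: "- ln C \<le> ln (1 / 2)" using C4 by (simp add: ln_div)
  \<comment> \<open>All constants together cost at most \<open>n / 16\<close> in the exponent of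
    \<open>H1\<close>, thanks to the lower bound on \<open>h1\<close>.\<close>
  have const: "real (k + 4 * N + 3 + n + 1) * ln C \<le> real n / 16 * h1"
  proof -
    have "4 * N + 4 \<le> 4 * (d * n)" using N1 by linarith
    moreover have "3 * d \<le> d ^ 2" by (rule cube_facts[OF d_ge])
    then have "3 * (d * n) \<le> d ^ 2 * n" using mult_right_mono[of "3 * d" "d ^ 2" n] by (simp add: mult.assoc)
    ultimately have "k + 4 * N + 3 + n + 1 \<le> 40 * d ^ 2 * n" using dn unfolding k_def by linarith
    then have "real (k + 4 * N + 3 + n + 1) \<le> real (40 * d ^ 2 * n)" by (rule of_nat_mono)
    then have "real (k + 4 * N + 3 + n + 1) * ln C \<le> real (40 * d ^ 2 * n) * ln C"
      using c0 by (intro mult_right_mono) auto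
    also have "\<dots> = real n * (40 * (real d ^ 2 * ln C))" by simp
    also have "\<dots> \<le> real n * (h1 / 16)"
    proof (intro mult_left_mono)
      have "3 * (real d ^ 2 * ln C) \<le> real d ^ 3 * ln C"
        using d3 c0 by (simp add: power2_eq_square power3_eq_cube)
      then show "40 * (real d ^ 2 * ln C) \<le> h1 / 16" using h1 h1pos by linarith
    qed simp
    finally show ?thesis by simp
  qed
  have rN: "2 * real N \<le> P + real M" using N(2) unfolding P_def by (metis of_nat_add of_nat_le_iff of_nat_mult of_nat_numeral)
  have rM: "8 * real M \<le> real n + 8" using M(2) by linarith
  \<comment> \<open>With \<open>H2\<close> as the \<open>\<kappa>\<close>-th power of
    \<open>H1\<close>, \<open>fin1\<close> and \<open>fin2\<close> say that the exponents of
    \<open>H1\<close> in the two terms are negative, constants included.\<close>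
  have fin1: "real n / 16 + real N + \<kappa> - real d * (real n - real l) < 0"
  proof -
    have "real d * real l \<le> real d * (real M + real d)" using lM d3 by (intro mult_left_mono) auto
    also have "\<dots> = real d * real M + real d ^ 2" by (simp add: power2_eq_square algebra_simps)
    finally have dl: "real d * real l \<le> real d * real M + real d ^ 2" .
    have dM: "8 * (real d * real M) \<le> P + 8 * real d"
      using mult_left_mono[OF rM, of "real d"] d3 unfolding P_def by (simp add: algebra_simps)
    have "real d * (real n - real l) = P - real d * real l" by (simp add: P_def algebra_simps)
    then show ?thesis using thue_arith(2)[OF dl dM rN rM nP P1' d3] by simp
  qed
  have fin2: "real n / 16 + real N + \<kappa> - real d * \<kappa> < 0"
  proof -
    have "3 * \<kappa> \<le> real d * \<kappa>" using d3 \<kappa>0 by (intro mult_right_mono) auto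
    from thue_arith(3)[OF this rN rM nP P2' d3 d2 \<kappa>] show ?thesis .
  qed
  ultimately show False
  proof (elim disjE)
    assume "1 / 2 \<le> H1 ^ N * H2 * (C ^ k * C ^ (4 * N + 2)) * (C / H1 ^ d) ^ (n - l)"
    then have "ln (1 / 2) \<le> ln (H1 ^ N * H2 * (C ^ k * C ^ (4 * N + 2)) * (C / H1 ^ d) ^ (n - l))"
      using H C4 by (subst ln_le_cancel_iff) auto
    also have "\<dots> = real N * h1 + h2 + real (k + 4 * N + 2) * ln C + (real n - real l) * (ln C - real d * h1)"
      using H C4 ln' by (simp add: ln_mult ln_realpow ln_div lnH of_nat_diff algebra_simps)
    finally have "0 \<le> real N * h1 + h2 + real (k + 4 * N + 3 + n + 1) * ln C - real l * ln C - real d * (real n - real l) * h1 - ln C"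
      using ln2 by (simp add: algebra_simps)
    moreover have "0 \<le> real l * ln C" using c0 by simp
    ultimately have "0 \<le> real N * h1 + \<kappa> * h1 + real n / 16 * h1 - real d * (real n - real l) * h1"
      using const c0 h2 by linarith
    then have "0 \<le> (real n / 16 + real N + \<kappa> - real d * (real n - real l)) * h1" by (simp add: algebra_simps)
    then show False using fin1 h1pos by (simp add: zero_le_mult_iff)
  next
    assume "1 / 2 \<le> H1 ^ N * H2 * (C ^ k * C ^ (4 * N + 2)) * (C / H2 ^ d)"
    then have "ln (1 / 2) \<le> ln (H1 ^ N * H2 * (C ^ k * C ^ (4 * N + 2)) * (C / H2 ^ d))"
      using H C4 by (subst ln_le_cancel_iff) auto
    also have "\<dots> = real N * h1 + h2 + real (k + 4 * N + 3) * ln C - real d * h2"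
      using H C4 by (simp add: ln_mult ln_realpow ln_div lnH algebra_simps)
    finally have "0 \<le> real N * h1 + h2 + real (k + 4 * N + 3 + n + 1) * ln C - real n * ln C - real d * h2"
      using ln2 by (simp add: algebra_simps)
    moreover have "0 \<le> real n * ln C" using c0 by simp
    ultimately have "0 \<le> real N * h1 + \<kappa> * h1 + real n / 16 * h1 - real d * h2"
      using const h2 by linarith
    then have "0 \<le> (real n / 16 + real N + \<kappa> - real d * \<kappa>) * h1" unfolding h2 by (simp add: algebra_simps)
    then show False using fin2 h1pos by (simp add: zero_le_mult_iff)
  qed
qed

end

section \<open>Solutions are good approximations\<close>

context galois_poly
begin

text \<open>Cauchy's bound: beyond \<open>1 + B\<close> the leading term outweighs the geometric
  series that bounds the others.\<close>

lemma root_bound: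
  assumes "\<And>i. real_of_int \<bar>coeff f i\<bar> \<le> B" "z \<in> Z"
  shows "cmod z \<le> 1 + B"
proof (rule ccontr)
  define r where "r = cmod z"
  assume "\<not> ?thesis"
  then have r: "1 + B < r" by (simp add: r_def)
  have lc1: "1 \<le> real_of_int \<bar>lc\<bar>" using lc_nz by linarith
  then have B: "1 \<le> B" using assms(1)[of "degree f"] by linarith
  have "0 = (\<Sum>i\<le>d. of_int (coeff f i) * z ^ i)"
    using assms(2) by (simp add: Z poly_altdef d)
  also have "\<dots> = of_int lc * z ^ d + (\<Sum>i<d. of_int (coeff f i) * z ^ i)"
    by (simp add: d flip: lessThan_Suc_atMost)
  finally have "of_int lc * z ^ d = - (\<Sum>i<d. of_int (coeff f i) * z ^ i)"
    by (simp add: eq_neg_iff_add_eq_0)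
  then have "cmod (of_int lc * z ^ d) = cmod (\<Sum>i<d. of_int (coeff f i) * z ^ i)"
    by (simp only: norm_minus_cancel)
  also have "\<dots> \<le> (\<Sum>i<d. B * r ^ i)"
    using assms(1) by (intro sum_norm_le) (simp add: norm_mult norm_power r_def mult_right_mono)
  also have "\<dots> = B * (\<Sum>i<d. r ^ i)" by (simp add: sum_distrib_left)
  also have "\<dots> \<le> (r - 1) * (\<Sum>i<d. r ^ i)"
    using r B by (intro mult_right_mono sum_nonneg) auto
  also have "\<dots> = r ^ d - 1" by (simp add: power_diff_1_eq)
  also have "\<dots> < r ^ d" by simp
  also have "\<dots> = 1 * cmod (z ^ d)" by (simp add: norm_power r_def)
  also have "\<dots> \<le> cmod (of_int lc) * cmod (z ^ d)"
    using lc1 by (intro mult_right_mono) auto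
  finally show False by (simp add: norm_mult)
qed

text \<open>The field is Galois, so one real conjugate makes it totally real.\<close>

lemma Z_real:
  assumes "\<alpha> \<in> Z" "\<alpha> \<in> \<real>"
  shows "Z \<subseteq> \<real>"
proof
  fix z assume "z \<in> Z"
  then obtain R :: "rat poly" where "poly (map_poly of_rat R) \<alpha> = z" using gal assms(1) by blast
  moreover have "(of_rat q :: complex) \<in> \<real>" for q
  proof -
    obtain a b where "quotient_of q = (a, b)" by fastforce
    then have "q = of_int a / of_int b" by (rule quotient_of_div)
    then show ?thesis by (simp add: of_rat_divide)
  qed
  then have "poly (map_poly of_rat R) \<alpha> \<in> \<real>"
    using assms(2) by (auto simp: poly_altdef intro!: sum_in_Reals Reals_mult Reals_power)
  ultimately show "z \<in> \<real>" by simp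
qed

lemma cnj_Z: "z \<in> Z \<Longrightarrow> cnj z \<in> Z"
proof -
  assume "z \<in> Z"
  have "map_poly cnj (of_int_poly f) = of_int_poly f"
    by (rule poly_eqI) (simp add: coeff_map_poly)
  then have "poly (of_int_poly f) (cnj z) = cnj (poly (of_int_poly f) z)"
    by (metis poly_cnj)
  then show ?thesis using \<open>z \<in> Z\<close> by (simp add: Z)
qed

end

context galois_bounds
begin

text \<open>Liouville's inequality for the pair \<open>[:0, 1:]\<close>, \<open>[:1:]\<close>, whose
  linear form at \<open>\<alpha>\<close> is \<open>\<alpha> - \<beta>\<close>.\<close>

lemma separation:
  assumes "\<alpha> \<in> Z" "\<beta> \<in> Z" "\<alpha> \<noteq> \<beta>"
  shows "1 \<le> cmod (\<alpha> - \<beta>) * C ^ (7 * d)"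
proof -
  have b: "bdd_poly 1 1 [:0, 1:]" "bdd_poly 1 1 [:1:]"
    by (auto simp: bdd_poly_def coeff_pCons split: nat.splits)
  have e: "lin \<alpha> \<beta> (hasse 0 [:0, 1:]) (hasse 0 [:1:]) \<alpha> = \<alpha> - \<beta>"
    using assms by (simp add: lin_self)
  have "1 \<le> cmod (lin \<alpha> \<beta> (hasse 0 [:0, 1:]) (hasse 0 [:1:]) \<alpha>) * (1 * C ^ (4 * 1 + 3)) ^ d"
    by (rule lin_hasse_lower_bound[OF b assms(1,2)]) (use assms(3) e in simp_all)
  then show ?thesis by (simp only: e mult_1 power_mult[symmetric]) simp
qed

text \<open>The value of the form is \<open>lc * y ^ d\<close> times the product of the differences
  between \<open>x / y\<close> and the roots. All roots but the nearest one are at least half the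
  root separation away, so the nearest one has to account for the smallness.\<close>

lemma nearest_root:
  assumes "real_of_int \<bar>homog d f x y\<bar> \<le> C" "y \<noteq> 0"
  obtains \<alpha> where "\<alpha> \<in> Z" "cmod (of_int x / of_int y - \<alpha>) * real_of_int \<bar>y\<bar> ^ d \<le> C ^ (7 * d ^ 2)"
proof -
  define \<xi> :: complex where "\<xi> = of_int x / of_int y"
  have "Z \<noteq> {}" using card_Z d_ge by auto
  then obtain \<alpha> where \<alpha>: "\<alpha> \<in> Z" "\<And>z. z \<in> Z \<Longrightarrow> cmod (\<xi> - \<alpha>) \<le> cmod (\<xi> - z)"
    using ex_min_if_finite[of "(\<lambda>z. cmod (\<xi> - z)) ` Z"] finite_Z
    by (metis (no_types, lifting) arg_min_least arg_min_if_finite(1))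
  have far: "1 \<le> cmod (\<xi> - z) * C ^ (7 * d + 1)" if "z \<in> Z - {\<alpha>}" for z
  proof -
    have "cmod (\<alpha> - z) \<le> cmod (\<xi> - \<alpha>) + cmod (\<xi> - z)"
      by (metis dist_norm dist_triangle2 norm_minus_commute)
    also have "\<dots> \<le> C * cmod (\<xi> - z)" using \<alpha>(2)[of z] that C4 mult_right_mono[of 2 C "cmod (\<xi> - z)"] by auto
    finally have "cmod (\<alpha> - z) * C ^ (7 * d) \<le> C * cmod (\<xi> - z) * C ^ (7 * d)"
      using C4 by (intro mult_right_mono) auto
    moreover have "1 \<le> cmod (\<alpha> - z) * C ^ (7 * d)" using \<alpha>(1) that by (intro separation) auto
    ultimately have "1 \<le> C * cmod (\<xi> - z) * C ^ (7 * d)" by linarith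
    then show ?thesis by (simp add: mult_ac)
  qed
  have "1 \<le> (\<Prod>z\<in>Z - {\<alpha>}. cmod (\<xi> - z) * C ^ (7 * d + 1))"
    using far by (intro prod_ge_1) auto
  also have "\<dots> = (\<Prod>z\<in>Z - {\<alpha>}. cmod (\<xi> - z)) * C ^ ((7 * d + 1) * (d - 1))"
  proof -
    have "card (Z - {\<alpha>}) = d - 1" using \<alpha>(1) card_Z finite_Z by (simp add: card_Diff_singleton)
    then show ?thesis by (simp only: prod.distrib prod_constant power_mult[symmetric])
  qed
  finally have prod: "1 \<le> (\<Prod>z\<in>Z - {\<alpha>}. cmod (\<xi> - z)) * C ^ ((7 * d + 1) * (d - 1))" .
  have "of_int (homog d f x y) = of_int y ^ d * (of_int lc * (\<Prod>z\<in>Z. \<xi> - z))"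
    using of_int_homog[of f d y x, where 'a = complex] assms(2)
    by (simp add: d \<xi>_def f_factorization poly_prod)
  then have "real_of_int \<bar>homog d f x y\<bar> = cmod (of_int y ^ d * (of_int lc * (\<Prod>z\<in>Z. \<xi> - z)))"
    by (metis norm_of_int of_int_abs)
  also have "\<dots> = real_of_int \<bar>y\<bar> ^ d * (real_of_int \<bar>lc\<bar> * (cmod (\<xi> - \<alpha>) * (\<Prod>z\<in>Z - {\<alpha>}. cmod (\<xi> - z))))"
    by (simp add: norm_mult norm_power prod.remove[OF finite_Z \<alpha>(1)] flip: prod_norm)
  finally have eq: "real_of_int \<bar>y\<bar> ^ d * (real_of_int \<bar>lc\<bar> * (cmod (\<xi> - \<alpha>) * (\<Prod>z\<in>Z - {\<alpha>}. cmod (\<xi> - z)))) \<le> C"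
    using assms(1) by simp
  have lc1: "1 \<le> real_of_int \<bar>lc\<bar>" using lc_nz by linarith
  let ?w = "real_of_int \<bar>y\<bar> ^ d * cmod (\<xi> - \<alpha>)" and ?p = "\<Prod>z\<in>Z - {\<alpha>}. cmod (\<xi> - z)"
  have p0: "0 \<le> ?p" by (intro prod_nonneg) auto
  have "?w * 1 \<le> ?w * (?p * C ^ ((7 * d + 1) * (d - 1)))"
    by (intro mult_left_mono prod) auto
  also have "\<dots> \<le> ?w * (real_of_int \<bar>lc\<bar> * (?p * C ^ ((7 * d + 1) * (d - 1))))"
    using mult_right_mono[OF lc1, of "?p * C ^ ((7 * d + 1) * (d - 1))"] p0 C4 by (intro mult_left_mono) auto
  also have "\<dots> = (real_of_int \<bar>y\<bar> ^ d * (real_of_int \<bar>lc\<bar> * (cmod (\<xi> - \<alpha>) * ?p))) * C ^ ((7 * d + 1) * (d - 1))"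
    by (simp add: mult_ac)
  also have "\<dots> \<le> C * C ^ ((7 * d + 1) * (d - 1))" using eq C4 by (intro mult_right_mono) auto
  also have "\<dots> = C ^ (1 + (7 * d + 1) * (d - 1))" by simp
  also have "\<dots> \<le> C ^ (7 * d ^ 2)"
  proof (intro power_increasing)
    obtain e where "d = Suc e" using d_ge by (cases d) auto
    then show "1 + (7 * d + 1) * (d - 1) \<le> 7 * d ^ 2" by (simp add: power2_eq_square algebra_simps)
  qed (use C4 in auto)
  finally have "?w \<le> C ^ (7 * d ^ 2)" by simp
  then show thesis using that[OF \<alpha>(1)] by (simp add: \<xi>_def mult.commute)
qed

lemma solution_approx:
  assumes "real_of_int \<bar>homog d f x y\<bar> \<le> C" "coprime x y"
    and big: "C ^ (10 * d ^ 3) * C ^ (10 * d ^ 3) < real_of_int (height x y)"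
  obtains \<alpha> where "\<alpha> \<in> Z" "\<alpha> \<in> \<real>" "y \<noteq> 0" "real_of_int (height x y) \<le> C ^ (10 * d ^ 3) * real_of_int \<bar>y\<bar>"
    "cmod (of_int x / of_int y - \<alpha>) \<le> C ^ (10 * d ^ 3) / real_of_int (height x y) ^ d"
proof -
  define H where "H = real_of_int (height x y)"
  define E where "E = C ^ (10 * d ^ 3)"
  have E1: "1 \<le> E" unfolding E_def using C4 by (intro one_le_power) auto
  have EH: "E * E < H" using big by (simp add: E_def H_def)
  have HE: "E < H" using EH mult_right_mono[OF E1, of E] E1 by linarith
  have y: "y \<noteq> 0"
  proof
    assume "y = 0"
    then have "\<bar>x\<bar> = 1" using assms(2) by simp
    then show False using HE E1 \<open>y = 0\<close> by (simp add: H_def height_def)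
  qed
  obtain \<alpha> where \<alpha>: "\<alpha> \<in> Z" "cmod (of_int x / of_int y - \<alpha>) * real_of_int \<bar>y\<bar> ^ d \<le> C ^ (7 * d ^ 2)"
    using nearest_root[OF assms(1) y] by blast
  define e where "e = cmod (of_int x / of_int y - \<alpha>)"
  define D where "D = C ^ (7 * d ^ 2)"
  note cf = cube_facts[OF d_ge]
  have CD: "C \<le> D" unfolding D_def using C4 d_ge by (intro self_le_power) auto
  have y1: "1 \<le> real_of_int \<bar>y\<bar>" using y by linarith
  have eD: "e \<le> D"
  proof -
    have "e * 1 \<le> e * real_of_int \<bar>y\<bar> ^ d" using y1 by (intro mult_left_mono one_le_power) (auto simp: e_def)
    then show ?thesis using \<alpha>(2) by (simp add: e_def D_def)
  qed
  have "cmod (of_int x / of_int y) \<le> e + cmod \<alpha>"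
    unfolding e_def by (metis diff_add_cancel norm_triangle_ineq)
  then have xy: "real_of_int \<bar>x\<bar> / real_of_int \<bar>y\<bar> \<le> 2 * D"
    using eD CD root_le[OF \<alpha>(1)] by (simp add: norm_divide)
  have Hy: "H \<le> C ^ (7 * d ^ 2 + 1) * real_of_int \<bar>y\<bar>"
  proof -
    have "real_of_int \<bar>x\<bar> \<le> 2 * D * real_of_int \<bar>y\<bar>" using xy y1 by (simp add: pos_divide_le_eq)
    moreover have "1 * real_of_int \<bar>y\<bar> \<le> 2 * D * real_of_int \<bar>y\<bar>" using CD C4 y1 by (intro mult_right_mono) auto
    ultimately have "H \<le> 2 * D * real_of_int \<bar>y\<bar>" by (auto simp: H_def height_def)
    also have "\<dots> \<le> C * D * real_of_int \<bar>y\<bar>" using C4 CD y1 by (intro mult_right_mono) auto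
    finally show ?thesis by (simp add: D_def)
  qed
  have "C ^ (7 * d ^ 2 + 1) \<le> E" unfolding E_def using C4 cf by (intro power_increasing) auto
  then have 1: "H \<le> E * real_of_int \<bar>y\<bar>"
    using Hy y1 mult_right_mono[of "C ^ (7 * d ^ 2 + 1)" E "real_of_int \<bar>y\<bar>"] by simp
  have "e * H ^ d \<le> e * (C ^ (7 * d ^ 2 + 1) * real_of_int \<bar>y\<bar>) ^ d"
    using Hy HE E1 by (intro mult_left_mono power_mono) (auto simp: e_def)
  also have "\<dots> = (e * real_of_int \<bar>y\<bar> ^ d) * C ^ ((7 * d ^ 2 + 1) * d)"
    by (simp only: power_mult_distrib power_mult[symmetric] mult_ac)
  also have "\<dots> \<le> D * C ^ ((7 * d ^ 2 + 1) * d)"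
    using \<alpha>(2) C4 by (intro mult_right_mono) (auto simp: e_def D_def)
  also have "\<dots> = C ^ (7 * d ^ 2 + (7 * d ^ 2 + 1) * d)" by (simp only: D_def power_add)
  also have "\<dots> \<le> E" unfolding E_def
  proof (intro power_increasing)
    have "d * (7 * d ^ 2) = 7 * d ^ 3" by (simp add: power2_eq_square power3_eq_cube)
    then show "7 * d ^ 2 + (7 * d ^ 2 + 1) * d \<le> 10 * d ^ 3" using cf by (simp add: algebra_simps)
  qed (use C4 in auto)
  finally have eH: "e * H ^ d \<le> E" .
  then have 2: "e \<le> E / H ^ d" using HE E1 by (simp add: field_simps)
  \<comment> \<open>The complex conjugate of a nonreal \<open>\<alpha>\<close> would be a second
    root at distance at most \<open>2 * e\<close>, against \<open>separation\<close>.\<close>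
  have "\<alpha> \<in> \<real>"
  proof (rule ccontr)
    assume nr: "\<alpha> \<notin> \<real>"
    have "cmod (\<alpha> - cnj \<alpha>) = 2 * \<bar>Im \<alpha>\<bar>" by (simp add: complex_diff_cnj norm_mult)
    moreover have "\<bar>Im \<alpha>\<bar> \<le> e"
    proof -
      have "Im (of_int x / of_int y) = (0::real)" by (metis Im_complex_of_real of_real_divide of_real_of_int_eq)
      then show ?thesis unfolding e_def using abs_Im_le_cmod[of "of_int x / of_int y - \<alpha>"] by simp
    qed
    moreover have "1 \<le> cmod (\<alpha> - cnj \<alpha>) * C ^ (7 * d)"
      using nr by (intro separation \<alpha> cnj_Z) (auto simp: Reals_cnj_iff)
    ultimately have "1 \<le> 2 * \<bar>Im \<alpha>\<bar> * C ^ (7 * d)" "\<bar>Im \<alpha>\<bar> \<le> e" by simp_all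
    moreover have "2 * \<bar>Im \<alpha>\<bar> * C ^ (7 * d) \<le> 2 * e * C ^ (7 * d)"
      using \<open>\<bar>Im \<alpha>\<bar> \<le> e\<close> C4 by (intro mult_right_mono) auto
    ultimately have "1 \<le> 2 * e * C ^ (7 * d)" by linarith
    also have "\<dots> \<le> C * e * C ^ (7 * d)" using C4 by (intro mult_right_mono) (auto simp: e_def)
    also have "\<dots> = e * C ^ (7 * d + 1)" by simp
    also have "\<dots> \<le> e * E" unfolding E_def using C4 cf by (intro mult_left_mono power_increasing) (auto simp: e_def)
    finally have "H ^ d \<le> e * E * H ^ d" using HE E1 by (intro mult_le_cancel_right1[THEN iffD2]) auto
    also have "\<dots> \<le> E * E" using eH E1 mult_right_mono[OF eH, of E] by (simp add: mult_ac)
    also have "\<dots> < H" by (rule EH)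
    also have "\<dots> \<le> H ^ d" using HE E1 d_ge by (intro self_le_power) auto
    finally show False by simp
  qed
  with 1 2 \<alpha>(1) y show thesis using that unfolding E_def H_def e_def by blast
qed

end

section \<open>Counting\<close>

text \<open>Remove a point of least height together with everything linked to it, and repeat: by the gap
  assumption the least logarithmic height grows by the factor \<open>\<gamma>\<close> in every round.\<close>

lemma greedy_count:
  fixes hn :: "'a \<Rightarrow> nat" and \<gamma> K :: real
  defines "h \<equiv> \<lambda>p. ln (real (hn p))"
  assumes pos: "\<And>p. p \<in> T \<Longrightarrow> 2 \<le> hn p" and \<gamma>: "0 < \<gamma>" "K \<le> \<gamma> ^ k"
    and gap: "\<And>p q. p \<in> T \<Longrightarrow> q \<in> T \<Longrightarrow> hn p \<le> hn q \<Longrightarrow> \<not> link p q \<Longrightarrow> \<gamma> * h p \<le> h q"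
    and top: "\<And>p q. p \<in> T \<Longrightarrow> q \<in> T \<Longrightarrow> h q < K * h p"
    and link: "\<And>p. p \<in> T \<Longrightarrow> finite {q \<in> T. link p q} \<and> card {q \<in> T. link p q} \<le> a"
  shows "finite T \<and> card T \<le> a * k"
proof (cases "T = {}")
  case False
  then obtain p0 where p0: "p0 \<in> T" "\<And>q. q \<in> T \<Longrightarrow> hn p0 \<le> hn q"
    using ex_has_least_nat[of "\<lambda>p. p \<in> T" _ hn] by blast
  \<comment> \<open>\<open>j\<close> is the number of growth factors still available: above the
    level \<open>K * h p0\<close> there is no height by \<open>top\<close>, so a set at distance
    \<open>\<gamma> ^ j\<close> from it survives at most \<open>j\<close> rounds.\<close>
  have ind: "finite S \<and> card S \<le> a * j" if "S \<subseteq> T" "\<And>q. q \<in> S \<Longrightarrow> K * h p0 \<le> \<gamma> ^ j * h q" for S j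
    using that
  proof (induction j arbitrary: S)
    case 0
    have "S = {}"
    proof (rule ccontr)
      assume "S \<noteq> {}"
      then obtain q where "q \<in> S" by blast
      then show False using 0(2)[of q] top[OF p0(1), of q] 0(1) by auto
    qed
    then show ?case by simp
  next
    case (Suc j)
    show ?case
    proof (cases "S = {}")
      case False
      then obtain p where p: "p \<in> S" "\<And>q. q \<in> S \<Longrightarrow> hn p \<le> hn q"
        using ex_has_least_nat[of "\<lambda>p. p \<in> S" _ hn] by blast
      define S' where "S' = {q \<in> S. \<not> link p q}"
      have "finite S' \<and> card S' \<le> a * j"
      proof (rule Suc.IH)
        show "S' \<subseteq> T" using Suc.prems(1) by (auto simp: S'_def)
        fix q assume "q \<in> S'"
        then have "\<gamma> * h p \<le> h q" using gap[of p q] p Suc.prems(1) by (auto simp: S'_def)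
        then have "\<gamma> ^ j * (\<gamma> * h p) \<le> \<gamma> ^ j * h q" using \<gamma>(1) by (intro mult_left_mono) auto
        then show "K * h p0 \<le> \<gamma> ^ j * h q" using Suc.prems(2)[OF p(1)] by (simp add: mult_ac)
      qed
      moreover have "S \<subseteq> S' \<union> {q \<in> T. link p q}" using Suc.prems(1) by (auto simp: S'_def)
      moreover have "finite {q \<in> T. link p q} \<and> card {q \<in> T. link p q} \<le> a"
        using link p(1) Suc.prems(1) by blast
      ultimately have "finite S" "card S \<le> a * j + a"
        using card_mono[of "S' \<union> {q \<in> T. link p q}" S] card_Un_le[of S' "{q \<in> T. link p q}"]
        by (auto intro: finite_subset)
      then show ?thesis by simp
    qed simp
  qed
  show ?thesis
  proof (rule ind[of T k])
    fix q assume q: "q \<in> T"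
    have "0 < h p0" using pos[OF p0(1)] by (simp add: h_def)
    moreover have "h p0 \<le> h q" using p0(2)[OF q] pos[OF p0(1)] by (simp add: h_def)
    ultimately show "K * h p0 \<le> \<gamma> ^ k * h q" using \<gamma> by (intro mult_mono) auto
  qed simp
qed simp

text \<open>Bernoulli's inequality gives
  \<open>(z - 1/16) ^ 5 \<ge> z ^ 4 * (z - 5/16) \<ge> z ^ 4\<close>.\<close>

lemma gap_exponent_large:
  fixes z :: real
  assumes "3 / 2 \<le> z"
  shows "4 / 5 * ln z \<le> ln (z - 1 / 16)"
proof -
  have "z ^ 4 * 1 \<le> z ^ 4 * (z - 5 / 16)" using assms by (intro mult_left_mono) auto
  also have "\<dots> = z ^ 5 * (1 + real 5 * (- 1 / (16 * z)))" using assms by (simp add: field_simps eval_nat_numeral)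
  also have "\<dots> \<le> z ^ 5 * (1 + - 1 / (16 * z)) ^ 5"
    using assms by (intro mult_left_mono Bernoulli_inequality) (auto simp: field_simps)
  also have "\<dots> = (z - 1 / 16) ^ 5" using assms by (simp add: field_simps flip: power_mult_distrib)
  finally have "ln (z ^ 4) \<le> ln ((z - 1 / 16) ^ 5)" using assms by (subst ln_le_cancel_iff) auto
  then show ?thesis using assms by (simp add: ln_realpow)
qed

text \<open>As \<open>\<mu> < d\<close>, the denominator of \<open>g\<close> is at most
  \<open>ln (d / 2)\<close>, and passing to \<open>d / 2 - 1 / 16\<close> costs a factor
  \<open>4/5\<close>. As \<open>\<mu> > d / 2\<close>, the part
  \<open>4/5 * (1.5 * ln d + ln \<mu>)\<close> of the numerator reaches \<open>2 * ln d\<close> up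
  to a constant; \<open>4/5 * 11.51\<close> covers this constant and \<open>ln 100\<close>.\<close>

lemma number_of_steps:
  fixes \<mu> :: real
  assumes "d \<ge> 3" "real d / 2 + 1 < \<mu>" "\<mu> < real d"
  defines "g \<equiv> (11.51 + 1.5 * ln (real d) + ln \<mu>) / ln (\<mu> - real d / 2)"
  shows "100 * real d ^ 2 \<le> (real d / 2 - 1 / 16) ^ nat \<lfloor>1 + g\<rfloor>" and "0 \<le> \<lfloor>1 + g\<rfloor>"
proof -
  define k where "k = nat \<lfloor>1 + g\<rfloor>"
  define L where "L = ln (\<mu> - real d / 2)"
  have d3: "3 \<le> real d" using assms(1) by simp
  have L0: "0 < L" unfolding L_def using assms by simp
  have Lz: "L \<le> ln (real d / 2)" unfolding L_def using assms by (subst ln_le_cancel_iff) auto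
  have num: "ln (100 * real d ^ 2) \<le> 4 / 5 * (11.51 + 1.5 * ln (real d) + ln \<mu>)"
  proof -
    have "ln (real d / 2) \<le> ln \<mu>" using assms d3 by (subst ln_le_cancel_iff) auto
    then have "ln (real d) - ln 2 \<le> ln \<mu>" using d3 by (simp add: ln_div)
    moreover have "ln (100 :: real) \<le> ln (2 ^ 7)" by (subst ln_le_cancel_iff) auto
    then have "ln (100 :: real) \<le> 7 * ln 2" using ln_realpow[of "2 :: real" 7] by (simp only: of_nat_numeral)
    moreover have "ln (100 * real d ^ 2) = ln 100 + 2 * ln (real d)" using d3 by (simp add: ln_mult ln_realpow)
    ultimately show ?thesis using ln2_le_25_over_36 by simp
  qed
  have "0 \<le> ln (real d)" "0 \<le> ln \<mu>" using d3 assms by auto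
  then have g0: "0 \<le> g" unfolding g_def L_def[symmetric] using L0 by (intro divide_nonneg_pos) auto
  then show "0 \<le> \<lfloor>1 + g\<rfloor>" by simp
  have gk: "g \<le> real k" unfolding k_def using g0 by linarith
  have "ln (100 * real d ^ 2) \<le> 4 / 5 * (g * L)" using num L0 by (simp add: g_def L_def[symmetric])
  also have "\<dots> \<le> 4 / 5 * (real k * ln (real d / 2))"
    using gk Lz L0 g0 by (intro mult_left_mono mult_mono) auto
  also have "\<dots> = real k * (4 / 5 * ln (real d / 2))" by simp
  also have "\<dots> \<le> real k * ln (real d / 2 - 1 / 16)"
    using gap_exponent_large[of "real d / 2"] d3 by (intro mult_left_mono) auto
  also have "\<dots> = ln ((real d / 2 - 1 / 16) ^ k)" using d3 by (simp add: ln_realpow)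
  finally show "100 * real d ^ 2 \<le> (real d / 2 - 1 / 16) ^ nat \<lfloor>1 + g\<rfloor>"
    unfolding k_def[symmetric] using d3 by (subst (asm) ln_le_cancel_iff) auto
qed

section \<open>Binary forms\<close>

definition dehom :: "nat \<Rightarrow> 'a::comm_ring_1 poly poly \<Rightarrow> 'a poly" where
  "dehom d F = poly_of d (\<lambda>i. coeff (coeff F i) (d - i))"

abbreviation entry :: "'a^'n^'m \<Rightarrow> 'm \<Rightarrow> 'n \<Rightarrow> 'a" where
  "entry M i j \<equiv> vec_nth (vec_nth M i) j"

definition cform :: "nat \<Rightarrow> int poly \<Rightarrow> complex \<Rightarrow> complex \<Rightarrow> complex" where
  "cform d f x y = (\<Sum>i\<le>d. of_int (coeff f i) * x ^ i * y ^ (d - i))"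

lemma coeff_map_form [simp]: "h 0 = 0 \<Longrightarrow> coeff (coeff (map_form h F) i) j = h (coeff (coeff F i) j)"
  by (simp add: map_form_def coeff_map_poly)

text \<open>Stated over any commutative ring, because \<open>form_subst\<close> evaluates a form at
  bivariate polynomials.\<close>

lemma form_eval_homogeneous:
  fixes G :: "'a::comm_ring_1 poly poly"
  assumes "\<And>i j. coeff (coeff G i) j \<noteq> 0 \<Longrightarrow> i + j = d"
  shows "form_eval G x y = (\<Sum>i\<le>d. coeff (coeff G i) (d - i) * x ^ i * y ^ (d - i))"
proof -
  have mono: "coeff G i = (if i \<le> d then monom (coeff (coeff G i) (d - i)) (d - i) else 0)" for i
  proof (rule poly_eqI)
    fix j
    show "coeff (coeff G i) j = coeff (if i \<le> d then monom (coeff (coeff G i) (d - i)) (d - i) else 0) j"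
      using assms[of i j] by (cases "coeff (coeff G i) j = 0") auto
  qed
  have "degree G \<le> d"
  proof (intro degree_le allI impI)
    fix i assume "d < i"
    then show "coeff G i = 0" using mono[of i] by simp
  qed
  then have "poly G [:x:] = (\<Sum>i\<le>d. coeff G i * [:x:] ^ i)"
    by (subst poly_altdef) (intro sum.mono_neutral_left, auto simp: coeff_eq_0)
  also have "\<dots> = (\<Sum>i\<le>d. monom (coeff (coeff G i) (d - i)) (d - i) * [:x ^ i:])"
  proof (intro sum.cong refl)
    fix i assume "i \<in> {..d}"
    then have "coeff G i = monom (coeff (coeff G i) (d - i)) (d - i)" using mono[of i] by simp
    then show "coeff G i * [:x:] ^ i = monom (coeff (coeff G i) (d - i)) (d - i) * [:x ^ i:]"
      by (metis poly_const_pow)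
  qed
  finally show ?thesis
    by (simp add: form_eval_def poly_sum poly_monom mult_ac)
qed

lemma form_eval_int:
  assumes "binary_form d F"
  shows "form_eval F x y = homog d (dehom d F) x y"
  using form_eval_homogeneous[of F d x y] assms
  by (auto simp: binary_form_def homog_def dehom_def intro!: sum.cong)

lemma form_eval_of_int:
  assumes "binary_form d F"
  shows "form_eval (map_form of_int F) x y = cform d (dehom d F) x y"
  using form_eval_homogeneous[of "map_form of_int F" d x y] assms
  by (auto simp: binary_form_def cform_def dehom_def intro!: sum.cong)

lemma poly_poly_hom: "poly (poly P [:x:]) y = poly (map_poly (\<lambda>p. poly p y) P) x"
  for P :: "'a::comm_ring_1 poly poly"
  using poly_hom.poly_map_poly[of y P "[:x:]"] by simp

text \<open>Turns the polynomial identities in \<open>Aut_Qbar\<close> into identities of functions;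
  fixing \<open>y\<close> reduces the claim to one variable twice.\<close>

lemma bivariate_eqI:
  fixes P Q :: "complex poly poly"
  assumes "\<And>x y. poly (poly P [:x:]) y = poly (poly Q [:x:]) y"
  shows "P = Q"
proof (rule poly_eqI)
  fix i
  have "poly (coeff P i) y = poly (coeff Q i) y" for y
  proof -
    have "poly (map_poly (\<lambda>p. poly p y) P) = poly (map_poly (\<lambda>p. poly p y) Q)"
      using assms by (simp add: fun_eq_iff flip: poly_poly_hom)
    then have "map_poly (\<lambda>p. poly p y) P = map_poly (\<lambda>p. poly p y) Q" by (simp only: poly_eq_poly_eq_iff)
    then have "coeff (map_poly (\<lambda>p. poly p y) P) i = coeff (map_poly (\<lambda>p. poly p y) Q) i" by simp
    then show ?thesis by (simp add: coeff_map_poly)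
  qed
  then show "coeff P i = coeff Q i" by (simp add: poly_eq_poly_eq_iff[symmetric] fun_eq_iff)
qed

lemma eval_form_subst:
  assumes "binary_form d F"
  shows "poly (poly (form_subst (map_form of_int F) M) [:x:]) y
    = cform d (dehom d F) (entry M 1 1 * x + entry M 1 2 * y) (entry M 2 1 * x + entry M 2 2 * y)"
proof -
  define G where "G = map_form (\<lambda>c. [:[:c:]:]) (map_form of_int F :: complex poly poly)"
  have "form_subst (map_form of_int F) M =
     (\<Sum>i\<le>d. coeff (coeff G i) (d - i) * [:[:0, entry M 1 2:], [:entry M 1 1:]:] ^ i * [:[:0, entry M 2 2:], [:entry M 2 1:]:] ^ (d - i))"
    unfolding form_subst_def G_def[symmetric]
    by (rule form_eval_homogeneous) (use assms in \<open>auto simp: G_def binary_form_def\<close>)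
  moreover have "coeff (coeff G i) (d - i) = [:[:of_int (coeff (dehom d F) i):]:]" if "i \<le> d" for i
    using that by (simp add: G_def dehom_def)
  ultimately show ?thesis
    by (simp add: cform_def poly_sum poly_power algebra_simps cong: sum.cong_simp)
qed

lemma eval_map_form:
  assumes "binary_form d F"
  shows "poly (poly (map_form of_int F) [:x:]) y = cform d (dehom d F) x y"
  using form_eval_of_int[OF assms] by (simp add: form_eval_def)

lemma Aut_Qbar_iff:
  assumes "binary_form d F"
  defines "T \<equiv> \<lambda>M x y. cform d (dehom d F) (entry M 1 1 * x + entry M 1 2 * y) (entry M 2 1 * x + entry M 2 2 * y)"
  shows "M \<in> Aut_Qbar F \<longleftrightarrow> (\<forall>i j. algebraic (entry M i j)) \<and>
    ((\<forall>x y. T M x y = cform d (dehom d F) x y) \<or> (\<forall>x y. T M x y = - cform d (dehom d F) x y))"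
proof -
  have "form_subst (map_form of_int F) M = map_form of_int F \<longleftrightarrow> (\<forall>x y. T M x y = cform d (dehom d F) x y)"
    using bivariate_eqI[of "form_subst (map_form of_int F) M" "map_form of_int F"]
    unfolding eval_form_subst[OF assms(1)] eval_map_form[OF assms(1)] T_def
    by (metis eval_form_subst[OF assms(1)] eval_map_form[OF assms(1)])
  moreover have "form_subst (map_form of_int F) M = - map_form of_int F \<longleftrightarrow> (\<forall>x y. T M x y = - cform d (dehom d F) x y)"
    using bivariate_eqI[of "form_subst (map_form of_int F) M" "- map_form of_int F"]
    unfolding eval_form_subst[OF assms(1)] T_def poly_minus eval_map_form[OF assms(1)]
    by (metis eval_form_subst[OF assms(1)] eval_map_form[OF assms(1)] poly_minus)
  ultimately show ?thesis by (simp add: Aut_Qbar_def)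
qed

section \<open>Homogenization and irreducibility\<close>

definition hom_poly :: "nat \<Rightarrow> rat poly \<Rightarrow> rat poly poly" where
  "hom_poly e q = poly_of e (\<lambda>i. monom (coeff q i) (e - i))"

lemma hom_poly_mult:
  assumes "degree q \<le> e1" "degree r \<le> e2"
  shows "hom_poly (e1 + e2) (q * r) = hom_poly e1 q * hom_poly e2 r"
proof (rule poly_eqI)
  fix i
  have "coeff (hom_poly e1 q * hom_poly e2 r) i
      = (\<Sum>j\<le>i. if i \<le> e1 + e2 then monom (coeff q j * coeff r (i - j)) (e1 + e2 - i) else 0)"
    unfolding coeff_mult
  proof (intro sum.cong refl)
    fix j assume j: "j \<in> {..i}"
    show "coeff (hom_poly e1 q) j * coeff (hom_poly e2 r) (i - j) =
        (if i \<le> e1 + e2 then monom (coeff q j * coeff r (i - j)) (e1 + e2 - i) else 0)"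
    proof (cases "j \<le> e1 \<and> i - j \<le> e2")
      case True
      then show ?thesis using j by (auto simp: hom_poly_def mult_monom)
    next
      case False
      then have "coeff q j = 0 \<or> coeff r (i - j) = 0" using assms by (auto simp: coeff_eq_0)
      then show ?thesis using False by (auto simp: hom_poly_def)
    qed
  qed
  also have "\<dots> = coeff (hom_poly (e1 + e2) (q * r)) i"
    by (auto simp: hom_poly_def coeff_mult[of q r] monom_sum)
  finally show "coeff (hom_poly (e1 + e2) (q * r)) i = coeff (hom_poly e1 q * hom_poly e2 r) i" by simp
qed

lemma hom_poly_unit:
  assumes "hom_poly e q dvd 1"
  shows "e = 0"
proof -
  obtain p where p: "hom_poly e q = [:p:]" "p dvd 1" using assms by (auto simp: is_unit_poly_iff)
  then obtain c where c: "p = [:c:]" "c \<noteq> 0"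
    by (metis degree_eq_zeroE is_unit_iff_degree not_is_unit_0 pCons_0_0)
  have "coeff (coeff (hom_poly e q) 0) 0 \<noteq> 0" using p c by simp
  then show ?thesis by (auto simp: hom_poly_def split: if_splits)
qed

lemma irreducible_dehom:
  assumes "binary_form d F" "irreducible_form F" "2 \<le> d"
  shows "irreducible (map_poly rat_of_int (dehom d F))" "degree (dehom d F) = d"
proof -
  define g where "g = map_poly rat_of_int (dehom d F)"
  define G where "G = map_form rat_of_int F"
  have cG: "coeff (coeff G i) j = (if i + j = d then coeff g i else 0)" for i j
    using assms(1) by (auto simp: G_def g_def dehom_def binary_form_def)
  have G: "G = hom_poly d g"
  proof (intro poly_eqI)
    fix i j
    show "coeff (coeff G i) j = coeff (coeff (hom_poly d g) i) j"
      unfolding cG by (auto simp: hom_poly_def)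
  qed
  have irr: "irreducible G" using assms(2) by (simp add: irreducible_form_def G_def)
  \<comment> \<open>A factorization of \<open>g\<close> lifts to one of the form. Irreducibility
    makes one factor a unit, hence of homogeneous degree 0.\<close>
  have split: "e1 = 0 \<or> e2 = 0" if "g = q * r" "degree q \<le> e1" "degree r \<le> e2" "e1 + e2 = d" for q r e1 e2
  proof -
    have "G = hom_poly e1 q * hom_poly e2 r" using hom_poly_mult[OF that(2,3)] that G by simp
    then have "hom_poly e1 q dvd 1 \<or> hom_poly e2 r dvd 1" using irr by (rule irreducibleD[rotated])
    then show ?thesis using hom_poly_unit by blast
  qed
  have gd: "degree g \<le> d" by (auto simp: g_def dehom_def intro!: degree_le)
  have deg: "degree g = d"
  proof (rule ccontr)
    assume "degree g \<noteq> d"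
    then have "degree g \<le> d - 1" using gd by simp
    \<comment> \<open>If the degree dropped, homogenizing to degree \<open>d\<close> would split off
      \<open>hom_poly 1 1\<close>, which is the variable \<open>y\<close>.\<close>
    then show False using split[of g 1 "d - 1" 1] assms(3) by auto
  qed
  then show "degree (dehom d F) = d" by (simp add: g_def)
  have g0: "g \<noteq> 0" using deg assms(3) by auto
  show "irreducible (map_poly rat_of_int (dehom d F))"
    unfolding g_def[symmetric]
  proof (rule irreducibleI[OF g0])
    show "\<not> g dvd 1" using deg assms(3) by (auto simp: is_unit_poly_iff)
    fix q r assume qr: "g = q * r"
    then have nz: "q \<noteq> 0" "r \<noteq> 0" using g0 by auto
    then have "degree q + degree r = d" using deg qr by (simp add: degree_mult_eq)
    then have "degree q = 0 \<or> degree r = 0" using split[OF qr] by auto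
    then show "q dvd 1 \<or> r dvd 1" using nz by (auto elim!: degree_eq_zeroE simp: is_unit_poly_iff)
  qed
qed

section \<open>Galois conjugates of a root\<close>

text \<open>Iterating the map \<open>z \<mapsto> R(z)\<close> on the finitely many roots of \<open>f\<close> must return to its starting point,
  since a polynomial identity that holds at one root holds at all of them.\<close>

lemma conjugate_generates:
  fixes f R :: "rat poly" and \<alpha> :: complex
  assumes irr: "irreducible f" and \<alpha>: "poly (map_poly of_rat f) \<alpha> = 0"
    and R: "poly (map_poly of_rat f) (poly (map_poly of_rat R) \<alpha>) = 0"
  obtains S :: "rat poly" where "poly (map_poly of_rat S) (poly (map_poly of_rat R) \<alpha>) = \<alpha>"
proof -
  define Z where "Z = {z :: complex. poly (map_poly of_rat f) z = 0}"
  define \<rho> where "\<rho> = poly (map_poly of_rat R :: complex poly)"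
  define It where "It k = ((\<lambda>p. R \<circ>\<^sub>p p) ^^ k) [:0, 1:]" for k :: nat
  have It: "poly (map_poly of_rat (It k)) z = (\<rho> ^^ k) z" for k z
  proof (induction k)
    case 0
    then show ?case by (simp add: It_def of_rat_hom.map_poly_pCons_hom)
  next
    case (Suc k)
    then show ?case by (simp add: It_def poly_of_rat_pcompose \<rho>_def)
  qed
  have finZ: "finite Z" unfolding Z_def
    by (rule poly_roots_finite) (use irr in auto)
  have \<rho>Z: "\<rho> z \<in> Z" if "z \<in> Z" for z
    using irreducible_rat_vanish[OF irr \<alpha>, of "f \<circ>\<^sub>p R" z] R that
    by (simp add: poly_of_rat_pcompose Z_def \<rho>_def)
  have orb: "(\<rho> ^^ k) \<alpha> \<in> Z" for k
    by (induction k) (use \<alpha> \<rho>Z in \<open>auto simp: Z_def\<close>)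
  have "\<not> inj (\<lambda>k. (\<rho> ^^ k) \<alpha>)"
    using orb finZ by (meson finite_subset image_subset_iff infinite_UNIV_nat finite_imageD)
  then obtain a b :: nat where ab: "a < b" "(\<rho> ^^ a) \<alpha> = (\<rho> ^^ b) \<alpha>"
    unfolding inj_def by (metis nat_neq_iff)
  define e where "e = b - a - 1"
  have b: "b = Suc e + a" using ab by (simp add: e_def)
  define \<gamma> where "\<gamma> = (\<rho> ^^ a) \<alpha>"
  have "(\<rho> ^^ Suc e) \<gamma> = \<gamma>" using ab(2) unfolding b funpow_add by (simp add: \<gamma>_def)
  then have "poly (map_poly of_rat (It (Suc e) - [:0, 1:])) \<gamma> = 0"
    by (simp add: map_poly_of_rat_diff It of_rat_hom.map_poly_pCons_hom)
  then have "poly (map_poly of_rat (It (Suc e) - [:0, 1:])) \<alpha> = 0"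
    using irreducible_rat_vanish[OF irr _ _ \<alpha>] orb[of a] by (simp add: \<gamma>_def Z_def)
  then have "(\<rho> ^^ Suc e) \<alpha> = \<alpha>"
    by (simp add: map_poly_of_rat_diff It of_rat_hom.map_poly_pCons_hom)
  then have "poly (map_poly of_rat (It e)) (\<rho> \<alpha>) = \<alpha>" unfolding It by (simp only: funpow_Suc_right o_apply)
  then show thesis using that unfolding \<rho>_def by blast
qed

text \<open>The values of rational polynomials at the algebraic number \<open>\<alpha>\<close>
  already form a field: a Bezout identity with the irreducible \<open>f\<close> provides the
  inverses.\<close>

lemma adjoin_subset:
  fixes f :: "rat poly" and \<alpha> :: complex
  assumes irr: "irreducible f" and \<alpha>: "poly (map_poly of_rat f) \<alpha> = 0"
  shows "adjoin \<rat> \<alpha> \<subseteq> {poly (map_poly of_rat R) \<alpha> | R :: rat poly. True}"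
proof -
  define K where "K = {poly (map_poly of_rat R) \<alpha> | R :: rat poly. True}"
  have K: "poly (map_poly of_rat R) \<alpha> \<in> K" for R :: "rat poly" unfolding K_def by blast
  have Q: "of_rat r \<in> K" for r using K[of "[:r:]"] by (simp add: of_rat_hom.map_poly_pCons_hom)
  have "subfield_of_C K"
    unfolding subfield_of_C_def
  proof (intro conjI ballI)
    show "0 \<in> K" "1 \<in> K" using Q[of 0] Q[of 1] by simp_all
    fix x assume "x \<in> K"
    then obtain R where R: "x = poly (map_poly of_rat R) \<alpha>" unfolding K_def by blast
    show "- x \<in> K" using K[of "0 - R"] unfolding R map_poly_of_rat_diff by simp
    show "inverse x \<in> K"
    proof (cases "x = 0")
      case True
      then show ?thesis using \<open>0 \<in> K\<close> by simp
    next
      case False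
      have "\<not> f dvd R"
      proof
        assume "f dvd R"
        then obtain r where "R = f * r" by blast
        then show False using False \<alpha> by (simp add: R map_poly_of_rat_mult)
      qed
      then have "coprime f R"
        using irr by (meson algebraic_semidom_class.irreducibleD' dvd_trans not_coprimeE)
      then obtain u v where "u * f + v * R = 1"
        using bezout_coefficients_fst_snd[of f R] by (metis coprime_imp_gcd_eq_1)
      then have "map_poly of_rat u * map_poly of_rat f + map_poly of_rat v * map_poly of_rat R = (1 :: complex poly)"
        by (simp flip: map_poly_of_rat_mult of_rat_hom.map_poly_hom_add)
      then have "poly (map_poly of_rat u * map_poly of_rat f + map_poly of_rat v * map_poly of_rat R) \<alpha> = 1"
        by simp
      then have "poly (map_poly of_rat v) \<alpha> * x = 1" using \<alpha> by (simp add: R)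
      then have "inverse x = poly (map_poly of_rat v) \<alpha>" by (metis inverse_unique mult.commute)
      then show ?thesis using K by simp
    qed
    fix y assume "y \<in> K"
    then obtain S where S: "y = poly (map_poly of_rat S) \<alpha>" unfolding K_def by blast
    show "x + y \<in> K" using K[of "R + S"] by (simp add: R S of_rat_hom.map_poly_hom_add)
    show "x * y \<in> K" using K[of "R * S"] by (simp add: R S map_poly_of_rat_mult)
  qed
  moreover have "\<rat> \<subseteq> K" using Q by (auto elim: Rats_cases)
  moreover have "\<alpha> \<in> K" using K[of "[:0, 1:]"] by (simp add: of_rat_hom.map_poly_pCons_hom)
  ultimately show ?thesis unfolding adjoin_def K_def by blast
qed

lemma polys_over_Rats:
  assumes "q \<in> polys_over \<rat>"
  obtains q' :: "rat poly" where "q = map_poly of_rat q'"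
proof -
  have "\<forall>i. \<exists>r. coeff q i = of_rat r" using assms by (auto simp: polys_over_def elim: Rats_cases)
  then obtain r where r: "\<And>i. coeff q i = of_rat (r i)" by metis
  have "q = map_poly of_rat (poly_of (degree q) r)"
  proof (rule poly_eqI)
    fix i
    show "coeff q i = coeff (map_poly of_rat (poly_of (degree q) r)) i"
      by (cases "i \<le> degree q") (simp_all add: r[symmetric] coeff_map_poly coeff_eq_0)
  qed
  then show thesis by (rule that)
qed

lemma irreducible_over_Rats:
  fixes f :: "int poly"
  assumes "irreducible (map_poly rat_of_int f)" "0 < degree f"
  shows "irreducible_over \<rat> (of_int_poly f)"
  unfolding irreducible_over_def
proof (intro conjI ballI impI)
  show "of_int_poly f \<in> polys_over \<rat>" by (simp add: polys_over_def)
  show "0 < degree (of_int_poly f :: complex poly)" using assms(2) by simp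
  fix q r :: "complex poly"
  assume "q \<in> polys_over \<rat>" "r \<in> polys_over \<rat>" and eq: "of_int_poly f = q * r"
  then obtain q' r' where q: "q = map_poly of_rat q'" and r: "r = map_poly of_rat r'"
    by (metis polys_over_Rats)
  have "map_poly of_rat (map_poly rat_of_int f) = (map_poly of_rat (q' * r') :: complex poly)"
    using eq by (simp add: q r map_poly_of_rat_of_int map_poly_of_rat_mult)
  then have "map_poly rat_of_int f = q' * r'"
    by (intro poly_eqI) (metis coeff_map_poly of_rat_0 of_rat_eq_iff)
  then have "q' dvd 1 \<or> r' dvd 1" using assms(1) by (metis irreducibleD)
  then show "degree q = 0 \<or> degree r = 0" by (auto simp: q r is_unit_poly_iff)
qed

lemma cform_dehomogenize:
  assumes "degree f \<le> d"
  shows "cform d f z 1 = poly (of_int_poly f) z"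
  using assms unfolding cform_def
  by (subst poly_altdef) (auto intro!: sum.mono_neutral_right intro: le_degree)

text \<open>Normality splits \<open>f\<close> over the extension, so every root is a rational
  polynomial in \<open>\<alpha>\<close>. \<open>conjugate_generates\<close> expresses
  \<open>\<alpha>\<close> in turn by any root, and composition relates any two roots. Separability
  makes the roots \<open>d\<close> in number.\<close>

lemma galois_poly_dehom:
  assumes "binary_form d F" "irreducible_form F" "3 \<le> d"
    and \<alpha>: "form_eval (map_form of_int F) \<alpha> 1 = 0" and gal: "galois_ext \<rat> (adjoin \<rat> \<alpha>)"
  shows "galois_poly (dehom d F) {z. poly (of_int_poly (dehom d F)) z = 0} d"
proof -
  define f where "f = dehom d F"
  define fr where "fr = map_poly rat_of_int f"
  define Z where "Z = {z :: complex. poly (of_int_poly f) z = 0}"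
  have irr: "irreducible fr" and deg: "degree f = d"
    using irreducible_dehom[OF assms(1,2)] assms(3) by (auto simp: f_def fr_def)
  have fc: "map_poly of_rat fr = (of_int_poly f :: complex poly)" by (simp add: fr_def map_poly_of_rat_of_int)
  have \<alpha>Z: "poly (of_int_poly f) \<alpha> = 0"
    using \<alpha> deg by (simp add: form_eval_of_int[OF assms(1)] f_def cform_dehomogenize)
  have over: "irreducible_over \<rat> (of_int_poly f)"
    using irr deg assms(3) by (intro irreducible_over_Rats) (auto simp: fr_def)
  have \<alpha>L: "\<alpha> \<in> adjoin \<rat> \<alpha>" by (simp add: adjoin_def)
  have "splits_over (adjoin \<rat> \<alpha>) (of_int_poly f)" "rsquarefree (of_int_poly f :: complex poly)"
    using gal over \<alpha>L \<alpha>Z unfolding galois_ext_def normal_ext_def separable_ext_def by blast+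
  then obtain c rs where rs: "set rs \<subseteq> adjoin \<rat> \<alpha>" "of_int_poly f = smult c (\<Prod>r\<leftarrow>rs. [:- r, 1:])"
    unfolding splits_over_def by blast
  have f0: "(of_int_poly f :: complex poly) \<noteq> 0" using deg assms(3) by auto
  have "Z \<subseteq> set rs"
  proof
    fix z assume "z \<in> Z"
    then have "poly (smult c (\<Prod>r\<leftarrow>rs. [:- r, 1:])) z = 0" unfolding Z_def rs(2) by simp
    moreover have "c \<noteq> 0" using f0 rs(2) by auto
    ultimately have "poly (\<Prod>r\<leftarrow>rs. [:- r, 1:]) z = 0" by simp
    then have "0 \<in> set (map (\<lambda>r. z - r) rs)" by (simp add: poly_prod_list o_def prod_list_zero_iff)
    then show "z \<in> set rs" by auto
  qed
  then have gen: "\<exists>R :: rat poly. poly (map_poly of_rat R) \<alpha> = z" if "z \<in> Z" for z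
    using rs(1) adjoin_subset[OF irr] \<alpha>Z that fc by fastforce
  show ?thesis
    unfolding galois_poly_def f_def[symmetric] Z_def[symmetric]
  proof (intro conjI allI impI)
    show "irreducible (map_poly rat_of_int f)" using irr by (simp add: fr_def)
    show "Z = Z" "d = degree f" "3 \<le> d" using assms deg by (auto simp: Z_def)
    have "smult (lead_coeff (of_int_poly f)) (\<Prod>z\<in>Z. [:- z, 1:]) = (of_int_poly f :: complex poly)"
      unfolding Z_def by (rule complex_poly_decompose_rsquarefree) fact
    then have "degree (smult (lead_coeff (of_int_poly f)) (\<Prod>z\<in>Z. [:- z, 1:]) :: complex poly) = d"
      using deg by simp
    moreover have "lead_coeff (of_int_poly f :: complex poly) \<noteq> 0" using f0 by simp
    ultimately show "card Z = d" by (simp add: degree_prod_eq_sum_degree)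
    fix \<gamma> \<delta> assume \<gamma>: "\<gamma> \<in> Z" and \<delta>: "\<delta> \<in> Z"
    obtain R where R: "poly (map_poly of_rat R) \<alpha> = \<gamma>" using gen[OF \<gamma>] by blast
    obtain S where S: "poly (map_poly of_rat S) \<gamma> = \<alpha>"
      using conjugate_generates[OF irr, of \<alpha> R] \<alpha>Z \<gamma> unfolding fc R Z_def by blast
    obtain R' where "poly (map_poly of_rat R') \<alpha> = \<delta>" using gen[OF \<delta>] by blast
    then have "poly (map_poly of_rat (R' \<circ>\<^sub>p S)) \<gamma> = \<delta>" by (simp add: poly_of_rat_pcompose S)
    then show "\<exists>R :: rat poly. poly (map_poly of_rat R) \<gamma> = \<delta>" by blast
  qed
qed

section \<open>Automorphisms of the form\<close>

lemma entry_mat2 [simp]: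
  "entry (mat2 s u t v) 1 1 = s" "entry (mat2 s u t v) 1 2 = u"
  "entry (mat2 s u t v) 2 1 = t" "entry (mat2 s u t v) 2 2 = v"
  by (simp_all add: mat2_def vector_def)

lemma entry_scaleR: "entry (r *\<^sub>R M) i j = of_real r * (entry M i j :: complex)"
  unfolding vector_scaleR_component by (rule scaleR_conv_of_real)

lemma cform_scale: "cform d f (c * x) (c * y) = c ^ d * cform d f x y"
proof -
  have "of_int (coeff f i) * (c * x) ^ i * (c * y) ^ (d - i) = c ^ d * (of_int (coeff f i) * x ^ i * y ^ (d - i))"
    if "i \<le> d" for i
  proof -
    have "c ^ d = c ^ i * c ^ (d - i)" using that by (simp flip: power_add)
    then show ?thesis by (simp add: power_mult_distrib mult_ac)
  qed
  then show ?thesis unfolding cform_def sum_distrib_left by (intro sum.cong) auto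
qed

lemma algebraic_sqrt_quotient:
  assumes "D > 0"
  shows "algebraic (complex_of_real (1 / sqrt (real_of_int D)) * of_int s)"
proof (rule algebraicI[of "[:- (of_int s * of_int s), 0, of_int D:]"])
  show "\<And>i. coeff [:- (of_int s * of_int s :: complex), 0, of_int D:] i \<in> \<int>"
    by (simp add: coeff_pCons split: nat.splits)
  show "[:- (of_int s * of_int s :: complex), 0, of_int D:] \<noteq> 0" using assms by simp
  have "complex_of_real (sqrt (real_of_int D)) ^ 2 = of_int D"
    using assms by (simp flip: of_real_power)
  then show "poly [:- (of_int s * of_int s :: complex), 0, of_int D:] (complex_of_real (1 / sqrt (real_of_int D)) * of_int s) = 0"
    using assms by (simp add: power2_eq_square field_simps)
qed

context galois_poly
begin

lemma cform_factorization: "cform d f x y = of_int lc * (\<Prod>z\<in>Z. x - z * y)"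
proof (cases "y = 0")
  case True
  have "cform d f x y = (\<Sum>i\<le>d. if i = d then of_int (coeff f d) * x ^ d else 0)"
    unfolding cform_def True by (intro sum.cong) auto
  then show ?thesis using True card_Z by (simp add: d)
next
  case False
  have "cform d f (y * (x / y)) (y * 1) = y ^ d * poly (of_int_poly f) (x / y)"
    unfolding cform_scale by (simp add: cform_dehomogenize d)
  also have "\<dots> = of_int lc * ((\<Prod>z\<in>Z. y) * (\<Prod>z\<in>Z. x / y - z))"
    using card_Z by (simp add: f_factorization poly_prod)
  also have "(\<Prod>z\<in>Z. y) * (\<Prod>z\<in>Z. x / y - z) = (\<Prod>z\<in>Z. x - z * y)"
    unfolding prod.distrib[symmetric] using False by (intro prod.cong) (auto simp: field_simps)
  finally show ?thesis using False by simp
qed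

lemma irrational_linear:
  assumes "z \<in> Z" "of_int t * z + of_int v = 0"
  shows "t = 0" "v = 0"
proof -
  have "[:v, t:] = 0"
    by (rule int_degree[OF assms(1)]) (use assms(2) d_ge in \<open>auto simp: hom_distribs algebra_simps\<close>)
  then show "t = 0" "v = 0" by auto
qed

text \<open>Each root occurs in \<open>2 * (d - 1)\<close> ordered pairs of distinct roots,
  \<open>d - 1\<close> times on either side.\<close>

lemma prod_pairs:
  fixes g :: "complex \<Rightarrow> complex"
  assumes "\<And>z. z \<in> Z \<Longrightarrow> g z \<noteq> 0"
  shows "(\<Prod>z\<in>Z. \<Prod>w\<in>Z - {z}. g z * g w) = ((\<Prod>z\<in>Z. g z) ^ (d - 1)) ^ 2"
proof -
  let ?P = "\<Prod>z\<in>Z. g z"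
  have "(\<Prod>w\<in>Z - {z}. g z * g w) = g z ^ (d - 1) * (?P / g z)" if "z \<in> Z" for z
    using that assms finite_Z card_Z by (simp add: prod.distrib prod.remove[of Z z g] card_Diff_singleton)
  then have "(\<Prod>z\<in>Z. \<Prod>w\<in>Z - {z}. g z * g w) = (\<Prod>z\<in>Z. g z ^ (d - 1) * (?P / g z))" by simp
  also have "\<dots> = ?P ^ (d - 1) * (?P ^ d / ?P)"
    by (simp add: prod.distrib prod_dividef prod_power_distrib card_Z)
  also have "?P ^ d / ?P = ?P ^ (d - 1)"
    using assms finite_Z d_ge by (cases d) (auto simp: prod_zero_iff)
  finally show ?thesis by (simp add: power2_eq_square)
qed

text \<open>A Moebius transformation taking one root to another permutes all roots, hence fixes the form up
  to a scalar; comparing \<open>\<Prod> (z - w)\<close> over pairs of roots before and after determines the scalar.\<close>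

lemma moebius_scalar:
  assumes "\<alpha> \<in> Z" "\<beta> \<in> Z" and det: "s * v - t * u \<noteq> 0"
    and M: "of_int s * \<alpha> + of_int u = \<beta> * (of_int t * \<alpha> + of_int v)"
  obtains c :: real where "\<And>x y. cform d f (of_int s * x + of_int u * y) (of_int t * x + of_int v * y) = of_real c * cform d f x y"
    "c ^ 2 = real_of_int \<bar>s * v - t * u\<bar> ^ d"
proof -
  define D :: complex where "D = of_int (s * v - t * u)"
  define b where "b = conj \<alpha> \<beta>"
  define B where "B z = of_int t * z + of_int v" for z :: complex
  have D0: "D \<noteq> 0" unfolding D_def of_int_eq_0_iff by (rule det)
  have B0: "B z \<noteq> 0" if "z \<in> Z" for z 
  proof
    assume "B z = 0"
    then have "t = 0" "v = 0" using irrational_linear[OF that, of t v] by (simp_all add: B_def)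
    then show False using det by simp
  qed
  \<comment> \<open>The relation \<open>M\<close> is the vanishing of a \<open>lin\<close>, so it
    holds at every root with the conjugate of \<open>\<beta>\<close> in place of
    \<open>\<beta>\<close>.\<close>
  have "lin \<alpha> \<beta> [:u, s:] [:v, t:] \<alpha> = 0"
    using M assms(1,2) by (simp add: lin_self hom_distribs algebra_simps)
  then have bz: "of_int s * z + of_int u = b z * B z" if "z \<in> Z" for z
  proof -
    have "lin \<alpha> \<beta> [:u, s:] [:v, t:] z = 0" by (rule lin_vanish[OF assms(1) _ that]) fact
    then show ?thesis by (simp add: lin_def hom_distribs b_def B_def algebra_simps)
  qed
  have bZ: "b z \<in> Z" if "z \<in> Z" for z unfolding b_def by (rule conj_in[OF assms(1,2) that])
  have diff: "(b z - b w) * (B z * B w) = D * (z - w)" if "z \<in> Z" "w \<in> Z" for z w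
  proof -
    have "(b z - b w) * (B z * B w) = (b z * B z) * B w - (b w * B w) * B z" by (simp add: algebra_simps)
    also have "\<dots> = D * (z - w)"
      unfolding bz[OF that(1), symmetric] bz[OF that(2), symmetric] by (simp add: D_def B_def algebra_simps)
    finally show ?thesis .
  qed
  have inj: "inj_on b Z"
  proof (rule inj_onI)
    fix z w assume zw: "z \<in> Z" "w \<in> Z" "b z = b w"
    then have "D * (z - w) = 0" using diff[OF zw(1,2)] by simp
    then show "z = w" using D0 by simp
  qed
  have bij: "bij_betw b Z Z"
    using inj bZ finite_Z by (simp add: bij_betw_def endo_inj_surj image_subset_iff)
  define P where "P = (\<Prod>z\<in>Z. B z)"
  have P0: "P \<noteq> 0" using B0 finite_Z by (simp add: P_def prod_zero_iff)
  have c: "cform d f (of_int s * x + of_int u * y) (of_int t * x + of_int v * y) = D ^ d / P * cform d f x y" for x y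
  proof -
    let ?X = "of_int s * x + of_int u * y" and ?Y = "of_int t * x + of_int v * y"
    have "(\<Prod>z\<in>Z. ?X - z * ?Y) = (\<Prod>z\<in>Z. ?X - b z * ?Y)"
      using prod.reindex_bij_betw[OF bij, of "\<lambda>z. ?X - z * ?Y"] by simp
    also have "\<dots> = (\<Prod>z\<in>Z. D * (x - z * y) / B z)"
    proof (intro prod.cong refl)
      fix z assume z: "z \<in> Z"
      have "(?X - b z * ?Y) * B z = ?X * B z - (b z * B z) * ?Y" by (simp add: algebra_simps)
      also have "\<dots> = D * (x - z * y)"
        unfolding bz[OF z, symmetric] by (simp add: D_def B_def algebra_simps)
      finally show "?X - b z * ?Y = D * (x - z * y) / B z" using B0[OF z] by (simp add: field_simps)
    qed
    also have "\<dots> = D ^ d / P * (\<Prod>z\<in>Z. x - z * y)"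
      by (simp add: prod.distrib prod_dividef P_def card_Z)
    finally show ?thesis by (simp add: cform_factorization mult_ac)
  qed
  \<comment> \<open>Evaluation at \<open>(1, 0)\<close> compares the coefficients of
    \<open>x ^ d\<close> and shows that the scalar is a quotient of integers, hence real.\<close>
  have lcf: "cform d f 1 0 = of_int lc" using cform_factorization[of 1 0] by simp
  have "cform d f (of_int s) (of_int t) = of_int (\<Sum>i\<le>d. coeff f i * s ^ i * t ^ (d - i))"
    by (simp add: cform_def)
  moreover have "cform d f (of_int s) (of_int t) = D ^ d / P * of_int lc"
    using c[of 1 0] lcf by simp
  ultimately have "D ^ d / P = of_int (\<Sum>i\<le>d. coeff f i * s ^ i * t ^ (d - i)) / of_int lc"
    using lc_nz by (simp add: field_simps)
  then have "D ^ d / P \<in> \<real>" by (metis Reals_divide Reals_of_int)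
  then obtain c where cr: "D ^ d / P = of_real c" by (auto elim: Reals_cases)
  \<comment> \<open>\<open>b\<close> permutes the roots, so the product of all their differences is
    unchanged; together with \<open>diff\<close> this determines the modulus of \<open>P\<close>
    from \<open>D\<close>.\<close>
  have perm: "(\<Prod>z\<in>Z. \<Prod>w\<in>Z - {z}. b z - b w) = (\<Prod>z\<in>Z. \<Prod>w\<in>Z - {z}. z - w)"
  proof -
    have "(\<Prod>w\<in>Z - {z}. b z - b w) = (\<Prod>w\<in>Z - {b z}. b z - w)" if "z \<in> Z" for z
    proof (rule prod.reindex_bij_betw)
      show "bij_betw b (Z - {z}) (Z - {b z})"
        using bij_betw_DiffI[OF bij, of "{z}" "{b z}"] that bZ by (simp add: bij_betw_def)
    qed
    then have "(\<Prod>z\<in>Z. \<Prod>w\<in>Z - {z}. b z - b w) = (\<Prod>z\<in>Z. \<Prod>w\<in>Z - {b z}. b z - w)" by simp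
    also have "\<dots> = (\<Prod>z\<in>Z. \<Prod>w\<in>Z - {z}. z - w)" by (rule prod.reindex_bij_betw[OF bij])
    finally show ?thesis .
  qed
  define V where "V = (\<Prod>z\<in>Z. \<Prod>w\<in>Z - {z}. z - w)"
  have V0: "V \<noteq> 0" using finite_Z by (auto simp: V_def prod_zero_iff)
  have "V * (\<Prod>z\<in>Z. \<Prod>w\<in>Z - {z}. B z * B w) = (\<Prod>z\<in>Z. \<Prod>w\<in>Z - {z}. (b z - b w) * (B z * B w))"
    unfolding V_def perm[symmetric] by (simp only: prod.distrib)
  also have "\<dots> = (\<Prod>z\<in>Z. \<Prod>w\<in>Z - {z}. D * (z - w))" using diff by (intro prod.cong) auto
  also have "\<dots> = (D ^ d) ^ (d - 1) * V"
    using finite_Z card_Z by (simp add: prod.distrib V_def card_Diff_singleton power_mult mult.commute flip: power_mult)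
  finally have "(P ^ (d - 1)) ^ 2 = (D ^ d) ^ (d - 1)"
    using V0 prod_pairs[of B] B0 by (simp add: P_def mult.commute)
  then have "cmod ((P ^ 2) ^ (d - 1)) = cmod ((D ^ d) ^ (d - 1))" by (simp add: mult.commute flip: power_mult)
  then have "(cmod P ^ 2) ^ (d - 1) = (cmod D ^ d) ^ (d - 1)" by (simp add: norm_power)
  then have PD: "cmod P ^ 2 = cmod D ^ d"
    by (rule power_eq_imp_eq_base) (use d_ge in auto)
  have "\<bar>c\<bar> = cmod (D ^ d / P)" by (simp add: cr)
  also have "\<dots> = cmod D ^ d / cmod P" by (simp add: norm_divide norm_power)
  finally have "\<bar>c\<bar> ^ 2 = (cmod D ^ d) ^ 2 / cmod P ^ 2" by (simp add: power_divide)
  also have "\<dots> = cmod D ^ d" unfolding PD using D0 by (simp add: power2_eq_square)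
  finally have "c ^ 2 = real_of_int \<bar>s * v - t * u\<bar> ^ d" unfolding D_def by (simp only: norm_of_int power2_abs of_int_abs)
  then show thesis using that c cr by metis
qed

end

locale galois_form = galois_poly f Z d for f Z d +
  fixes F :: "int poly poly"
  assumes bf: "binary_form d F" and fF: "f = dehom d F"
begin

lemma Aut_enh_memI:
  assumes "\<alpha> \<in> Z" "\<beta> \<in> Z" and det: "s * v - t * u \<noteq> 0"
    and M: "of_int s * \<alpha> + of_int u = \<beta> * (of_int t * \<alpha> + of_int v)"
  shows "(1 / sqrt (real_of_int \<bar>s * v - t * u\<bar>)) *\<^sub>R mat2 (of_int s) (of_int u) (of_int t) (of_int v) \<in> Aut_enh F"
proof -
  define D where "D = \<bar>s * v - t * u\<bar>"
  define r where "r = 1 / sqrt (real_of_int D)"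
  have D: "D > 0" using det by (simp add: D_def)
  obtain c where c: "\<And>x y. cform d f (of_int s * x + of_int u * y) (of_int t * x + of_int v * y) = of_real c * cform d f x y"
    "c ^ 2 = real_of_int D ^ d"
    using moebius_scalar[OF assms] unfolding D_def by metis
  define N where "N = r *\<^sub>R mat2 (of_int s) (of_int u) (of_int t) (of_int v)"
  have ent: "entry N 1 1 = of_real r * of_int s" "entry N 1 2 = of_real r * of_int u"
    "entry N 2 1 = of_real r * of_int t" "entry N 2 2 = of_real r * of_int v"
    by (simp_all only: N_def entry_scaleR entry_mat2)
  have N: "cform d f (entry N 1 1 * x + entry N 1 2 * y) (entry N 2 1 * x + entry N 2 2 * y)
      = of_real (r ^ d * c) * cform d f x y" for x y
  proof -
    have "cform d f (entry N 1 1 * x + entry N 1 2 * y) (entry N 2 1 * x + entry N 2 2 * y)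
       = cform d f (of_real r * (of_int s * x + of_int u * y)) (of_real r * (of_int t * x + of_int v * y))"
      by (simp add: ent algebra_simps)
    then show ?thesis by (simp add: cform_scale c(1))
  qed
  \<comment> \<open>Scaling the matrix by \<open>r\<close> multiplies the form by
    \<open>r ^ d\<close>; the normalization by the determinant makes the square of the total scalar
    1.\<close>
  have "(r ^ d * c) ^ 2 = (r ^ 2 * real_of_int D) ^ d"
    by (simp add: c(2) power_mult_distrib mult.commute flip: power_mult)
  also have "r ^ 2 * real_of_int D = 1" using D by (simp add: r_def power_divide)
  finally have "r ^ d * c = 1 \<or> r ^ d * c = -1" by (simp add: power2_eq_1_iff)
  then have "complex_of_real (r ^ d * c) = 1 \<or> complex_of_real (r ^ d * c) = - 1"
    by (metis of_real_1 of_real_minus)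
  then have "(\<forall>x y. of_real (r ^ d * c) * cform d f x y = cform d f x y)
      \<or> (\<forall>x y. of_real (r ^ d * c) * cform d f x y = - cform d f x y)"
    by (elim disjE) simp_all
  moreover have "\<forall>i j. algebraic (entry N i j)"
    unfolding forall_2 ent r_def using algebraic_sqrt_quotient[OF D] by blast
  ultimately have "N \<in> Aut_Qbar F"
    unfolding Aut_Qbar_iff[OF bf] fF[symmetric] N by blast
  moreover have "\<exists>s u t v :: int. N = (1 / sqrt (real_of_int \<bar>s * v - t * u\<bar>)) *\<^sub>R mat2 (of_int s) (of_int u) (of_int t) (of_int v) \<and> s * v - t * u \<noteq> 0"
    using det unfolding N_def r_def D_def by blast
  ultimately show ?thesis unfolding Aut_enh_def N_def r_def D_def by blast
qed

lemma Aut_enh_image: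
  assumes "\<alpha> \<in> Z" "N \<in> Aut_enh F"
  obtains s u t v :: int and r :: real and z where "r \<noteq> 0" "N = r *\<^sub>R mat2 (of_int s) (of_int u) (of_int t) (of_int v)"
    "s * v - t * u \<noteq> 0" "r ^ 2 * real_of_int \<bar>s * v - t * u\<bar> = 1" "z \<in> Z"
    "of_int s * \<alpha> + of_int u = z * (of_int t * \<alpha> + of_int v)"
proof -
  obtain s u t v :: int where N: "N = (1 / sqrt (real_of_int \<bar>s * v - t * u\<bar>)) *\<^sub>R mat2 (of_int s) (of_int u) (of_int t) (of_int v)"
    and det: "s * v - t * u \<noteq> 0" and Q: "N \<in> Aut_Qbar F"
    using assms(2) unfolding Aut_enh_def by blast
  define D where "D = \<bar>s * v - t * u\<bar>"
  define r where "r = 1 / sqrt (real_of_int D)"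
  have D: "D > 0" using det by (simp add: D_def)
  have r0: "r \<noteq> 0" using D by (simp add: r_def)
  have r2: "r ^ 2 * real_of_int \<bar>s * v - t * u\<bar> = 1" using D unfolding D_def[symmetric] by (simp add: r_def power_divide)
  have ent: "entry N 1 1 = of_real r * of_int s" "entry N 1 2 = of_real r * of_int u"
    "entry N 2 1 = of_real r * of_int t" "entry N 2 2 = of_real r * of_int v"
    by (simp_all only: N r_def D_def entry_scaleR entry_mat2)
  have "cform d f \<alpha> 1 = 0" using assms(1) by (simp add: cform_dehomogenize d root_iff)
  moreover have "cform d f (entry N 1 1 * \<alpha> + entry N 1 2 * 1) (entry N 2 1 * \<alpha> + entry N 2 2 * 1) = cform d f \<alpha> 1
      \<or> cform d f (entry N 1 1 * \<alpha> + entry N 1 2 * 1) (entry N 2 1 * \<alpha> + entry N 2 2 * 1) = - cform d f \<alpha> 1"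
    using Q unfolding Aut_Qbar_iff[OF bf] fF[symmetric] by blast
  ultimately have "cform d f (entry N 1 1 * \<alpha> + entry N 1 2 * 1) (entry N 2 1 * \<alpha> + entry N 2 2 * 1) = 0" by auto
  moreover have "cform d f (entry N 1 1 * \<alpha> + entry N 1 2 * 1) (entry N 2 1 * \<alpha> + entry N 2 2 * 1)
      = cform d f (of_real r * (of_int s * \<alpha> + of_int u)) (of_real r * (of_int t * \<alpha> + of_int v))"
    by (simp add: ent algebra_simps)
  ultimately have "cform d f (of_int s * \<alpha> + of_int u) (of_int t * \<alpha> + of_int v) = 0"
    using r0 by (simp add: cform_scale)
  then obtain z where "z \<in> Z" "of_int s * \<alpha> + of_int u = z * (of_int t * \<alpha> + of_int v)"
    unfolding cform_factorization using lc_nz finite_Z by (auto simp: prod_zero_iff)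
  then show thesis using that[OF r0 _ det r2] N unfolding r_def D_def by blast
qed

end

lemma degree_quadratic_le: "degree [:a, b, c:] \<le> 2"
  by (auto intro!: degree_le simp: coeff_pCons split: nat.splits)

context galois_form
begin

text \<open>Since \<open>card\<close> is 0 on infinite sets, the bound is meaningful only with this
  fact. An element is determined up to sign by the image of one root: two integer matrices that take
  \<open>\<alpha>\<close> to the same \<open>z\<close> give an equation of degree at most 2 for
  \<open>\<alpha>\<close>, which is trivial because \<open>d \<ge> 3\<close>, and so they are
  proportional.\<close>

lemma finite_Aut_enh: "finite (Aut_enh F)"
proof -
  obtain \<alpha> where \<alpha>: "\<alpha> \<in> Z" using card_Z d_ge by (metis all_not_in_conv card.empty not_numeral_le_zero)
  define R where "R z N \<longleftrightarrow> (\<exists>(s::int) (u::int) (t::int) (v::int) (r::real). r \<noteq> 0 \<and> N = r *\<^sub>R mat2 (of_int s) (of_int u) (of_int t) (of_int v)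
    \<and> s * v - t * u \<noteq> 0 \<and> r ^ 2 * real_of_int \<bar>s * v - t * u\<bar> = 1
    \<and> of_int s * \<alpha> + of_int u = z * (of_int t * \<alpha> + of_int v))" for z N
  have cover: "Aut_enh F \<subseteq> (\<Union>z\<in>Z. {N. R z N})"
  proof
    fix N assume "N \<in> Aut_enh F"
    then show "N \<in> (\<Union>z\<in>Z. {N. R z N})"
    proof (rule Aut_enh_image[OF \<alpha>], goal_cases)
      case (1 s u t v r z)
      then have "R z N" unfolding R_def by blast
      then show ?case using 1 by blast
    qed
  qed
  have fib: "N' = N \<or> N' = - N" if "R z N" "R z N'" for z N N'
  proof -
    obtain s u t v :: int and r :: real where 1: "r \<noteq> 0" "N = r *\<^sub>R mat2 (of_int s) (of_int u) (of_int t) (of_int v)"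
      "s * v - t * u \<noteq> 0" "r ^ 2 * real_of_int \<bar>s * v - t * u\<bar> = 1" "of_int s * \<alpha> + of_int u = z * (of_int t * \<alpha> + of_int v)"
      using \<open>R z N\<close> unfolding R_def by blast
    obtain s' u' t' v' :: int and r' :: real where 2: "r' \<noteq> 0" "N' = r' *\<^sub>R mat2 (of_int s') (of_int u') (of_int t') (of_int v')"
      "s' * v' - t' * u' \<noteq> 0" "r' ^ 2 * real_of_int \<bar>s' * v' - t' * u'\<bar> = 1" "of_int s' * \<alpha> + of_int u' = z * (of_int t' * \<alpha> + of_int v')"
      using \<open>R z N'\<close> unfolding R_def by blast
    have "[:u * v' - u' * v, s * v' + u * t' - s' * v - u' * t, s * t' - s' * t:] = 0"
    proof (rule int_degree[OF \<alpha>])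
      have "(of_int s * \<alpha> + of_int u) * (of_int t' * \<alpha> + of_int v') = (of_int s' * \<alpha> + of_int u') * (of_int t * \<alpha> + of_int v)"
        unfolding 1(5) 2(5) by (simp add: mult_ac)
      then show "poly (of_int_poly [:u * v' - u' * v, s * v' + u * t' - s' * v - u' * t, s * t' - s' * t:]) \<alpha> = 0"
        by (simp add: hom_distribs algebra_simps)
      show "degree [:u * v' - u' * v, s * v' + u * t' - s' * v - u' * t, s * t' - s' * t:] < d"
        by (rule le_less_trans[OF degree_quadratic_le]) (use d_ge in simp)
    qed
    then have e: "u * v' = u' * v" "s * v' + u * t' = s' * v + u' * t" "s * t' = s' * t" by auto
    \<comment> \<open>If the primed matrix is a multiple of the other one, the ratio is
      \<open>E / D\<close>; this is how \<open>E\<close> is found.\<close>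
    define E where "E = s * v' - u' * t"
    define D where "D = s * v - t * u"
    have D0: "D \<noteq> 0" using 1(3) by (simp add: D_def)
    have p: "s' * D = s * E" "u' * D = u * E" "t' * D = t * E" "v' * D = v * E"
    proof -
      have "s * E = s * (s * v' + u * t') - u * (s * t') - s * u' * t" by (simp add: E_def algebra_simps)
      also have "\<dots> = s' * D" unfolding e(2) e(3) by (simp add: D_def algebra_simps)
      finally show "s' * D = s * E" by simp
      have "u * E = s * (u * v') - u * u' * t" by (simp add: E_def algebra_simps)
      also have "\<dots> = u' * D" unfolding e(1) by (simp add: D_def algebra_simps)
      finally show "u' * D = u * E" by simp
      have "t * E = t * (s * v' + u * t') - t * u * t' - t * u' * t" by (simp add: E_def algebra_simps)
      also have "\<dots> = v * (s' * t) - t * u * t'" unfolding e(2) by (simp add: algebra_simps)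
      also have "\<dots> = t' * D" unfolding e(3)[symmetric] by (simp add: D_def algebra_simps)
      finally show "t' * D = t * E" by simp
      have "v * E = v * s * v' - t * (u' * v)" by (simp add: E_def algebra_simps)
      also have "\<dots> = v' * D" unfolding e(1)[symmetric] by (simp add: D_def algebra_simps)
      finally show "v' * D = v * E" by simp
    qed
    define k where "k = r' * (real_of_int E / real_of_int D) / r"
    have q: "real_of_int a' = real_of_int a * (real_of_int E / real_of_int D)" if "a' * D = a * E" for a a'
    proof -
      have "real_of_int a' * real_of_int D = real_of_int a * real_of_int E" using that by (metis of_int_mult)
      then show ?thesis using D0 by (simp add: field_simps)
    qed
    have q': "r' * real_of_int a' = k * (r * real_of_int a)" if "a' * D = a * E" for a a'
      unfolding q[OF that] k_def using 1(1) by simp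
    have q'': "complex_of_real r' * of_int a' = of_real k * (of_real r * of_int a)" if "a' * D = a * E" for a a'
      using arg_cong[OF q'[OF that], of complex_of_real] by simp
    have N': "N' = k *\<^sub>R N"
    proof -
      have "entry N' i j = entry (k *\<^sub>R N) i j" for i j
        using exhaust_2[of i] exhaust_2[of j] unfolding 1(2) 2(2)
        by (elim disjE) (simp_all only: entry_scaleR entry_mat2 q''[OF p(1)] q''[OF p(2)] q''[OF p(3)] q''[OF p(4)])
      then show ?thesis by (simp only: Finite_Cartesian_Product.vec_eq_iff) simp
    qed
    have "\<bar>(r' * s') * (r' * v') - (r' * t') * (r' * u')\<bar> = \<bar>r' ^ 2 * real_of_int (s' * v' - t' * u')\<bar>"
      by (simp add: power2_eq_square algebra_simps)
    also have "\<dots> = r' ^ 2 * real_of_int \<bar>s' * v' - t' * u'\<bar>" by (simp only: abs_mult abs_power2 of_int_abs)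
    finally have "\<bar>(r' * s') * (r' * v') - (r' * t') * (r' * u')\<bar> = r' ^ 2 * real_of_int \<bar>s' * v' - t' * u'\<bar>" .
    then have "1 = \<bar>(r' * s') * (r' * v') - (r' * t') * (r' * u')\<bar>" using 2(4) by simp
    also have "\<dots> = \<bar>k ^ 2 * (r ^ 2 * real_of_int (s * v - t * u))\<bar>"
      unfolding q'[OF p(1)] q'[OF p(2)] q'[OF p(3)] q'[OF p(4)] by (simp add: power2_eq_square algebra_simps)
    also have "\<dots> = k ^ 2 * (r ^ 2 * real_of_int \<bar>s * v - t * u\<bar>)" by (simp only: abs_mult abs_power2 of_int_abs)
    finally have "k ^ 2 = 1" using 1(4) by simp
    then show ?thesis using N' by (auto simp: power2_eq_1_iff)
  qed
  have "finite {N. R z N}" for z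
  proof (cases "\<exists>N. R z N")
    case True
    then obtain N where "R z N" by blast
    then have "{N. R z N} \<subseteq> {N, - N}" using fib by blast
    then show ?thesis by (rule finite_subset) simp
  qed simp
  then show ?thesis using cover finite_Z by (meson finite_UN_I finite_subset)
qed

end

section \<open>Computability of the threshold\<close>

lemma rec_comp1: "rec_eval \<phi> g xs y \<Longrightarrow> rec_eval \<phi> h [y] z \<Longrightarrow> rec_eval \<phi> (Comp h [g]) xs z"
  by (rule rec_eval.comp[where ys = "[y]"]) auto

lemma rec_comp2:
  "rec_eval \<phi> g1 xs y1 \<Longrightarrow> rec_eval \<phi> g2 xs y2 \<Longrightarrow> rec_eval \<phi> h [y1, y2] z \<Longrightarrow> rec_eval \<phi> (Comp h [g1, g2]) xs z"
  by (rule rec_eval.comp[where ys = "[y1, y2]"]) (auto simp: less_Suc_eq)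

lemma rec_proj: "i < length xs \<Longrightarrow> y = xs ! i \<Longrightarrow> rec_eval \<phi> (Proj i) xs y"
  by (auto intro: rec_eval.proj)

definition rec_add :: recf where
  "rec_add = PrimRec (Proj 0) (Comp Succ [Proj 1])"

lemma rec_add: "rec_eval \<phi> rec_add [x, y] (x + y)"
  unfolding rec_add_def
proof (induction x)
  case 0
  show ?case by (rule rec_eval.prim_0) (auto intro: rec_proj)
next
  case (Suc x)
  then show ?case
    by (rule rec_eval.prim_Suc) (auto intro!: rec_comp1 rec_proj rec_eval.succ)
qed

definition rec_pow2 :: recf where
  "rec_pow2 = PrimRec (Comp Succ [Zero]) (Comp rec_add [Proj 1, Proj 1])"

lemma rec_pow2: "rec_eval \<phi> rec_pow2 [x] (2 ^ x)"
  unfolding rec_pow2_def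
proof (induction x)
  case 0
  have "rec_eval \<phi> (Comp Succ [Zero]) [] (Suc 0)"
    by (rule rec_comp1[OF rec_eval.zero rec_eval.succ])
  then show ?case using rec_eval.prim_0 by fastforce
next
  case (Suc x)
  have "rec_eval \<phi> (Comp rec_add [Proj 1, Proj 1]) [x, 2 ^ x] (2 ^ x + 2 ^ x)"
    by (rule rec_comp2[OF _ _ rec_add]) (auto intro: rec_proj)
  with Suc have "rec_eval \<phi> (PrimRec (Comp Succ [Zero]) (Comp rec_add [Proj 1, Proj 1])) [Suc x] (2 ^ x + 2 ^ x)"
    by (rule rec_eval.prim_Suc)
  then show ?case by (simp add: mult_2)
qed

text \<open>The innermost argument bounds \<open>m\<close>, \<open>d\<close> and all coefficients.
  The height needed is a power of twice this argument, with an exponent polynomial in it. The two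
  upper stages dominate any such exponent, the lowest one the base.\<close>

definition threshold :: "nat \<Rightarrow> int poly poly \<Rightarrow> real" where
  "threshold m F = 2 ^ 2 ^ 2 ^ (m + encode_form F)"

text \<open>At precision \<open>n\<close>, read by \<open>Proj 2\<close>, the output stands for the
  exact numerator \<open>2 ^ T * 2 ^ n\<close> of the threshold \<open>2 ^ T\<close>.
  \<open>int_encode\<close> doubles nonnegative integers, hence the \<open>Succ\<close> in the
  exponent.\<close>

definition rec_threshold :: recf where
  "rec_threshold = Comp rec_pow2 [Comp Succ [Comp rec_add [Proj 2,
     Comp rec_pow2 [Comp rec_pow2 [Comp rec_add [Proj 0, Proj 1]]]]]]"

lemma computes_threshold: "computes_from rec_threshold m F \<mu> (threshold m F)"
  unfolding computes_from_def
proof (intro allI impI)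
  fix q :: "nat \<Rightarrow> int" and n :: nat
  define T :: nat where "T = 2 ^ 2 ^ (m + encode_form F)"
  let ?\<phi> = "\<lambda>k. int_encode (q k)" and ?xs = "[m, encode_form F, n]"
  have "rec_eval ?\<phi> (Comp rec_add [Proj 0, Proj 1]) ?xs (m + encode_form F)"
    by (rule rec_comp2[OF _ _ rec_add]) (auto intro: rec_proj)
  then have "rec_eval ?\<phi> (Comp rec_pow2 [Comp rec_pow2 [Comp rec_add [Proj 0, Proj 1]]]) ?xs T"
    unfolding T_def by (intro rec_comp1[OF rec_comp1 rec_pow2]) (auto intro: rec_pow2)
  then have "rec_eval ?\<phi> (Comp rec_add [Proj 2, Comp rec_pow2 [Comp rec_pow2 [Comp rec_add [Proj 0, Proj 1]]]]) ?xs (n + T)"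
    by (rule rec_comp2[OF _ _ rec_add, rotated]) (auto intro: rec_proj)
  then have "rec_eval ?\<phi> rec_threshold ?xs (2 ^ Suc (n + T))"
    unfolding rec_threshold_def by (intro rec_comp1[OF rec_comp1 rec_pow2]) (auto intro: rec_eval.succ)
  moreover have "int_encode (2 ^ T * 2 ^ n) = 2 ^ Suc (n + T)"
    by (simp add: int_encode_def sum_encode_def nat_mult_distrib nat_power_eq power_add mult_ac)
  ultimately have "rec_eval ?\<phi> rec_threshold ?xs (int_encode (2 ^ T * 2 ^ n))" by simp
  moreover have "\<bar>of_int (2 ^ T * 2 ^ n) / 2 ^ n - threshold m F\<bar> \<le> 1 / 2 ^ n"
    by (simp add: threshold_def T_def)
  ultimately show "\<exists>z. rec_eval ?\<phi> rec_threshold ?xs (int_encode z) \<and> \<bar>of_int z / 2 ^ n - threshold m F\<bar> \<le> 1 / 2 ^ n"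
    by blast
qed

section \<open>The code of a form dominates its degree and coefficients\<close>

lemma list_encode_ge_length: "length xs \<le> list_encode xs"
proof (induction xs)
  case (Cons x xs)
  then show ?case using le_prod_encode_2[of "list_encode xs" x] by simp
qed simp

lemma list_encode_ge_elem: "x \<in> set xs \<Longrightarrow> x \<le> list_encode xs"
proof (induction xs)
  case (Cons a xs)
  then show ?case
    using le_prod_encode_1[of a "list_encode xs"] le_prod_encode_2[of "list_encode xs" a] by auto
qed simp

lemma int_encode_ge: "\<bar>z\<bar> \<le> int (int_encode z)"
  by (simp add: int_encode_def sum_encode_def)

lemma encode_form_ge_coeff: "\<bar>coeff (coeff F i) j\<bar> \<le> int (encode_form F)"
proof (cases "coeff (coeff F i) j = 0")
  case False
  define p where "p = coeff F i"
  have "p \<noteq> 0" "coeff p j \<noteq> 0" using False by (auto simp: p_def)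
  then have "coeff p j \<in> set (coeffs p)" by (auto intro: coeff_in_coeffs le_degree)
  then have "int_encode (coeff p j) \<le> list_encode (map int_encode (coeffs p))"
    by (intro list_encode_ge_elem) auto
  also have "p \<in> set (coeffs F)" using \<open>p \<noteq> 0\<close> unfolding p_def by (metis coeff_0 coeff_in_coeffs le_degree)
  then have "list_encode (map int_encode (coeffs p)) \<le> encode_form F"
    unfolding encode_form_def by (intro list_encode_ge_elem) auto
  finally show ?thesis using int_encode_ge[of "coeff p j"] by (simp add: p_def)
qed simp

lemma encode_form_ge_degree: "coeff F i \<noteq> 0 \<Longrightarrow> i < encode_form F"
proof -
  assume "coeff F i \<noteq> 0"
  then have "i < length (coeffs F)"
    using le_degree[of F i] by (cases "F = 0") (auto simp: length_coeffs_degree)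
  also have "\<dots> \<le> encode_form F"
    unfolding encode_form_def
    using list_encode_ge_length[of "map (\<lambda>p. list_encode (map int_encode (coeffs p))) (coeffs F)"] by simp
  finally show ?thesis .
qed

text \<open>From \<open>B\<close> to \<open>Suc B\<close> the left side grows by a factor of at most
  \<open>(6/5) ^ 7 < 4\<close>, while the right side is squared.\<close>

lemma tower_bound: "5 \<le> B \<Longrightarrow> 10000 * B ^ 7 \<le> (2::nat) ^ 2 ^ B"
proof (induction B rule: nat_induct_at_least)
  case base
  then show ?case by simp
next
  case (Suc B)
  have "5 ^ 7 * (Suc B) ^ 7 = (5 * Suc B) ^ 7" by (simp only: power_mult_distrib)
  also have "\<dots> \<le> (6 * B) ^ 7" using Suc.hyps by (intro power_mono) auto
  also have "\<dots> = 6 ^ 7 * B ^ 7" by (simp only: power_mult_distrib)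
  also have "\<dots> \<le> 5 ^ 7 * (4 * B ^ 7)" by simp
  finally have "(Suc B) ^ 7 \<le> 4 * B ^ 7" by simp
  then have "10000 * (Suc B) ^ 7 \<le> 4 * 2 ^ 2 ^ B" using Suc.IH by linarith
  also have "(4 :: nat) \<le> 2 ^ 2 ^ B"
  proof -
    have "(2 :: nat) \<le> 2 ^ B" using Suc.hyps by (intro self_le_power) auto
    then have "(2 :: nat) ^ 2 \<le> 2 ^ 2 ^ B" by (intro power_increasing) auto
    then show ?thesis by simp
  qed
  then have "4 * 2 ^ 2 ^ B \<le> (2::nat) ^ 2 ^ B * 2 ^ 2 ^ B" by (rule mult_right_mono) simp
  also have "\<dots> = 2 ^ 2 ^ Suc B" by (simp flip: power_add mult_2)
  finally show ?case .
qed

lemma threshold_large: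
  assumes "5 \<le> B" "d \<le> B"
  shows "(2 * real B) ^ (10000 * d ^ 6) \<le> 2 ^ 2 ^ 2 ^ B"
proof -
  have "2 * B \<le> 2 ^ B" using assms(1)
  proof (induction B rule: nat_induct_at_least)
    case (Suc n)
    then show ?case by simp
  qed simp
  then have "real (2 * B) \<le> real (2 ^ B)" by (rule of_nat_mono)
  then have "(2 * real B) ^ (10000 * d ^ 6) \<le> (2 ^ B) ^ (10000 * d ^ 6)" by (intro power_mono) auto
  also have "\<dots> = 2 ^ (B * (10000 * d ^ 6))" by (simp add: power_mult)
  also have "\<dots> \<le> 2 ^ 2 ^ 2 ^ B"
  proof (rule power_increasing)
    have "B * (10000 * d ^ 6) \<le> B * (10000 * B ^ 6)" using assms(2) by (intro mult_left_mono power_mono) auto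
    also have "\<dots> = 10000 * B ^ 7" using power_add[of B 1 6] by simp
    also have "\<dots> \<le> 2 ^ 2 ^ B" by (rule tower_bound[OF assms(1)])
    finally show "B * (10000 * d ^ 6) \<le> 2 ^ 2 ^ B" .
  qed simp
  finally show ?thesis .
qed

section \<open>The number of large solutions\<close>

text \<open>\<open>N\<close> takes \<open>p\<close> to \<open>q\<close> as points of the projective
  line; \<open>c\<close> absorbs the square root in the normalization and common factors of the
  image.\<close>

definition linked :: "int poly poly \<Rightarrow> int \<times> int \<Rightarrow> int \<times> int \<Rightarrow> bool" where
  "linked F p q \<longleftrightarrow> (\<exists>N\<in>Aut_enh F. \<exists>c :: complex. c \<noteq> 0 \<and>
     entry N 1 1 * of_int (fst p) + entry N 1 2 * of_int (snd p) = c * of_int (fst q) \<and>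
     entry N 2 1 * of_int (fst p) + entry N 2 2 * of_int (snd p) = c * of_int (snd q))"

lemma coprime_proportional:
  fixes x y x' y' :: int
  assumes "coprime x y" "coprime x' y'" "0 < y" "0 < y'" "x * y' = x' * y"
  shows "x = x'" "y = y'"
proof -
  have "y dvd x * y'" "y' dvd x' * y" using assms(5) by (metis dvd_triv_right)+
  then have "y dvd y'" "y' dvd y"
    using assms(1,2) by (auto simp: coprime_dvd_mult_right_iff coprime_commute)
  then show "y = y'" using assms(3,4) by (metis abs_of_pos zdvd_antisym_abs)
  then show "x = x'" using assms(3,5) by simp
qed

text \<open>\<open>N\<close> and \<open>p\<close> determine \<open>q\<close>, because coprime
  coordinates with positive second entry are determined by their ratio.\<close>

lemma card_linked_le:
  assumes "finite (Aut_enh F)" and T: "\<And>q. q \<in> T \<Longrightarrow> coprime (fst q) (snd q) \<and> 0 < snd q"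
  shows "finite {q \<in> T. linked F p q} \<and> card {q \<in> T. linked F p q} \<le> card (Aut_enh F)"
proof -
  define L where "L = {q \<in> T. linked F p q}"
  have "\<forall>q\<in>L. \<exists>N. N \<in> Aut_enh F \<and> (\<exists>c :: complex. c \<noteq> 0 \<and>
     entry N 1 1 * of_int (fst p) + entry N 1 2 * of_int (snd p) = c * of_int (fst q) \<and>
     entry N 2 1 * of_int (fst p) + entry N 2 2 * of_int (snd p) = c * of_int (snd q))"
    unfolding L_def linked_def by blast
  from bchoice[OF this] obtain N where N: "\<forall>q\<in>L. N q \<in> Aut_enh F \<and> (\<exists>c :: complex. c \<noteq> 0 \<and>
     entry (N q) 1 1 * of_int (fst p) + entry (N q) 1 2 * of_int (snd p) = c * of_int (fst q) \<and>
     entry (N q) 2 1 * of_int (fst p) + entry (N q) 2 2 * of_int (snd p) = c * of_int (snd q))" ..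
  have "inj_on N L"
  proof (rule inj_onI)
    fix q q' assume q: "q \<in> L" "q' \<in> L" and eq: "N q = N q'"
    obtain c c' :: complex where c: "c \<noteq> 0" "c * of_int (fst q) = c' * of_int (fst q')" "c * of_int (snd q) = c' * of_int (snd q')"
      using N q eq by metis
    have "c * of_int (fst q * snd q') = c * of_int (fst q' * snd q)"
    proof -
      have "c * of_int (fst q * snd q') = c' * of_int (snd q') * of_int (fst q')" using c(2) by (simp add: mult_ac)
      also have "\<dots> = c * of_int (fst q' * snd q)" using c(3)[symmetric] by (simp add: mult_ac)
      finally show ?thesis .
    qed
    then have "fst q * snd q' = fst q' * snd q" using c(1) by (simp only: mult_cancel_left of_int_eq_iff) simp
    moreover have "coprime (fst q) (snd q)" "coprime (fst q') (snd q')" "0 < snd q" "0 < snd q'"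
      using T q by (auto simp: L_def)
    ultimately have "fst q = fst q'" "snd q = snd q'" by (metis coprime_proportional)+
    then show "q = q'" by (rule prod_eqI)
  qed
  moreover have "N ` L \<subseteq> Aut_enh F" using N by blast
  ultimately show ?thesis unfolding L_def[symmetric]
    using assms(1) by (meson card_inj_on_le finite_imageD finite_subset)
qed

context galois_form
begin

lemma linkedI:
  assumes "\<alpha> \<in> Z" "\<beta> \<in> Z" "s * v - t * u \<noteq> 0" "of_int s * \<alpha> + of_int u = \<beta> * (of_int t * \<alpha> + of_int v)"
    and y: "y1 \<noteq> 0" "y2 \<noteq> 0" and eq: "y2 * (s * x1 + u * y1) = x2 * (t * x1 + v * y1)"
  shows "linked F (x1, y1) (x2, y2)"
proof -
  define D where "D = s * v - t * u"
  define r where "r = 1 / sqrt (real_of_int \<bar>D\<bar>)"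
  define N where "N = r *\<^sub>R mat2 (of_int s) (of_int u) (of_int t) (of_int v)"
  have N: "N \<in> Aut_enh F" unfolding N_def r_def D_def by (rule Aut_enh_memI[OF assms(1-4)])
  have r: "r \<noteq> 0" using assms(3) by (simp add: r_def D_def[symmetric])
  define c :: complex where "c = of_real r * (of_int (t * x1 + v * y1) / of_int y2)"
  have nz: "t * x1 + v * y1 \<noteq> 0"
  proof
    assume 0: "t * x1 + v * y1 = 0"
    then have 1: "s * x1 + u * y1 = 0" using eq y by simp
    have "(s * v - t * u) * y1 = s * (t * x1 + v * y1) - t * (s * x1 + u * y1)" by (simp add: algebra_simps)
    then show False using 0 1 assms(3) y by simp
  qed
  have e: "of_int (s * x1 + u * y1) = (of_int (t * x1 + v * y1) / of_int y2 * of_int x2 :: complex)"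
  proof -
    have "of_int y2 * of_int (s * x1 + u * y1) = (of_int x2 * of_int (t * x1 + v * y1) :: complex)"
      using eq by (metis of_int_mult)
    then show ?thesis using y by (simp add: field_simps del: of_int_add of_int_mult)
  qed
  have "entry N 1 1 * of_int x1 + entry N 1 2 * of_int y1 = of_real r * of_int (s * x1 + u * y1)"
    "entry N 2 1 * of_int x1 + entry N 2 2 * of_int y1 = of_real r * of_int (t * x1 + v * y1)"
    by (simp_all only: N_def entry_scaleR entry_mat2) (simp_all add: algebra_simps)
  then have "entry N 1 1 * of_int x1 + entry N 1 2 * of_int y1 = c * of_int x2"
    "entry N 2 1 * of_int x1 + entry N 2 2 * of_int y1 = c * of_int y2"
    unfolding e c_def using y by (simp_all only: mult.assoc) (simp del: of_int_add of_int_mult)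
  moreover have "(of_int (t * x1 + v * y1) :: complex) \<noteq> 0" unfolding of_int_eq_0_iff by (rule nz)
  then have "c \<noteq> 0" using r y unfolding c_def by (simp del: of_int_add of_int_mult)
  ultimately show ?thesis unfolding linked_def using N by auto
qed

end

lemma homog_minus: "homog d f (- x) (- y) = (- 1) ^ d * homog d f x y"
proof -
  have "coeff f i * (- x) ^ i * (- y) ^ (d - i) = (- 1) ^ d * (coeff f i * x ^ i * y ^ (d - i))" if "i \<le> d" for i
  proof -
    have "(- 1 :: int) ^ d = (- 1) ^ i * (- 1) ^ (d - i)" using that by (simp flip: power_add)
    then show ?thesis unfolding power_minus[of x] power_minus[of y] by (simp add: mult_ac)
  qed
  then show ?thesis unfolding homog_def sum_distrib_left by (intro sum.cong) auto
qed

locale thue_problem = galois_form +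
  fixes m :: nat
  assumes m: "0 < m"
begin

definition B :: nat where "B = m + encode_form F"

text \<open>\<open>solution_approx\<close> with the constant \<open>2 * B\<close> yields
  approximations with this larger constant, which then takes the place of \<open>C\<close> in
  \<open>galois_approx\<close>.\<close>

definition C2 :: real where "C2 = (2 * real B) ^ (10 * d ^ 3)"

lemma coeff_f_le: "\<bar>coeff f i\<bar> \<le> int B"
  using encode_form_ge_coeff[of F i "d - i"] by (simp add: fF dehom_def B_def)

lemma B_gt: "d < B" "5 \<le> B"
proof -
  have "coeff F d \<noteq> 0"
  proof
    assume "coeff F d = 0"
    then have "coeff f d = 0" by (simp add: fF dehom_def)
    then show False using lc_nz d by simp
  qed
  then have "d < encode_form F" by (rule encode_form_ge_degree)
  then show "d < B" "5 \<le> B" using d_ge m by (simp_all add: B_def)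
qed

lemma bounds: "galois_bounds f Z d (2 * real B)"
proof unfold_locales
  show "4 \<le> 2 * real B" using B_gt(2) by simp
  show "real d \<le> 2 * real B" using B_gt(1) by simp
  have c: "real_of_int \<bar>coeff f i\<bar> \<le> real B" for i using coeff_f_le[of i] by linarith
  show "real_of_int \<bar>coeff f i\<bar> \<le> 2 * real B" for i using c[of i] by linarith
  show "cmod z \<le> 2 * real B" if "z \<in> Z" for z using root_bound[OF c that] B_gt(2) by simp
qed

lemma C2_ge: "2 * real B \<le> C2"
  unfolding C2_def using B_gt(2) d_ge by (intro self_le_power) auto

lemma threshold_C2: "C2 ^ (1000 * d ^ 3) \<le> threshold m F"
proof -
  have "C2 ^ (1000 * d ^ 3) = (2 * real B) ^ (10000 * d ^ 6)"
    unfolding C2_def power_mult[symmetric] using power_add[of d 3 3] by simp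
  then show ?thesis
    using threshold_large[OF B_gt(2) less_imp_le[OF B_gt(1)]] by (simp add: threshold_def B_def)
qed

lemma bounds': assumes "\<alpha> \<in> Z" "\<alpha> \<in> \<real>" shows "galois_approx f Z d C2"
proof -
  interpret b: galois_bounds f Z d "2 * real B" by (rule bounds)
  show ?thesis
  proof unfold_locales
    show "4 \<le> C2" "real d \<le> C2" using b.C4 b.d_le C2_ge by linarith+
    show "real_of_int \<bar>coeff f i\<bar> \<le> C2" for i using b.coeff_le[of i] C2_ge by linarith
    show "cmod z \<le> C2" if "z \<in> Z" for z using b.root_le[OF that] C2_ge by linarith
    show "C2 \<in> \<nat>" unfolding C2_def by (metis of_nat_in_Nats of_nat_mult of_nat_numeral of_nat_power)
    show "Z \<subseteq> \<real>" by (rule Z_real[OF assms])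
  qed
qed

abbreviation "S \<equiv> primitive_solutions m F (threshold m F)"

lemma solution_height:
  assumes "(x, y) \<in> S"
  shows "C2 ^ (1000 * d ^ 3) \<le> real_of_int (height x y)" "C2 * C2 < real_of_int (height x y)"
proof -
  show 1: "C2 ^ (1000 * d ^ 3) \<le> real_of_int (height x y)"
    using assms threshold_C2 by (auto simp: primitive_solutions_def)
  have "1 < C2" using C2_ge B_gt(2) by linarith
  then have "C2 ^ 2 < C2 ^ (1000 * d ^ 3)" using cube_facts(3)[OF d_ge] by (intro power_strict_increasing) auto
  then show "C2 * C2 < real_of_int (height x y)" using 1 by (simp add: power2_eq_square)
qed

lemma solution_near_root:
  assumes "(x, y) \<in> S"
  obtains \<alpha> where "\<alpha> \<in> Z" "\<alpha> \<in> \<real>" "galois_approx.approx Z d C2 \<alpha> x y"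
proof -
  interpret b: galois_bounds f Z d "2 * real B" by (rule bounds)
  have s: "\<bar>homog d f x y\<bar> \<le> int m" "coprime x y"
    using assms by (auto simp: primitive_solutions_def form_eval_int[OF bf] fF)
  have "real_of_int \<bar>homog d f x y\<bar> \<le> 2 * real B" using s(1) by (simp add: B_def)
  from b.solution_approx[OF this s(2)] solution_height(2)[OF assms]
  obtain \<alpha> where \<alpha>: "\<alpha> \<in> Z" "\<alpha> \<in> \<real>" "y \<noteq> 0" "real_of_int (height x y) \<le> C2 * real_of_int \<bar>y\<bar>"
    "cmod (of_int x / of_int y - \<alpha>) \<le> C2 / real_of_int (height x y) ^ d"
    unfolding C2_def by blast
  interpret a: galois_approx f Z d C2 by (rule bounds'[OF \<alpha>(1,2)])
  show thesis by (rule that[OF \<alpha>(1,2)]) (use \<alpha> s(2) in \<open>simp add: a.approx_def\<close>)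
qed

lemma count:
  fixes \<mu> :: real
  assumes "real d / 2 + 1 < \<mu>" "\<mu> < real d"
  defines "g \<equiv> (11.51 + 1.5 * ln (real d) + ln \<mu>) / ln (\<mu> - real d / 2)"
  shows "finite (up_to_sign S) \<and> int (card (up_to_sign S)) \<le> int (card (Aut_enh F)) * \<lfloor>1 + g\<rfloor>"
proof (cases "S = {}")
  \<comment> \<open>Without a solution there need not be a real root, and
    \<open>galois_approx\<close> cannot be interpreted; then nonnegativity of the bound
    suffices.\<close>
  case True
  then show ?thesis using number_of_steps(2)[OF d_ge assms(1,2)] by (simp add: up_to_sign_def g_def)
next
  case False
  then obtain p0 where "p0 \<in> S" by blast
  then obtain \<alpha>0 where "\<alpha>0 \<in> Z" "\<alpha>0 \<in> \<real>" using solution_near_root by (metis surj_pair)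
  then interpret a: galois_approx f Z d C2 by (rule bounds')
  \<comment> \<open>Positive \<open>y\<close> selects one element of each pair of opposite
    solutions; \<open>y = 0\<close> does not occur at such heights.\<close>
  define T where "T = {(x, y) \<in> S. 0 < y}"
  define hn where "hn p = nat (height (fst p) (snd p))" for p :: "int \<times> int"
  have hn: "real (hn p) = real_of_int (height (fst p) (snd p))" for p
    by (simp add: hn_def height_def)
  define K where "K = nat \<lfloor>1 + g\<rfloor>"
  have apx: "\<exists>\<alpha>. a.approx \<alpha> (fst p) (snd p)" if "p \<in> S" for p
    using solution_near_root[of "fst p" "snd p"] that by auto
  have hbig: "1000 * real d ^ 3 * ln C2 \<le> ln (real (hn p))" if "p \<in> S" for p
  proof -
    have "C2 ^ (1000 * d ^ 3) \<le> real (hn p)" using solution_height(1)[of "fst p" "snd p"] that by (simp add: hn)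
    moreover have "0 < C2" using a.C4 by simp
    moreover from this have "0 < C2 ^ (1000 * d ^ 3)" by simp
    ultimately have "ln (C2 ^ (1000 * d ^ 3)) \<le> ln (real (hn p))"
      by (subst ln_le_cancel_iff) linarith+
    then show ?thesis using \<open>0 < C2\<close> by (simp add: ln_realpow)
  qed
  have TS: "T \<subseteq> S" by (auto simp: T_def)
  have "finite T \<and> card T \<le> card (Aut_enh F) * K"
  proof (rule greedy_count[where \<gamma> = "real d / 2 - 1 / 16" and K = "100 * real d ^ 2" and link = "linked F" and hn = hn])
    show "0 < real d / 2 - 1 / 16" using d_ge by simp
    show "100 * real d ^ 2 \<le> (real d / 2 - 1 / 16) ^ K"
      unfolding K_def g_def by (rule number_of_steps(1)[OF d_ge assms(1,2)])
    show "2 \<le> hn p" if "p \<in> T" for p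
    proof -
      have "C2 * C2 < real (hn p)" using solution_height(2)[of "fst p" "snd p"] that TS by (auto simp: hn)
      moreover have "4 * 4 \<le> C2 * C2" using a.C4 by (intro mult_mono) auto
      ultimately show ?thesis by linarith
    qed
    show "ln (real (hn q)) < 100 * real d ^ 2 * ln (real (hn p))" if p: "p \<in> T" and q: "q \<in> T" for p q
    proof -
      obtain \<alpha> \<beta> where "a.approx \<alpha> (fst p) (snd p)" "a.approx \<beta> (fst q) (snd q)" using apx p q TS by blast
      from a.thue_principle[OF this] hbig[of p] p TS show ?thesis by (auto simp: hn)
    qed
    show "(real d / 2 - 1 / 16) * ln (real (hn p)) \<le> ln (real (hn q))"
      if p: "p \<in> T" and q: "q \<in> T" and le: "hn p \<le> hn q" and nl: "\<not> linked F p q" for p q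
    proof (rule ccontr)
      assume neg: "\<not> (real d / 2 - 1 / 16) * ln (real (hn p)) \<le> ln (real (hn q))"
      obtain \<alpha> \<beta> where ap: "a.approx \<alpha> (fst p) (snd p)" "a.approx \<beta> (fst q) (snd q)" using apx p q TS by blast
      note fp = a.approx_facts[OF ap(1)] and fq = a.approx_facts[OF ap(2)]
      have "0 < real (hn p)" using fp(4) by (simp add: hn)
      then have "ln (real (hn p)) \<le> ln (real (hn q))" using le by (subst ln_le_cancel_iff) auto
      then have le': "ln (real_of_int (height (fst p) (snd p))) \<le> ln (real_of_int (height (fst q) (snd q)))"
        by (simp only: hn)
      have lt: "ln (real_of_int (height (fst q) (snd q))) < (real d / 2 - 1 / 16) * ln (real_of_int (height (fst p) (snd p)))"
        using neg by (simp only: hn not_le)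
      show False
      proof (rule a.gap_principle[OF ap hbig[OF subsetD[OF TS p], unfolded hn] le' lt], goal_cases)
        case (1 s u t v)
        then have "linked F (fst p, snd p) (fst q, snd q)"
          by (intro linkedI[OF fp(1) fq(1) _ _ fp(3) fq(3)])
        then show False using nl by simp
      qed
    qed
    show "finite {q \<in> T. linked F p q} \<and> card {q \<in> T. linked F p q} \<le> card (Aut_enh F)" for p
      by (rule card_linked_le[OF finite_Aut_enh]) (auto simp: T_def primitive_solutions_def)
  qed
  moreover have "up_to_sign S \<subseteq> (\<lambda>(x, y). {(x, y), (- x, - y)}) ` T"
  proof
    fix P assume "P \<in> up_to_sign S"
    then obtain x y where xy: "(x, y) \<in> S" "P = {(x, y), (- x, - y)}" by (auto simp: up_to_sign_def)
    obtain \<alpha> where "a.approx \<alpha> x y" using apx[OF xy(1)] by auto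
    then have "y \<noteq> 0" by (rule a.approx_facts(3))
    show "P \<in> (\<lambda>(x, y). {(x, y), (- x, - y)}) ` T"
    proof (cases "0 < y")
      case True
      then show ?thesis using xy by (intro image_eqI[of _ _ "(x, y)"]) (auto simp: T_def)
    next
      case False
      have "\<bar>homog d f (- x) (- y)\<bar> = \<bar>homog d f x y\<bar>" by (simp add: homog_minus abs_mult)
      moreover from this have "homog d f (- x) (- y) = 0 \<longleftrightarrow> homog d f x y = 0" by (metis abs_eq_0_iff)
      ultimately have "(- x, - y) \<in> S"
        using xy(1) by (simp add: primitive_solutions_def form_eval_int[OF bf] fF[symmetric] height_def)
      then have "(- x, - y) \<in> T" using False \<open>y \<noteq> 0\<close> by (simp add: T_def)
      moreover have "P = {(- x, - y), (- (- x), - (- y))}" using xy(2) by auto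
      ultimately show ?thesis by (intro image_eqI[of _ _ "(- x, - y)"]) auto
    qed
  qed
  ultimately have "finite (up_to_sign S)" "card (up_to_sign S) \<le> card (Aut_enh F) * K"
    by (meson finite_imageI finite_subset, meson order.trans surj_card_le)
  then have "int (card (up_to_sign S)) \<le> int (card (Aut_enh F)) * int K" by (metis of_nat_le_iff of_nat_mult)
  moreover have "int K = \<lfloor>1 + g\<rfloor>"
    using number_of_steps(2)[OF d_ge assms(1,2)] by (simp add: K_def g_def)
  ultimately show ?thesis using \<open>finite (up_to_sign S)\<close> by simp
qed

end

theorem theorem1p3:
  "\<exists>(P :: recf) (C\<^sub>5 :: nat \<Rightarrow> int poly poly \<Rightarrow> real \<Rightarrow> real).
     \<forall>(d :: nat) (F :: int poly poly) (\<alpha> :: complex) (m :: nat) (\<mu> :: real).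
       d \<ge> 3 \<longrightarrow> binary_form d F \<longrightarrow> irreducible_form F \<longrightarrow>
       form_eval (map_form of_int F) \<alpha> 1 = 0 \<longrightarrow> galois_ext \<rat> (adjoin \<rat> \<alpha>) \<longrightarrow>
       m > 0 \<longrightarrow> real d / 2 + 1 < \<mu> \<longrightarrow> \<mu> < real d \<longrightarrow>
         computes_from P m F \<mu> (C\<^sub>5 m F \<mu>) \<and> C\<^sub>5 m F \<mu> > 0 \<and>
         finite (up_to_sign (primitive_solutions m F (C\<^sub>5 m F \<mu>))) \<and>
         int (card (up_to_sign (primitive_solutions m F (C\<^sub>5 m F \<mu>))))
           \<le> int (card (Aut_enh F)) *
              \<lfloor>1 + (11.51 + 1.5 * ln (real d) + ln \<mu>) / ln (\<mu> - real d / 2)\<rfloor>"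
proof (intro exI[of _ rec_threshold] exI[of _ "\<lambda>m F \<mu>. threshold m F"] allI impI)
  fix d :: nat and F :: "int poly poly" and \<alpha> :: complex and m :: nat and \<mu> :: real
  assume h: "3 \<le> d" "binary_form d F" "irreducible_form F" "form_eval (map_form of_int F) \<alpha> 1 = 0"
    "galois_ext \<rat> (adjoin \<rat> \<alpha>)" "0 < m" "real d / 2 + 1 < \<mu>" "\<mu> < real d"
  define f where "f = dehom d F"
  define Z where "Z = {z :: complex. poly (of_int_poly f) z = 0}"
  interpret galois_poly f Z d
    unfolding f_def Z_def by (rule galois_poly_dehom[OF h(2,3,1,4,5)])
  interpret thue_problem f Z d F m
    by unfold_locales (use h in \<open>simp_all add: f_def\<close>)
  show "computes_from rec_threshold m F \<mu> (threshold m F) \<and> 0 < threshold m F \<and>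
      finite (up_to_sign (primitive_solutions m F (threshold m F))) \<and>
      int (card (up_to_sign (primitive_solutions m F (threshold m F))))
        \<le> int (card (Aut_enh F)) *
          \<lfloor>1 + (11.51 + 1.5 * ln (real d) + ln \<mu>) / ln (\<mu> - real d / 2)\<rfloor>"
    using computes_threshold count[OF h(7,8)] by (simp add: threshold_def)
qed

end
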